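(* Let $d\ge 1$ be an integer, $\beta=(\beta_0,\dots,\beta_d)^{\mathrm T}\in\mathbb R^{d+1}$, and let $x,\delta,u,\varepsilon$ be real random variables such that: (i) $x,\delta,u,\varepsilon$ are independent; (ii) $\delta,u,\varepsilon$ have zero mean and $\mathbf E[\varepsilon^2+\delta^{2d}+u^{2d}+x^{2d}]<\infty$; (iii) the moments of $\delta$ and $u$ up to order $2d$ are known (they may be used in the estimators); (iv) the distribution of $x$ is not concentrated at $d$ or fewer points; (v) $\mathbf E[x^{4d}+\delta^{4d}+u^{4d}+\varepsilon^4]<\infty$. Put $w=x+\delta$, $\xi=x+u$, $y=\sum_{j=0}^d\beta_j\xi^j+\varepsilon$, and let $(x_i,\delta_i,u_i,\varepsilon_i)$, $i\ge1$, be i.i.d. copies of $(x,\delta,u,\varepsilon)$ with corresponding observations $(w_i,y_i)$. Let $m_x^{(2d)}=(\mathbf E x,\dots,\mathbf E x^{2d})^{\mathrm T}$, $\sigma_\varepsilon^2=\mathbf{Var}(\varepsilon)$, and let $\widehat m_x^{(2d)},\widehat\beta,\widehat\sigma_\varepsilon^2$ be the estimators defined in the context, based on $(w_i,y_i)$, $1\le i\le n$. Then the estimator is asymptotically normal: there is a covariance matrix $\Sigma$ of order $3d+2$ with $$\sqrt n\begin{pmatrix}\widehat m_x^{(2d)}-m_x^{(2d)}\\ \widehat\beta-\beta\\ \widehat\sigma_\varepsilon^2-\sigma_\varepsilon^2\end{pmatrix}\xrightarrow{d}\mathcal N_{3d+2}(0,\Sigma)\qquad(n\to\infty).$$ If,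 in addition, (vi) the support of $\delta$ contains at least $2d$ nonzero points and the support of $\varepsilon$ contains at least $3$ points, then $\Sigma$ is nonsingular.
   Context: A bar denotes averaging over $i=1,\dots,n$, e.g. $\overline{t(w)}=n^{-1}\sum_{i=1}^n t(w_i)$, $\overline{y^2}=n^{-1}\sum_{i=1}^n y_i^2$; for matrices and vectors it is applied entrywise. Polynomials $t_r$, $0\le r\le 2d$: $t_0(w)=1$ and recursively $t_r(w)=w^r-\sum_{i=0}^{r-1}\binom ri\mathbf E[\delta^{r-i}]\,t_i(w)$. Polynomials $g_r$, $0\le r\le 2d$: $g_r(w)=\sum_{j=0}^r\binom rj\mathbf E[u^{r-j}]\,t_j(w)$. Matrices and vectors (rows and columns indexed by $0,\dots,d$): $T(w)=(t_{i+j}(w))_{0\le i,j\le d}$, $G(w)=(g_{i+j}(w))_{0\le i,j\le d}$, $h(w,y)=y\,(t_0(w),t_1(w),\dots,t_d(w))^{\mathrm T}$, $U=\left(\binom ij\mathbf E u^{i-j}\right)_{0\le i,j\le d}$ with $\binom ij=0$ (and zero entry) if $i<j$; $U^{-\mathrm T}=(U^{-1})^{\mathrm T}$. Estimators: $\widehat m_x^{(2d)}=(\overline{t_1(w)},\dots,\overline{t_{2d}(w)})^{\mathrm T}$, $\widehat\beta=U^{-\mathrm T}\,\overline{T(w)}^{\,-1}\,\overline{h(w,y)}$ (defined when $\overline{T(w)}$ is invertible, arbitrarily otherwise), $\widehat\sigma^2_\varepsilon=\overline{y^2}-\widehat\beta^{\mathrm T}\,\overline{G(w)}\,\widehat\beta$.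 *)

theory Defs
  imports
    "HOL-Probability.Probability"
    "Jordan_Normal_Form.Gauss_Jordan_Elimination"
begin

(* Vectors and matrices of size depending on d are those of Jordan_Normal_Form, indexed from 0. *)
unbundle no vec_syntax
hide_const (open) Finite_Cartesian_Product.vec Finite_Cartesian_Product.mat
  Finite_Cartesian_Product.row Finite_Cartesian_Product.column Determinants.det

text \<open>The arguments \<open>md\<close> and \<open>mu\<close> are the known moment sequences of the two errors,
  \<open>md k = E \<delta>\<^sup>k\<close> and \<open>mu k = E u\<^sup>k\<close>.\<close>

fun t_pol :: "(nat \<Rightarrow> real) \<Rightarrow> nat \<Rightarrow> real \<Rightarrow> real" where
  "t_pol md r w = w ^ r - (\<Sum>i<r. real (r choose i) * md (r - i) * t_pol md i w)"

declare t_pol.simps [simp del]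

definition g_pol :: "(nat \<Rightarrow> real) \<Rightarrow> (nat \<Rightarrow> real) \<Rightarrow> nat \<Rightarrow> real \<Rightarrow> real" where
  "g_pol md mu r w = (\<Sum>j\<le>r. real (r choose j) * mu (r - j) * t_pol md j w)"

definition T_mat :: "(nat \<Rightarrow> real) \<Rightarrow> nat \<Rightarrow> real \<Rightarrow> real mat" where
  "T_mat md d w = mat (d + 1) (d + 1) (\<lambda>(i, j). t_pol md (i + j) w)"

definition G_mat :: "(nat \<Rightarrow> real) \<Rightarrow> (nat \<Rightarrow> real) \<Rightarrow> nat \<Rightarrow> real \<Rightarrow> real mat" where
  "G_mat md mu d w = mat (d + 1) (d + 1) (\<lambda>(i, j). g_pol md mu (i + j) w)"

definition h_vec :: "(nat \<Rightarrow> real) \<Rightarrow> nat \<Rightarrow> real \<Rightarrow> real \<Rightarrow> real vec" where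
  "h_vec md d w y = y \<cdot>\<^sub>v vec (d + 1) (\<lambda>j. t_pol md j w)"

text \<open>For \<open>i < j\<close> the entry is zero because the binomial coefficient is.\<close>

definition U_mat :: "(nat \<Rightarrow> real) \<Rightarrow> nat \<Rightarrow> real mat" where
  "U_mat mu d = mat (d + 1) (d + 1) (\<lambda>(i, j). real (i choose j) * mu (i - j))"

definition avg :: "nat \<Rightarrow> (nat \<Rightarrow> real) \<Rightarrow> real" where
  "avg n a = (\<Sum>i=1..n. a i) / real n"

definition avg_vec :: "nat \<Rightarrow> nat \<Rightarrow> (nat \<Rightarrow> real vec) \<Rightarrow> real vec" where
  "avg_vec k n v = vec k (\<lambda>a. avg n (\<lambda>i. v i $ a))"

definition avg_mat :: "nat \<Rightarrow> nat \<Rightarrow> (nat \<Rightarrow> real mat) \<Rightarrow> real mat" where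
  "avg_mat k n A = mat k k (\<lambda>(a, b). avg n (\<lambda>i. A i $$ (a, b)))"

abbreviation inv_mat :: "real mat \<Rightarrow> real mat" where
  "inv_mat A \<equiv> the (mat_inverse A)"

definition mx_hat :: "(nat \<Rightarrow> real) \<Rightarrow> nat \<Rightarrow> nat \<Rightarrow> (nat \<Rightarrow> real) \<Rightarrow> real vec" where
  "mx_hat md d n w = vec (2 * d) (\<lambda>k. avg n (\<lambda>i. t_pol md (k + 1) (w i)))"

text \<open>\<open>b0\<close> is the arbitrary value of the estimator when the averaged matrix is singular.\<close>

definition beta_hat ::
  "(nat \<Rightarrow> real) \<Rightarrow> (nat \<Rightarrow> real) \<Rightarrow> nat \<Rightarrow> real vec \<Rightarrow> nat \<Rightarrow> (nat \<Rightarrow> real) \<Rightarrow> (nat \<Rightarrow> real) \<Rightarrow> real vec" where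
  "beta_hat md mu d b0 n w y =
     (let Tbar = avg_mat (d + 1) n (\<lambda>i. T_mat md d (w i));
          hbar = avg_vec (d + 1) n (\<lambda>i. h_vec md d (w i) (y i))
      in if invertible_mat Tbar
         then transpose_mat (inv_mat (U_mat mu d)) *\<^sub>v (inv_mat Tbar *\<^sub>v hbar)
         else b0)"

definition sigma2_hat ::
  "(nat \<Rightarrow> real) \<Rightarrow> (nat \<Rightarrow> real) \<Rightarrow> nat \<Rightarrow> real vec \<Rightarrow> nat \<Rightarrow> (nat \<Rightarrow> real) \<Rightarrow> (nat \<Rightarrow> real) \<Rightarrow> real" where
  "sigma2_hat md mu d b0 n w y =
     (let bh = beta_hat md mu d b0 n w y
      in avg n (\<lambda>i. (y i)\<^sup>2)
         - bh \<bullet> (avg_mat (d + 1) n (\<lambda>i. G_mat md mu d (w i)) *\<^sub>v bh))"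

text \<open>As a measurable and as a topological space, \<open>k\<close>-dimensional space is the product of
  \<open>k\<close> copies of the real line indexed by \<open>{..<k}\<close>.\<close>

definition coords :: "nat \<Rightarrow> real vec \<Rightarrow> nat \<Rightarrow> real" where
  "coords k v = (\<lambda>i\<in>{..<k}. v $ i)"

definition converges_in_distribution ::
  "'a measure \<Rightarrow> nat \<Rightarrow> (nat \<Rightarrow> 'a \<Rightarrow> real vec) \<Rightarrow> (nat \<Rightarrow> real) measure \<Rightarrow> bool" where
  "converges_in_distribution M k X N \<longleftrightarrow>
     (\<forall>n. (\<forall>\<omega>. X n \<omega> \<in> carrier_vec k) \<and>
          (\<lambda>\<omega>. coords k (X n \<omega>)) \<in> measurable M (\<Pi>\<^sub>M i\<in>{..<k}. borel)) \<and>
     (\<forall>f. continuous_map (product_topology (\<lambda>_. euclideanreal) {..<k}) euclideanreal f \<longrightarrow>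
          bounded (f ` (\<Pi>\<^sub>E i\<in>{..<k}. UNIV)) \<longrightarrow>
          (\<lambda>n. \<integral>\<omega>. f (coords k (X n \<omega>)) \<partial>M) \<longlonglongrightarrow> (\<integral>z. f z \<partial>N))"

definition covariance_mat :: "nat \<Rightarrow> real mat \<Rightarrow> bool" where
  "covariance_mat k S \<longleftrightarrow>
     S \<in> carrier_mat k k \<and> transpose_mat S = S \<and> (\<forall>a\<in>carrier_vec k. 0 \<le> a \<bullet> (S *\<^sub>v a))"

text \<open>The second argument is the variance; variance zero gives a point mass.\<close>

definition normal_law :: "real \<Rightarrow> real \<Rightarrow> real measure" where
  "normal_law m v =
     (if v = 0 then return borel m else density lborel (normal_density m (sqrt v)))"

text \<open>\<open>N\<close> is the normal law with mean \<open>m\<close> and possibly singular covariance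
  matrix \<open>S\<close>: every linear functional is normally distributed with the corresponding mean
  and variance. Such an \<open>N\<close> is unique by the Cramer-Wold theorem.\<close>

definition multivariate_normal :: "nat \<Rightarrow> real vec \<Rightarrow> real mat \<Rightarrow> (nat \<Rightarrow> real) measure \<Rightarrow> bool" where
  "multivariate_normal k m S N \<longleftrightarrow>
     m \<in> carrier_vec k \<and> covariance_mat k S \<and> sets N = sets (\<Pi>\<^sub>M i\<in>{..<k}. borel) \<and>
     (\<forall>a\<in>carrier_vec k.
        distr N borel (\<lambda>z. \<Sum>i<k. a $ i * z i) = normal_law (a \<bullet> m) (a \<bullet> (S *\<^sub>v a)))"

definition support_of :: "'a::topological_space measure \<Rightarrow> 'a set" where
  "support_of N = {z. \<forall>V. open V \<longrightarrow> z \<in> V \<longrightarrow> 0 < emeasure N V}"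

end

theory Submission
  imports Defs "Jordan_Normal_Form.Determinant"
begin

text \<open>Each estimator is a smooth function of averages of i.i.d. terms. With
  \<open>b = U\<^sup>T \<beta>\<close> and \<open>H\<close> the moment matrix of \<open>x\<close>, one has
  \<open>T (T\<^sup>-\<^sup>1 h - b) = h - T b\<close> for the averaged \<open>T\<close> and \<open>h\<close>, where \<open>h - T b\<close> averages centred terms because
  \<open>t\<^sub>r(w)\<close> is conditionally unbiased for \<open>x\<^sup>r\<close>. Hence the estimation error is the average of explicit influence
  functions \<open>\<psi>\<^sub>j\<close>, up to a remainder quadratic in the deviations of the averages, whose second moments are \<open>O(1/n)\<close>.
  Characteristic functions of linear functionals then converge by the one-dimensional central limit
  theorem. They determine the limit: after the substitution \<open>s\<^sub>j = sin(z\<^sub>j/c)\<close>, Stone-Weierstrass on a cube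
  approximates a bounded continuous function, locally uniformly and boundedly, by trigonometric polynomials.

  If a linear combination of the \<open>\<psi>\<^sub>j\<close> vanishes almost surely, then it is, conditionally on \<open>(x, \<delta>, u)\<close>, a
  quadratic polynomial in \<open>\<epsilon>\<close> with three zeros. Its coefficients vanish one after the other; what remains
  is a polynomial of degree at most \<open>2d\<close> in \<open>w = x + \<delta>\<close>, which has at least \<open>2d + 1\<close> zeros.\<close>

text \<open>Nothing bounds the moments of the regression estimator: the averaged \<open>T\<close>
  may be nearly singular, and where it is singular the value is arbitrary. The remainder is
  therefore estimated only where the deviations of the averages are at most a fixed \<eta>.
  Elsewhere a difference of two values of \<open>iexp\<close> costs at most 2, and Chebyshev's
  inequality makes that event cost O(1/n). On the good event the remainder is sqrt(n) times a square
  of mean O(1/n). Assumption (v) enters through square integrability of every averaged summand: each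
  has degree at most 2d in x and the errors when \<epsilon> counts d. The sine substitution serves a
  bound on the whole space. An approximation that is good only on a cube says nothing about the size
  of a trigonometric polynomial outside it, whereas a function of the sin(z_j/c) is controlled
  everywhere by its values on a compact cube. The mass far out is then controlled by one-dimensional
  marginals. \<Sigma> may be singular, so degenerate normal laws have to be constructed and the
  central limit theorem has to include variance zero.\<close>

no_notation inner (infix "\<bullet>" 70)

subsection \<open>The Cramer-Wold device\<close>

text \<open>Real trigonometric polynomials with arbitrary frequency vectors. The free phase covers
  sines as well as cosines, so one kind of generator suffices, and integrals of members are
  determined by the characteristic function.\<close>

inductive_set trig_span :: "nat \<Rightarrow> ((nat \<Rightarrow> real) \<Rightarrow> real) set" for k where
  cos: "(\<lambda>z. cos ((\<Sum>j<k. t j * z j) + \<phi>)) \<in> trig_span k"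
| add: "f \<in> trig_span k \<Longrightarrow> g \<in> trig_span k \<Longrightarrow> (\<lambda>z. f z + g z) \<in> trig_span k"
| scale: "f \<in> trig_span k \<Longrightarrow> (\<lambda>z. c * f z) \<in> trig_span k"

text \<open>The product-to-sum formula for cosines, extended by bilinearity. It makes the span an
  algebra, as Stone-Weierstrass requires.\<close>

lemma trig_span_mult:
  assumes "f \<in> trig_span k" "g \<in> trig_span k"
  shows "(\<lambda>z. f z * g z) \<in> trig_span k"
  using assms(1)
proof induction
  case (cos t \<phi>)
  from assms(2) show ?case
  proof induction
    case (cos s \<psi>)
    have eq: "(\<lambda>z. cos ((\<Sum>j<k. t j * z j) + \<phi>) * cos ((\<Sum>j<k. s j * z j) + \<psi>)) =
      (\<lambda>z. 1/2 * cos ((\<Sum>j<k. (t j - s j) * z j) + (\<phi> - \<psi>)) +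
           1/2 * cos ((\<Sum>j<k. (t j + s j) * z j) + (\<phi> + \<psi>)))"
      by (rule ext) (simp add: cos_times_cos algebra_simps sum.distrib sum_subtractf
          flip: diff_conv_add_uminus)
    show ?case unfolding eq by (intro trig_span.intros)
  next
    case (add f g)
    then show ?case by (simp add: distrib_left trig_span.add)
  next
    case (scale g c)
    then show ?case using trig_span.scale[OF scale.IH, of c] by (simp add: mult.left_commute)
  qed
next
  case (add f g)
  then show ?case by (simp add: distrib_right trig_span.add)
next
  case (scale f c)
  then show ?case using trig_span.scale[OF scale.IH, of c] by (simp add: mult.assoc)
qed

lemma trig_span_const: "(\<lambda>_. c) \<in> trig_span k"
  using trig_span.scale[OF trig_span.cos[where t="\<lambda>_. 0" and \<phi>=0], of c] by simp

text \<open>Phase -pi/2 turns a cosine into a sine. These functions become the coordinates of the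
  cube in the approximation lemma.\<close>

lemma trig_span_sin:
  assumes "j < k"
  shows "(\<lambda>z. sin (z j / c)) \<in> trig_span k"
proof -
  have "(\<Sum>i<k. (if i = j then 1 / c else 0) * z i) = z j / c" for z :: "nat \<Rightarrow> real"
    using assms by (simp add: if_distrib[where f="\<lambda>x. x * _"] cong: if_cong)
  then show ?thesis
    using trig_span.cos[where k=k and t="\<lambda>i. if i = j then 1 / c else 0" and \<phi>="- pi / 2"]
    by (simp add: cos_diff)
qed

lemma trig_span_bounded:
  assumes "f \<in> trig_span k"
  shows "\<exists>B. \<forall>z. \<bar>f z\<bar> \<le> B"
  using assms
proof induction
  case (cos t \<phi>)
  show ?case using abs_cos_le_one by blast
next
  case (add f g)
  then obtain B C where "\<And>z. \<bar>f z\<bar> \<le> B" "\<And>z. \<bar>g z\<bar> \<le> C" by blast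
  then have "\<bar>f z + g z\<bar> \<le> B + C" for z
    by (metis abs_triangle_ineq add_mono order_trans)
  then show ?case by blast
next
  case (scale f c)
  then obtain B where "\<And>z. \<bar>f z\<bar> \<le> B" by blast
  then have "\<bar>c * f z\<bar> \<le> \<bar>c\<bar> * B" for z by (simp add: abs_mult mult_left_mono)
  then show ?case by blast
qed

lemma trig_span_measurable:
  assumes "f \<in> trig_span k" and X: "\<And>j. j < k \<Longrightarrow> (\<lambda>\<omega>. X \<omega> j) \<in> borel_measurable M"
  shows "(\<lambda>\<omega>. f (X \<omega>)) \<in> borel_measurable M"
  using assms(1)
proof induction
  case (cos t \<phi>)
  have [measurable]: "(\<lambda>\<omega>. \<Sum>j<k. t j * X \<omega> j) \<in> borel_measurable M"
    using X by (intro borel_measurable_sum borel_measurable_times) auto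
  show ?case by measurable
qed auto

lemma trig_span_integrable:
  assumes "f \<in> trig_span k" "prob_space M" "\<And>j. j < k \<Longrightarrow> (\<lambda>\<omega>. X \<omega> j) \<in> borel_measurable M"
  shows "integrable M (\<lambda>\<omega>. f (X \<omega>))"
proof -
  interpret prob_space M by fact
  obtain B where "\<And>z. \<bar>f z\<bar> \<le> B" using trig_span_bounded[OF assms(1)] by blast
  then show ?thesis
    using trig_span_measurable[OF assms(1,3)] by (intro integrable_const_bound[where B=B]) auto
qed

lemma trig_span_integral_tendsto:
  assumes f: "f \<in> trig_span k" and M: "prob_space M" and N: "prob_space N"
    and X: "\<And>n j. j < k \<Longrightarrow> (\<lambda>\<omega>. X n \<omega> j) \<in> borel_measurable M"
    and Z: "\<And>j. j < k \<Longrightarrow> (\<lambda>z. z j) \<in> borel_measurable N"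
    and chr: "\<And>t. (\<lambda>n. \<integral>\<omega>. iexp (\<Sum>j<k. t j * X n \<omega> j) \<partial>M) \<longlonglongrightarrow> (\<integral>z. iexp (\<Sum>j<k. t j * z j) \<partial>N)"
  shows "(\<lambda>n. \<integral>\<omega>. f (X n \<omega>) \<partial>M) \<longlonglongrightarrow> (\<integral>z. f z \<partial>N)"
  using f
proof induction
  case (cos t \<phi>)
  \<comment> \<open>A cosine with phase is the real part of \<open>iexp \<phi>\<close> times an
    exponential. The identity is stated for a generic measure because it is applied to both
    \<open>M\<close> and \<open>N\<close>.\<close>
  have eq: "(\<integral>\<omega>. cos ((\<Sum>j<k. t j * Y \<omega> j) + \<phi>) \<partial>M) = Re (iexp \<phi> * (\<integral>\<omega>. iexp (\<Sum>j<k. t j * Y \<omega> j) \<partial>M))"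
    if "prob_space M" and Y: "\<And>j. j < k \<Longrightarrow> (\<lambda>\<omega>. Y \<omega> j) \<in> borel_measurable M"
    for M :: "'c measure" and Y :: "'c \<Rightarrow> nat \<Rightarrow> real"
  proof -
    interpret prob_space M by fact
    have [measurable]: "(\<lambda>\<omega>. \<Sum>j<k. t j * Y \<omega> j) \<in> borel_measurable M"
      using Y by (intro borel_measurable_sum) auto
    have int: "integrable M (\<lambda>\<omega>. iexp \<phi> * iexp (\<Sum>j<k. t j * Y \<omega> j))"
      by (intro integrable_mult_right integrable_iexp) (simp_all del: of_real_sum)
    have "(\<integral>\<omega>. cos ((\<Sum>j<k. t j * Y \<omega> j) + \<phi>) \<partial>M) = (\<integral>\<omega>. Re (iexp \<phi> * iexp (\<Sum>j<k. t j * Y \<omega> j)) \<partial>M)"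
      by (intro Bochner_Integration.integral_cong refl)
        (simp add: cos_add algebra_simps Re_exp Im_exp del: of_real_sum)
    also have "\<dots> = Re (iexp \<phi> * (\<integral>\<omega>. iexp (\<Sum>j<k. t j * Y \<omega> j) \<partial>M))"
      using integral_Re[OF int] by simp
    finally show ?thesis .
  qed
  have X': "(\<integral>\<omega>. cos ((\<Sum>j<k. t j * X n \<omega> j) + \<phi>) \<partial>M) = Re (iexp \<phi> * (\<integral>\<omega>. iexp (\<Sum>j<k. t j * X n \<omega> j) \<partial>M))" for n
    by (rule eq[OF M X])
  have Z': "(\<integral>z. cos ((\<Sum>j<k. t j * z j) + \<phi>) \<partial>N) = Re (iexp \<phi> * (\<integral>z. iexp (\<Sum>j<k. t j * z j) \<partial>N))"
    by (rule eq[OF N Z])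
  show ?case
    unfolding X' Z' by (intro tendsto_Re tendsto_mult tendsto_const chr)
next
  case (add f g)
  then show ?case
    using trig_span_integrable[OF add.hyps(1) M X] trig_span_integrable[OF add.hyps(2) M X]
      trig_span_integrable[OF add.hyps(1) N Z] trig_span_integrable[OF add.hyps(2) N Z]
    by (auto intro: tendsto_add)
next
  case (scale f c)
  then show ?case by (auto intro: tendsto_mult_left)
qed

text \<open>The ramp vanishes for |Z| <= L and equals 1 for |Z| >= L + 1. Unlike the indicator of a
  tail it is continuous, so weak convergence applies to it directly.\<close>

lemma tail_cutoff_tendsto_zero:
  assumes "prob_space N" "Z \<in> borel_measurable N"
  shows "(\<lambda>L. \<integral>z. min 1 (max 0 (\<bar>Z z\<bar> - real L)) \<partial>N) \<longlonglongrightarrow> 0"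
proof -
  interpret prob_space N by fact
  note [measurable] = assms(2)
  have "(\<lambda>L. \<integral>z. min 1 (max 0 (\<bar>Z z\<bar> - real L)) \<partial>N) \<longlonglongrightarrow> (\<integral>z. (0::real) \<partial>N)"
  proof (rule integral_dominated_convergence[where w="\<lambda>_. 1"])
    show "AE z in N. (\<lambda>L. min 1 (max 0 (\<bar>Z z\<bar> - real L))) \<longlonglongrightarrow> 0"
    proof (intro AE_I2 tendsto_eventually)
      fix z
      have "\<forall>\<^sub>F L in sequentially. \<bar>Z z\<bar> \<le> real L"
        using real_arch_simple[of "\<bar>Z z\<bar>"] eventually_sequentially
        by (metis of_nat_mono order_trans)
      then show "\<forall>\<^sub>F L in sequentially. min 1 (max 0 (\<bar>Z z\<bar> - real L)) = 0"
        by eventually_elim simp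
    qed
  qed auto
  then show ?thesis by simp
qed

text \<open>Levy's continuity theorem on the line, applied to a single coordinate. This supplies the
  tightness for the multivariate argument.\<close>

lemma marginal_cutoff_tendsto:
  assumes M: "prob_space M" and N: "prob_space N"
    and X: "\<And>n. X n \<in> borel_measurable M" and Z: "Z \<in> borel_measurable N"
    and chr: "\<And>t. (\<lambda>n. \<integral>\<omega>. iexp (t * X n \<omega>) \<partial>M) \<longlonglongrightarrow> (\<integral>z. iexp (t * Z z) \<partial>N)"
  shows "(\<lambda>n. \<integral>\<omega>. min 1 (max 0 (\<bar>X n \<omega>\<bar> - L)) \<partial>M) \<longlonglongrightarrow> (\<integral>z. min 1 (max 0 (\<bar>Z z\<bar> - L)) \<partial>N)"
proof -
  note [measurable] = X Z
  interpret M: prob_space M by fact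
  interpret N: prob_space N by fact
  have rM: "real_distribution (distr M borel (X n))" for n
    by (simp add: real_distribution_def real_distribution_axioms_def M.prob_space_distr)
  have rN: "real_distribution (distr N borel Z)"
    by (simp add: real_distribution_def real_distribution_axioms_def N.prob_space_distr)
  have conv: "weak_conv_m (\<lambda>n. distr M borel (X n)) (distr N borel Z)"
    using chr by (intro levy_continuity rM rN) (simp add: char_def integral_distr)
  have "(\<lambda>n. \<integral>x. min 1 (max 0 (\<bar>x\<bar> - L)) \<partial>distr M borel (X n)) \<longlonglongrightarrow> (\<integral>x. min 1 (max 0 (\<bar>x\<bar> - L)) \<partial>distr N borel Z)"
    by (rule weak_conv_imp_integral_bdd_continuous_conv[OF rM rN conv, where B=1])
      (intro continuous_intros, simp)
  then show ?thesis by (simp add: integral_distr)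
qed

text \<open>Coordinates from k on are frozen at zero, which makes the k-dimensional cube a compact
  subset of the full function space by Tychonoff's theorem.\<close>

lemma compact_cube:
  "compact {s :: nat \<Rightarrow> real. (\<forall>j<k. s j \<in> {-1..1}) \<and> (\<forall>j\<ge>k. s j = 0)}"
proof -
  have "{s :: nat \<Rightarrow> real. (\<forall>j<k. s j \<in> {-1..1}) \<and> (\<forall>j\<ge>k. s j = 0)} =
      (\<Pi>\<^sub>E j\<in>UNIV. if j < k then {-1..1} else {0})"
    unfolding PiE_UNIV_domain Pi_def by (rule Collect_cong) (metis UNIV_I leI less_le_not_le singleton_iff)
  moreover have "compactin (product_topology (\<lambda>i. euclidean) UNIV) (\<Pi>\<^sub>E j\<in>UNIV. if j < k then {-1..1::real} else {0})"
    by (simp add: compactin_PiE)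
  ultimately show ?thesis by (simp add: euclidean_product_topology)
qed

text \<open>The error bound holds on the whole space: far out, g is bounded by B, the approximant is
  within e of some value of g, and the sum of ramps is at least 1.\<close>

lemma bounded_continuous_approx_trig_span:
  fixes g :: "(nat \<Rightarrow> real) \<Rightarrow> real"
  assumes g: "continuous_on UNIV g" and bnd: "\<And>z. \<bar>g z\<bar> \<le> B"
    and dep: "\<And>z z'. (\<And>j. j < k \<Longrightarrow> z j = z' j) \<Longrightarrow> g z = g z'"
    and e: "e > 0" and L: "L \<ge> 0"
  obtains q where "q \<in> trig_span k"
    "\<And>z. \<bar>g z - q z\<bar> \<le> e + 2 * B * (\<Sum>j<k. min 1 (max 0 (\<bar>z j\<bar> - L)))"
proof -
  \<comment> \<open>With this scale |z_j| <= L + 1 means that z_j/c lies in [-pi/2, pi/2], where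
    arcsin inverts sin.\<close>
  define c where "c = 2 * (L + 1) / pi"
  have c: "c > 0" using L by (simp add: c_def)
  define S where "S = {s :: nat \<Rightarrow> real. (\<forall>j<k. s j \<in> {-1..1}) \<and> (\<forall>j\<ge>k. s j = 0)}"
  define \<sigma> where "\<sigma> z = (\<lambda>j. if j < k then sin (z j / c) else 0)" for z :: "nat \<Rightarrow> real"
  \<comment> \<open>Functions on the cube whose pullback along the sine map is a trigonometric
    polynomial; Stone-Weierstrass is applied to this algebra.\<close>
  define R where "R = {q. continuous_on S q \<and> (\<lambda>z. q (\<sigma> z)) \<in> trig_span k}"
  \<comment> \<open>\<open>F\<close> carries g to the cube. Pulled back, it equals g as long as all
    |z_j| <= L + 1, and otherwise it is still some value of g, hence bounded by B.\<close>
  define F where "F s = g (\<lambda>j. if j < k then c * arcsin (s j) else 0)" for s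
  interpret function_ring_on R S
  proof
    show "compact S" unfolding S_def by (rule compact_cube)
    show "\<exists>f\<in>R. f x \<noteq> f y" if "x \<in> S" "y \<in> S" "x \<noteq> y" for x y
    proof -
      from that(3) obtain j where j: "x j \<noteq> y j" by (auto simp: fun_eq_iff)
      then have "j < k" using that(1,2) unfolding S_def by (cases "j < k") auto
      note j = j this
      have "(\<lambda>s. s j) \<in> R"
        using trig_span_sin[OF j(2), of c] j(2) unfolding R_def \<sigma>_def
        by (simp add: continuous_on_subset[OF continuous_on_product_coordinates])
      with j(1) show ?thesis by (intro bexI[of _ "\<lambda>s. s j"])
    qed
    show "continuous_on S f" if "f \<in> R" for f using that by (simp add: R_def)
    show "(\<lambda>x. f x + g x) \<in> R" if "f \<in> R" "g \<in> R" for f g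
      using that trig_span.add[of "\<lambda>z. f (\<sigma> z)" k "\<lambda>z. g (\<sigma> z)"]
      by (simp add: R_def continuous_on_add)
    show "(\<lambda>x. f x * g x) \<in> R" if "f \<in> R" "g \<in> R" for f g
      using that trig_span_mult[of "\<lambda>z. f (\<sigma> z)" k "\<lambda>z. g (\<sigma> z)"]
      by (simp add: R_def continuous_on_mult)
    show "(\<lambda>_. c) \<in> R" for c
      by (simp add: R_def trig_span_const)
  qed
  have "continuous_on S F"
    unfolding F_def
  proof (rule continuous_on_compose2[OF g], rule continuous_on_coordinatewise_then_product)
    fix j
    show "continuous_on S (\<lambda>s. if j < k then c * arcsin (s j) else 0)"
    proof (cases "j < k")
      case True
      have "continuous_on S (\<lambda>s. s j)"
        by (rule continuous_on_subset[OF continuous_on_product_coordinates]) simp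
      with True show ?thesis
        by (simp, intro continuous_on_mult continuous_on_const continuous_on_arcsin) (auto simp: S_def)
    qed simp
  qed simp
  from Stone_Weierstrass_basic[OF this e] obtain Q
    where Q: "Q \<in> R" "\<And>s. s \<in> S \<Longrightarrow> \<bar>F s - Q s\<bar> < e" by blast
  show thesis
  proof
    show "(\<lambda>z. Q (\<sigma> z)) \<in> trig_span k" using Q(1) by (simp add: R_def)
    fix z :: "nat \<Rightarrow> real"
    have "\<sigma> z \<in> S" by (auto simp: \<sigma>_def S_def)
    from Q(2)[OF this] have 1: "\<bar>F (\<sigma> z) - Q (\<sigma> z)\<bar> < e" .
    have nn: "min 1 (max 0 (\<bar>z j\<bar> - L)) \<ge> 0" for j by simp
    have B: "B \<ge> 0" using bnd[of z] by linarith
    have "\<bar>g z - F (\<sigma> z)\<bar> \<le> 2 * B * (\<Sum>j<k. min 1 (max 0 (\<bar>z j\<bar> - L)))"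
    proof (cases "\<exists>j<k. \<bar>z j\<bar> > L + 1")
      case True
      \<comment> \<open>Here only the trivial bound 2 B is available, and one saturated ramp pays
        for it.\<close>
      then obtain j where j: "j < k" "\<bar>z j\<bar> > L + 1" by blast
      have "1 = min 1 (max 0 (\<bar>z j\<bar> - L))" using j by simp
      also have "\<dots> \<le> (\<Sum>j<k. min 1 (max 0 (\<bar>z j\<bar> - L)))"
        using j(1) nn by (intro member_le_sum) auto
      finally have "2 * B * 1 \<le> 2 * B * (\<Sum>j<k. min 1 (max 0 (\<bar>z j\<bar> - L)))"
        using B by (intro mult_left_mono) auto
      moreover have "\<bar>g z - F (\<sigma> z)\<bar> \<le> 2 * B"
        using abs_triangle_ineq4[of "g z" "F (\<sigma> z)"] add_mono[OF bnd[of z] bnd[of "\<lambda>j. if j < k then c * arcsin (\<sigma> z j) else 0"]]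
        by (simp add: F_def)
      ultimately show ?thesis by linarith
    next
      case False
      have "F (\<sigma> z) = g z"
        unfolding F_def
      proof (rule dep)
        fix j assume j: "j < k"
        with False have "\<bar>z j\<bar> \<le> L + 1" by (meson not_le)
        then have "\<bar>z j\<bar> / c \<le> (L + 1) / c" using c by (intro divide_right_mono) auto
        moreover have "(L + 1) / c = pi / 2" using L by (simp add: c_def field_simps)
        ultimately have "\<bar>z j / c\<bar> \<le> pi / 2" using c by simp
        then have "arcsin (sin (z j / c)) = z j / c"
          by (intro arcsin_sin) (simp_all only: abs_le_iff minus_le_iff)
        then show "(if j < k then c * arcsin (\<sigma> z j) else 0) = z j" using j c by (simp add: \<sigma>_def)
      qed
      moreover have "0 \<le> 2 * B * (\<Sum>j<k. min 1 (max 0 (\<bar>z j\<bar> - L)))"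
        using B by (intro mult_nonneg_nonneg sum_nonneg) auto
      ultimately show ?thesis by simp
    qed
    with 1 show "\<bar>g z - Q (\<sigma> z)\<bar> \<le> e + 2 * B * (\<Sum>j<k. min 1 (max 0 (\<bar>z j\<bar> - L)))"
      by linarith
  qed
qed

lemma integral_diff_le_integral:
  assumes "integrable M f" "integrable M g" "integrable M h" "\<And>x. \<bar>f x - g x\<bar> \<le> (h x :: real)"
  shows "\<bar>(\<integral>x. f x \<partial>M) - (\<integral>x. g x \<partial>M)\<bar> \<le> (\<integral>x. h x \<partial>M)"
proof -
  have "\<bar>(\<integral>x. f x \<partial>M) - (\<integral>x. g x \<partial>M)\<bar> = \<bar>\<integral>x. f x - g x \<partial>M\<bar>" using assms by simp
  also have "\<dots> \<le> (\<integral>x. \<bar>f x - g x\<bar> \<partial>M)" by (rule integral_abs_bound)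
  also have "\<dots> \<le> (\<integral>x. h x \<partial>M)" using assms by (intro integral_mono) auto
  finally show ?thesis .
qed

text \<open>A trigonometric polynomial replaces g under \<open>M\<close> and under \<open>N\<close>,
  with an error made of ramps. The ramps are small under \<open>N\<close> for large L, hence
  eventually small under \<open>M\<close> by convergence of the marginals.\<close>

theorem cramer_wold:
  fixes g :: "(nat \<Rightarrow> real) \<Rightarrow> real" and X :: "nat \<Rightarrow> 'a \<Rightarrow> nat \<Rightarrow> real"
  assumes M: "prob_space M" and N: "prob_space N"
    and X: "\<And>n j. j < k \<Longrightarrow> (\<lambda>\<omega>. X n \<omega> j) \<in> borel_measurable M"
    and Z: "\<And>j. j < k \<Longrightarrow> (\<lambda>z. z j) \<in> borel_measurable N"
    and chr: "\<And>t. (\<lambda>n. \<integral>\<omega>. iexp (\<Sum>j<k. t j * X n \<omega> j) \<partial>M) \<longlonglongrightarrow> (\<integral>z. iexp (\<Sum>j<k. t j * z j) \<partial>N)"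
    and g: "continuous_on UNIV g" and bnd: "\<And>z. \<bar>g z\<bar> \<le> B"
    and dep: "\<And>z z'. (\<And>j. j < k \<Longrightarrow> z j = z' j) \<Longrightarrow> g z = g z'"
    and gX: "\<And>n. (\<lambda>\<omega>. g (X n \<omega>)) \<in> borel_measurable M" and gN: "g \<in> borel_measurable N"
  shows "(\<lambda>n. \<integral>\<omega>. g (X n \<omega>) \<partial>M) \<longlonglongrightarrow> (\<integral>z. g z \<partial>N)"
proof (rule LIMSEQ_I)
  fix r :: real assume r: "r > 0"
  interpret M: prob_space M by fact
  interpret N: prob_space N by fact
  note [measurable] = gX gN
  define h where "h L z = (\<Sum>j<k. min 1 (max 0 (\<bar>z j\<bar> - L)))" for L :: real and z :: "nat \<Rightarrow> real"
  have B: "B \<ge> 0" using bnd[of "\<lambda>_. 0"] by linarith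
  have intX: "integrable M (\<lambda>\<omega>. min 1 (max 0 (\<bar>X n \<omega> j\<bar> - L)))" if "j < k" for j n L
    using X[OF that] by (intro M.integrable_const_bound[where B=1]) auto
  have intN: "integrable N (\<lambda>z. min 1 (max 0 (\<bar>z j\<bar> - L)))" if "j < k" for j L
    using Z[OF that] by (intro N.integrable_const_bound[where B=1]) auto
  have inthX: "integrable M (\<lambda>\<omega>. h L (X n \<omega>))" for L n
    unfolding h_def by (intro Bochner_Integration.integrable_sum intX) simp
  have inthN: "integrable N (h L)" for L
    unfolding h_def by (intro Bochner_Integration.integrable_sum intN) simp
  have hN: "(\<lambda>L. \<integral>z. h (real L) z \<partial>N) \<longlonglongrightarrow> 0"
  proof -
    have "(\<lambda>L. \<Sum>j<k. \<integral>z. min 1 (max 0 (\<bar>z j\<bar> - real L)) \<partial>N) \<longlonglongrightarrow> (\<Sum>j<k. 0)"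
      by (intro tendsto_sum tail_cutoff_tendsto_zero[OF N] Z) simp
    then show ?thesis unfolding h_def by (subst Bochner_Integration.integral_sum) (auto intro: intN)
  qed
  have hX: "(\<lambda>n. \<integral>\<omega>. h L (X n \<omega>) \<partial>M) \<longlonglongrightarrow> (\<integral>z. h L z \<partial>N)" for L
  proof -
    have "(\<lambda>n. \<integral>\<omega>. iexp (t * X n \<omega> j) \<partial>M) \<longlonglongrightarrow> (\<integral>z. iexp (t * z j) \<partial>N)" if "j < k" for j t
    proof -
      \<comment> \<open>Frequency vectors with one nonzero entry yield the marginal characteristic
        functions.\<close>
      have "(\<Sum>i<k. (if i = j then t else 0) * z i) = t * z j" for z :: "nat \<Rightarrow> real"
        using that by (simp add: if_distrib[where f="\<lambda>x. x * _"] cong: if_cong)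
      then show ?thesis using chr[of "\<lambda>i. if i = j then t else 0"] by simp
    qed
    then have "(\<lambda>n. \<Sum>j<k. \<integral>\<omega>. min 1 (max 0 (\<bar>X n \<omega> j\<bar> - L)) \<partial>M) \<longlonglongrightarrow> (\<Sum>j<k. \<integral>z. min 1 (max 0 (\<bar>z j\<bar> - L)) \<partial>N)"
      by (intro tendsto_sum marginal_cutoff_tendsto[OF M N] X Z) simp_all
    then show ?thesis unfolding h_def
      by (subst (1 2) Bochner_Integration.integral_sum) (auto intro: intN intX)
  qed
  \<comment> \<open>The final error is twice r/12 + r/6, plus r/6 for the trigonometric polynomial,
    hence 2r/3 in total. Using B + 1 avoids division by zero when B = 0.\<close>
  have "\<forall>\<^sub>F L in sequentially. (\<integral>z. h (real L) z \<partial>N) < r / (12 * (B + 1))"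
    using r B by (intro order_tendstoD(2)[OF hN]) simp
  then obtain L :: nat where L: "(\<integral>z. h (real L) z \<partial>N) < r / (12 * (B + 1))"
    by (auto simp: eventually_sequentially)
  have r12: "r / 12 > 0" using r by simp
  obtain q where q: "q \<in> trig_span k" "\<And>z. \<bar>g z - q z\<bar> \<le> r / 12 + 2 * B * h (real L) z"
    unfolding h_def by (rule bounded_continuous_approx_trig_span[OF g bnd dep r12 of_nat_0_le_iff[of L]]) blast+
  have qlim: "(\<lambda>n. \<integral>\<omega>. q (X n \<omega>) \<partial>M) \<longlonglongrightarrow> (\<integral>z. q z \<partial>N)"
    by (rule trig_span_integral_tendsto[OF q(1) M N X Z chr])
  have dX: "\<bar>(\<integral>\<omega>. g (X n \<omega>) \<partial>M) - (\<integral>\<omega>. q (X n \<omega>) \<partial>M)\<bar> \<le> r / 12 + 2 * B * (\<integral>\<omega>. h (real L) (X n \<omega>) \<partial>M)" for n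
  proof -
    have "\<bar>(\<integral>\<omega>. g (X n \<omega>) \<partial>M) - (\<integral>\<omega>. q (X n \<omega>) \<partial>M)\<bar> \<le> (\<integral>\<omega>. r / 12 + 2 * B * h (real L) (X n \<omega>) \<partial>M)"
      using q(2) bnd
      by (intro integral_diff_le_integral M.integrable_const_bound[where B=B and f="\<lambda>\<omega>. g (X n \<omega>)"] trig_span_integrable[OF q(1) M]
          Bochner_Integration.integrable_add Bochner_Integration.integrable_mult_right inthX X) auto
    also have "\<dots> = r / 12 + 2 * B * (\<integral>\<omega>. h (real L) (X n \<omega>) \<partial>M)"
      using inthX by (simp add: M.prob_space)
    finally show ?thesis .
  qed
  have dN: "\<bar>(\<integral>z. g z \<partial>N) - (\<integral>z. q z \<partial>N)\<bar> \<le> r / 12 + 2 * B * (\<integral>z. h (real L) z \<partial>N)"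
  proof -
    have "\<bar>(\<integral>z. g z \<partial>N) - (\<integral>z. q z \<partial>N)\<bar> \<le> (\<integral>z. r / 12 + 2 * B * h (real L) z \<partial>N)"
      using q(2) bnd
      by (intro integral_diff_le_integral N.integrable_const_bound[where B=B and f=g] trig_span_integrable[OF q(1) N]
          Bochner_Integration.integrable_add Bochner_Integration.integrable_mult_right inthN Z) auto
    also have "\<dots> = r / 12 + 2 * B * (\<integral>z. h (real L) z \<partial>N)"
      using inthN by (simp add: N.prob_space)
    finally show ?thesis .
  qed
  have smallB: "2 * B * x \<le> r / 6" if "x \<le> r / (12 * (B + 1))" for x
  proof -
    have "2 * B * x \<le> 2 * B * (r / (12 * (B + 1)))" using that B by (intro mult_left_mono) auto
    also have "\<dots> = (r / 6) * (B / (B + 1))" using B by (simp add: field_simps)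
    also have "\<dots> \<le> r / 6 * 1" using B r by (intro mult_left_mono) auto
    finally show ?thesis by simp
  qed
  have "\<forall>\<^sub>F n in sequentially. (\<integral>\<omega>. h (real L) (X n \<omega>) \<partial>M) < r / (12 * (B + 1))"
    by (rule order_tendstoD(2)[OF hX L])
  moreover have "\<forall>\<^sub>F n in sequentially. dist (\<integral>\<omega>. q (X n \<omega>) \<partial>M) (\<integral>z. q z \<partial>N) < r / 6"
    using r by (intro tendstoD[OF qlim]) simp
  ultimately have "\<forall>\<^sub>F n in sequentially. norm ((\<integral>\<omega>. g (X n \<omega>) \<partial>M) - (\<integral>z. g z \<partial>N)) < r"
  proof eventually_elim
    case (elim n)
    show ?case
      using dX[of n] dN smallB[of "\<integral>\<omega>. h (real L) (X n \<omega>) \<partial>M"] smallB[of "\<integral>z. h (real L) z \<partial>N"] elim L r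
      unfolding dist_real_def real_norm_def by linarith
  qed
  then show "\<exists>no. \<forall>n\<ge>no. norm ((\<integral>\<omega>. g (X n \<omega>) \<partial>M) - (\<integral>z. g z \<partial>N)) < r"
    by (simp add: eventually_sequentially)
qed

subsection \<open>Perturbation of linear systems\<close>

text \<open>Entrywise l1 norms: they are submultiplicative, and bounds on single entries, which
  later are averages, translate into them directly.\<close>

definition vec_l1 :: "real vec \<Rightarrow> real" where
  "vec_l1 v = (\<Sum>i<dim_vec v. \<bar>v $ i\<bar>)"

definition mat_l1 :: "real mat \<Rightarrow> real" where
  "mat_l1 A = (\<Sum>i<dim_row A. \<Sum>j<dim_col A. \<bar>A $$ (i, j)\<bar>)"

lemma vec_l1_nonneg: "vec_l1 v \<ge> 0" and mat_l1_nonneg: "mat_l1 A \<ge> 0"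
  by (auto simp: vec_l1_def mat_l1_def intro!: sum_nonneg)

lemma abs_index_le_vec_l1: "i < dim_vec v \<Longrightarrow> \<bar>v $ i\<bar> \<le> vec_l1 v"
  unfolding vec_l1_def by (rule member_le_sum) auto

lemma vec_l1_zero_iff:
  assumes "v \<in> carrier_vec m"
  shows "vec_l1 v = 0 \<longleftrightarrow> v = 0\<^sub>v m"
  using assms by (auto simp: vec_l1_def sum_nonneg_eq_0_iff)

lemma vec_l1_add:
  assumes "u \<in> carrier_vec m" "v \<in> carrier_vec m"
  shows "vec_l1 (u + v) \<le> vec_l1 u + vec_l1 v"
  using assms by (simp add: vec_l1_def abs_triangle_ineq sum_mono flip: sum.distrib)

lemma vec_l1_uminus: "vec_l1 (- v) = vec_l1 v"
  by (simp add: vec_l1_def)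

lemma abs_scalar_prod_le:
  assumes "u \<in> carrier_vec m" "v \<in> carrier_vec m"
  shows "\<bar>u \<bullet> v\<bar> \<le> vec_l1 u * vec_l1 v"
proof -
  have "\<bar>u \<bullet> v\<bar> \<le> (\<Sum>i<m. \<bar>u $ i\<bar> * \<bar>v $ i\<bar>)"
    using assms unfolding scalar_prod_def by (simp add: atLeast0LessThan flip: abs_mult)
  also have "\<dots> \<le> (\<Sum>i<m. \<bar>u $ i\<bar> * vec_l1 v)"
    using assms abs_index_le_vec_l1[of _ v] by (intro sum_mono mult_left_mono) auto
  finally show ?thesis using assms by (simp add: vec_l1_def[of u] sum_distrib_right)
qed

lemma vec_l1_mult_mat_vec:
  assumes A: "A \<in> carrier_mat n m" and v: "v \<in> carrier_vec m"
  shows "vec_l1 (A *\<^sub>v v) \<le> mat_l1 A * vec_l1 v"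
proof -
  have "\<bar>(A *\<^sub>v v) $ i\<bar> \<le> (\<Sum>j<m. \<bar>A $$ (i, j)\<bar>) * vec_l1 v" if "i < n" for i
    using abs_scalar_prod_le[of "row A i" m v] A v that by (simp add: vec_l1_def)
  then have "(\<Sum>i<n. \<bar>(A *\<^sub>v v) $ i\<bar>) \<le> (\<Sum>i<n. (\<Sum>j<m. \<bar>A $$ (i, j)\<bar>) * vec_l1 v)"
    by (intro sum_mono) auto
  then show ?thesis using A v by (simp add: mat_l1_def vec_l1_def[of "A *\<^sub>v v"] sum_distrib_right)
qed

lemma mat_l1_le:
  assumes "A \<in> carrier_mat n m" "\<And>i j. i < n \<Longrightarrow> j < m \<Longrightarrow> \<bar>A $$ (i, j)\<bar> \<le> e"
  shows "mat_l1 A \<le> real n * real m * e"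
proof -
  have "mat_l1 A = (\<Sum>i<n. \<Sum>j<m. \<bar>A $$ (i, j)\<bar>)"
    using assms(1) by (simp add: mat_l1_def)
  also have "\<dots> \<le> (\<Sum>i<n. \<Sum>j<m. e)"
    by (intro sum_mono assms(2)) auto
  finally show ?thesis by simp
qed

lemma vec_l1_le:
  assumes "v \<in> carrier_vec m" "\<And>i. i < m \<Longrightarrow> \<bar>v $ i\<bar> \<le> e"
  shows "vec_l1 v \<le> real m * e"
proof -
  have "vec_l1 v = (\<Sum>i<m. \<bar>v $ i\<bar>)"
    using assms(1) by (simp add: vec_l1_def)
  also have "\<dots> \<le> (\<Sum>i<m. e)"
    by (intro sum_mono assms(2)) auto
  finally show ?thesis by simp
qed

section \<open>Determinants, inverses and their measurability\<close>

lemma invertible_mat_iff_det: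
  fixes A :: "real mat"
  assumes A: "A \<in> carrier_mat m m"
  shows "invertible_mat A \<longleftrightarrow> det A \<noteq> 0"
proof
  assume "invertible_mat A"
  then obtain B where AB: "A * B = 1\<^sub>m (dim_row A)" and BA: "B * A = 1\<^sub>m (dim_row B)"
    by (auto simp: invertible_mat_def inverts_mat_def)
  have "dim_col (A * B) = m" "dim_col (B * A) = dim_row B" using A AB BA by auto
  then have B: "B \<in> carrier_mat m m" using A by auto
  have "det A * det B = 1" using det_mult[OF A B] AB A by simp
  then show "det A \<noteq> 0" by auto
next
  assume "det A \<noteq> 0"
  from det_non_zero_imp_unit[OF A this, where b="()"] obtain B
    where "mat_inverse A = Some B"
    using mat_inverse(1)[OF A, where b="()"] by (cases "mat_inverse A") auto
  from mat_inverse(2)[OF A this] A show "invertible_mat A"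
    by (auto simp: invertible_mat_def inverts_mat_def intro!: exI[of _ B])
qed

lemma inv_mat:
  assumes A: "A \<in> carrier_mat m m" and "det A \<noteq> 0"
  shows "inv_mat A \<in> carrier_mat m m" "A * inv_mat A = 1\<^sub>m m" "inv_mat A * A = 1\<^sub>m m"
proof -
  from det_non_zero_imp_unit[OF assms, where b="()"] obtain B
    where B: "mat_inverse A = Some B"
    using mat_inverse(1)[OF A, where b="()"] by (cases "mat_inverse A") auto
  with mat_inverse(2)[OF A B]
  show "inv_mat A \<in> carrier_mat m m" "A * inv_mat A = 1\<^sub>m m" "inv_mat A * A = 1\<^sub>m m" by auto
qed

text \<open>Cramer's rule: the entries of the inverse are quotients of polynomials in the entries of
  \<open>A\<close>, hence measurable when \<open>A\<close> is random.\<close>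

lemma inv_mat_eq_adj:
  assumes A: "A \<in> carrier_mat m m" and nz: "det A \<noteq> 0" and ij: "i < m" "j < m"
  shows "inv_mat A $$ (i, j) = adj_mat A $$ (i, j) / det A"
proof -
  note I = inv_mat[OF A nz] and D = adj_mat[OF A]
  have "inv_mat A * (A * adj_mat A) = inv_mat A * (det A \<cdot>\<^sub>m 1\<^sub>m m)" using D by simp
  also have "\<dots> = det A \<cdot>\<^sub>m inv_mat A" using I by (simp add: mult_smult_distrib[OF I(1) one_carrier_mat])
  also have "inv_mat A * (A * adj_mat A) = adj_mat A"
    by (simp only: assoc_mult_mat[OF I(1) A D(1), symmetric] I(3) left_mult_one_mat[OF D(1)])
  finally have "adj_mat A $$ (i, j) = det A * inv_mat A $$ (i, j)" using I ij by simp
  then show ?thesis using nz by simp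
qed

lemma borel_measurable_det:
  assumes A: "\<And>\<omega>. A \<omega> \<in> carrier_mat m m"
    and "\<And>i j. i < m \<Longrightarrow> j < m \<Longrightarrow> (\<lambda>\<omega>. A \<omega> $$ (i, j) :: real) \<in> borel_measurable M"
  shows "(\<lambda>\<omega>. det (A \<omega>)) \<in> borel_measurable M"
  unfolding det_def'[OF A]
proof (intro borel_measurable_sum borel_measurable_times borel_measurable_const borel_measurable_prod)
  fix p i assume "p \<in> {p. p permutes {0..<m}}" "i \<in> {0..<m}"
  then have "p i \<in> {0..<m}" by (simp only: mem_Collect_eq permutes_in_image)
  with \<open>i \<in> {0..<m}\<close> show "(\<lambda>\<omega>. A \<omega> $$ (i, p i)) \<in> borel_measurable M" by (intro assms(2)) auto
qed

lemma borel_measurable_adj: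
  assumes A: "\<And>\<omega>. A \<omega> \<in> carrier_mat m m"
    and meas: "\<And>i j. i < m \<Longrightarrow> j < m \<Longrightarrow> (\<lambda>\<omega>. A \<omega> $$ (i, j) :: real) \<in> borel_measurable M"
    and ij: "i < m" "j < m"
  shows "(\<lambda>\<omega>. adj_mat (A \<omega>) $$ (i, j)) \<in> borel_measurable M"
proof -
  have "(\<lambda>\<omega>. det (mat_delete (A \<omega>) j i)) \<in> borel_measurable M"
  proof (rule borel_measurable_det[where m="m - 1"])
    show "mat_delete (A \<omega>) j i \<in> carrier_mat (m - 1) (m - 1)" for \<omega>
      using A[of \<omega>] by (auto simp: mat_delete_def)
    fix k l assume kl: "k < m - 1" "l < m - 1"
    have "mat_delete (A \<omega>) j i $$ (k, l) = A \<omega> $$ (if k < j then k else Suc k, if l < i then l else Suc l)" for \<omega>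
      using A[of \<omega>] kl by (simp add: mat_delete_def)
    then show "(\<lambda>\<omega>. mat_delete (A \<omega>) j i $$ (k, l)) \<in> borel_measurable M"
      using kl by (simp add: meas)
  qed
  moreover have "adj_mat (A \<omega>) $$ (i, j) = (-1) ^ (j + i) * det (mat_delete (A \<omega>) j i)" for \<omega>
    using A[of \<omega>] ij by (simp add: adj_mat_def cofactor_def)
  ultimately show ?thesis by simp
qed

text \<open>From \<open>P * H = 1\<^sub>m m\<close> one gets P T v = v + P (T - H) v, and smallness
  lets the last term be absorbed. Here v stands for the error in the solution of a linear system and
  T v for its residual. Invertibility of T is derived from the first bound afterwards.\<close>

lemma perturbed_solution:
  assumes car: "P \<in> carrier_mat m m" "H \<in> carrier_mat m m" "T \<in> carrier_mat m m" "v \<in> carrier_vec m"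
    and PH: "P * H = 1\<^sub>m m" and small: "mat_l1 P * mat_l1 (T - H) \<le> 1 / 2"
  shows "vec_l1 v \<le> 2 * mat_l1 P * vec_l1 (T *\<^sub>v v)"
    and "vec_l1 (v - P *\<^sub>v (T *\<^sub>v v)) \<le> 2 * (mat_l1 P)\<^sup>2 * mat_l1 (T - H) * vec_l1 (T *\<^sub>v v)"
proof -
  have TH: "T - H \<in> carrier_mat m m" using car by auto
  have "T = H + (T - H)" using car by auto
  then have "T *\<^sub>v v = H *\<^sub>v v + (T - H) *\<^sub>v v"
    using car TH by (metis add_mult_distrib_mat_vec)
  then have "P *\<^sub>v (T *\<^sub>v v) = P *\<^sub>v (H *\<^sub>v v) + P *\<^sub>v ((T - H) *\<^sub>v v)"
    using car TH by (simp add: mult_add_distrib_mat_vec[of _ m m])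
  also have "P *\<^sub>v (H *\<^sub>v v) = v"
    using car PH by (simp flip: assoc_mult_mat_vec)
  finally have eq: "P *\<^sub>v (T *\<^sub>v v) = v + P *\<^sub>v ((T - H) *\<^sub>v v)" .
  have w: "P *\<^sub>v ((T - H) *\<^sub>v v) \<in> carrier_vec m" "P *\<^sub>v (T *\<^sub>v v) \<in> carrier_vec m" using car TH by auto
  have le: "vec_l1 (P *\<^sub>v ((T - H) *\<^sub>v v)) \<le> mat_l1 P * (mat_l1 (T - H) * vec_l1 v)"
    using vec_l1_mult_mat_vec[of P m m "(T - H) *\<^sub>v v"] vec_l1_mult_mat_vec[OF TH car(4)] car TH mat_l1_nonneg[of P]
    by (meson mult_left_mono mult_mat_vec_carrier order_trans)
  also have "\<dots> \<le> 1 / 2 * vec_l1 v"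
    using mult_right_mono[OF small vec_l1_nonneg[of v]] by (simp add: mult.assoc)
  finally have half: "vec_l1 (P *\<^sub>v ((T - H) *\<^sub>v v)) \<le> 1 / 2 * vec_l1 v" .
  have "v = P *\<^sub>v (T *\<^sub>v v) + - (P *\<^sub>v ((T - H) *\<^sub>v v))"
    unfolding eq using car w by auto
  then have "vec_l1 v \<le> vec_l1 (P *\<^sub>v (T *\<^sub>v v)) + vec_l1 (P *\<^sub>v ((T - H) *\<^sub>v v))"
    using vec_l1_add[OF w(2), of "- (P *\<^sub>v ((T - H) *\<^sub>v v))"] w by (simp add: vec_l1_uminus)
  also have "vec_l1 (P *\<^sub>v (T *\<^sub>v v)) \<le> mat_l1 P * vec_l1 (T *\<^sub>v v)"
    using car by (intro vec_l1_mult_mat_vec) auto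
  finally show 1: "vec_l1 v \<le> 2 * mat_l1 P * vec_l1 (T *\<^sub>v v)" using half by simp
  have "v - P *\<^sub>v (T *\<^sub>v v) = - (P *\<^sub>v ((T - H) *\<^sub>v v))"
    unfolding eq using car w by auto
  then have "vec_l1 (v - P *\<^sub>v (T *\<^sub>v v)) \<le> mat_l1 P * (mat_l1 (T - H) * vec_l1 v)"
    using le by (simp add: vec_l1_uminus)
  also have "\<dots> \<le> mat_l1 P * (mat_l1 (T - H) * (2 * mat_l1 P * vec_l1 (T *\<^sub>v v)))"
    using 1 mat_l1_nonneg by (intro mult_left_mono) auto
  finally show "vec_l1 (v - P *\<^sub>v (T *\<^sub>v v)) \<le> 2 * (mat_l1 P)\<^sup>2 * mat_l1 (T - H) * vec_l1 (T *\<^sub>v v)"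
    by (simp add: power2_eq_square mult_ac)
qed

text \<open>A kernel vector of T has zero residual, so the first bound of
  \<open>perturbed_solution\<close> forces it to vanish.\<close>

lemma perturbed_det_nonzero:
  assumes car: "P \<in> carrier_mat m m" "H \<in> carrier_mat m m" "T \<in> carrier_mat m m"
    and PH: "P * H = 1\<^sub>m m" and small: "mat_l1 P * mat_l1 (T - H) \<le> 1 / 2"
  shows "det T \<noteq> 0"
proof
  assume "det T = 0"
  then obtain v where v: "v \<in> carrier_vec m" "v \<noteq> 0\<^sub>v m" "T *\<^sub>v v = 0\<^sub>v m"
    using det_0_iff_vec_prod_zero[OF car(3)] by blast
  have "vec_l1 v \<le> 0"
    using perturbed_solution(1)[OF car v(1) PH small] v(3) by (simp add: vec_l1_def)
  then have "vec_l1 v = 0" using vec_l1_nonneg[of v] by linarith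
  with v vec_l1_zero_iff[OF v(1)] show False by simp
qed

lemma quadratic_form_eq_sum:
  fixes S :: "real mat"
  assumes "S \<in> carrier_mat k k" "a \<in> carrier_vec k"
  shows "a \<bullet> (S *\<^sub>v a) = (\<Sum>i<k. \<Sum>j<k. a $ i * a $ j * S $$ (i, j))"
proof -
  have "a \<bullet> (S *\<^sub>v a) = (\<Sum>i<k. \<Sum>j<k. a $ i * (S $$ (i, j) * a $ j))"
    using assms by (simp add: scalar_prod_def atLeast0LessThan sum_distrib_left)
  also have "\<dots> = (\<Sum>i<k. \<Sum>j<k. a $ i * a $ j * S $$ (i, j))"
    by (intro sum.cong refl) simp
  finally show ?thesis .
qed

lemma symmetric_scalar_prod:
  assumes G: "(G :: real mat) \<in> carrier_mat m m" and sym: "transpose_mat G = G"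
    and u: "u \<in> carrier_vec m" and v: "v \<in> carrier_vec m"
  shows "u \<bullet> (G *\<^sub>v v) = v \<bullet> (G *\<^sub>v u)"
proof -
  have "u \<bullet> (G *\<^sub>v v) = (G *\<^sub>v v) \<bullet> u" using assms by (intro comm_scalar_prod) auto
  also have "\<dots> = v \<bullet> (transpose_mat G *\<^sub>v u)"
    using assms by (metis transpose_vec_mult_scalar transpose_carrier_mat)
  finally show ?thesis using sym by simp
qed

text \<open>Put c = b - \<beta>. Symmetry merges the two cross terms into 2 \<beta> G c, whose main
  part is 2 \<beta> G0 l when l approximates c. What remains contains c - l, or G - G0 together with
  c, or c twice.\<close>

lemma quadratic_form_perturbation:
  assumes car: "G \<in> carrier_mat m m" "G0 \<in> carrier_mat m m" "b \<in> carrier_vec m" "\<beta> \<in> carrier_vec m" "l \<in> carrier_vec m"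
    and sym: "transpose_mat G = G"
  shows "\<bar>b \<bullet> (G *\<^sub>v b) - \<beta> \<bullet> (G *\<^sub>v \<beta>) - 2 * (\<beta> \<bullet> (G0 *\<^sub>v l))\<bar> \<le>
    2 * vec_l1 \<beta> * mat_l1 (G - G0) * vec_l1 (b - \<beta>) + 2 * vec_l1 \<beta> * mat_l1 G0 * vec_l1 (b - \<beta> - l) +
    (mat_l1 G0 + mat_l1 (G - G0)) * (vec_l1 (b - \<beta>))\<^sup>2"
proof -
  define c where "c = b - \<beta>"
  have c: "c \<in> carrier_vec m" and b: "b = \<beta> + c" using car by (auto simp: c_def)
  have GG: "G - G0 \<in> carrier_mat m m" using car by auto
  have "G = G0 + (G - G0)" using car by auto
  then have split: "G *\<^sub>v v = G0 *\<^sub>v v + (G - G0) *\<^sub>v v" if "v \<in> carrier_vec m" for v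
    using car GG that by (metis add_mult_distrib_mat_vec)
  have cl: "c - l \<in> carrier_vec m" using c car by auto
  have "l + (c - l) = c" using car c by (intro eq_vecI) auto
  then have "G0 *\<^sub>v c = G0 *\<^sub>v l + G0 *\<^sub>v (c - l)"
    using mult_add_distrib_mat_vec[OF car(2,5) cl] by simp
  then have G0c: "\<beta> \<bullet> (G0 *\<^sub>v c) = \<beta> \<bullet> (G0 *\<^sub>v l) + \<beta> \<bullet> (G0 *\<^sub>v (c - l))"
    using car c cl by (simp add: scalar_prod_add_distrib[of _ m])
  have "b \<bullet> (G *\<^sub>v b) = \<beta> \<bullet> (G *\<^sub>v \<beta>) + \<beta> \<bullet> (G *\<^sub>v c) + c \<bullet> (G *\<^sub>v \<beta>) + c \<bullet> (G *\<^sub>v c)"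
    unfolding b using car c
    by (simp add: mult_add_distrib_mat_vec[of _ m m] scalar_prod_add_distrib[of _ m] add_scalar_prod_distrib[of _ m])
  also have "c \<bullet> (G *\<^sub>v \<beta>) = \<beta> \<bullet> (G *\<^sub>v c)" by (rule symmetric_scalar_prod[OF car(1) sym c car(4)])
  also have "\<beta> \<bullet> (G *\<^sub>v c) = \<beta> \<bullet> (G0 *\<^sub>v l) + \<beta> \<bullet> (G0 *\<^sub>v (c - l)) + \<beta> \<bullet> ((G - G0) *\<^sub>v c)"
    unfolding split[OF c] G0c[symmetric] using car c GG by (simp add: scalar_prod_add_distrib[of _ m])
  also have "c \<bullet> (G *\<^sub>v c) = c \<bullet> (G0 *\<^sub>v c) + c \<bullet> ((G - G0) *\<^sub>v c)"
    unfolding split[OF c] using car c GG by (simp add: scalar_prod_add_distrib[of _ m])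
  finally have eq: "b \<bullet> (G *\<^sub>v b) - \<beta> \<bullet> (G *\<^sub>v \<beta>) - 2 * (\<beta> \<bullet> (G0 *\<^sub>v l)) =
      2 * (\<beta> \<bullet> (G0 *\<^sub>v (c - l))) + 2 * (\<beta> \<bullet> ((G - G0) *\<^sub>v c)) + c \<bullet> (G0 *\<^sub>v c) + c \<bullet> ((G - G0) *\<^sub>v c)"
    by simp
  have bil: "\<bar>u \<bullet> (A *\<^sub>v v)\<bar> \<le> vec_l1 u * (mat_l1 A * vec_l1 v)"
    if "u \<in> carrier_vec m" "A \<in> carrier_mat m m" "v \<in> carrier_vec m" for u v A
    using abs_scalar_prod_le[of u m "A *\<^sub>v v"] vec_l1_mult_mat_vec[OF that(2,3)] that vec_l1_nonneg[of u]
    by (meson mult_left_mono mult_mat_vec_carrier order_trans)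
  show ?thesis
    unfolding eq using bil[OF car(4,2) cl] bil[OF car(4) GG c] bil[OF c car(2) c] bil[OF c GG c]
    unfolding c_def[symmetric] power2_eq_square by (simp add: algebra_simps)
qed

section \<open>Deterministic second-order expansion of the estimators\<close>

lemma U_mat_carrier: "U_mat mu d \<in> carrier_mat (d + 1) (d + 1)"
  by (simp add: U_mat_def)

lemma det_U_mat:
  assumes "mu 0 = 1"
  shows "det (U_mat mu d) = 1"
proof -
  have "det (U_mat mu d) = prod_list (diag_mat (U_mat mu d))"
    by (rule det_lower_triangular[OF _ U_mat_carrier]) (simp add: U_mat_def)
  also have "diag_mat (U_mat mu d) = map (\<lambda>_. 1) [0..<d + 1]"
    using assms by (auto simp: diag_mat_def U_mat_def)
  also have "prod_list \<dots> = 1" by (simp add: map_replicate_const del: upt_Suc)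
  finally show ?thesis .
qed

lemma U_mat_transpose_inverse:
  fixes mu :: "nat \<Rightarrow> real" and d :: nat
  assumes "mu 0 = 1"
  defines "W \<equiv> transpose_mat (inv_mat (U_mat mu d))"
  shows "W \<in> carrier_mat (d + 1) (d + 1)"
    and "W * transpose_mat (U_mat mu d) = 1\<^sub>m (d + 1)" "transpose_mat (U_mat mu d) * W = 1\<^sub>m (d + 1)"
proof -
  have "det (U_mat mu d) \<noteq> 0" using det_U_mat[of mu d] assms(1) by simp
  note I = inv_mat[OF U_mat_carrier this]
  show "W \<in> carrier_mat (d + 1) (d + 1)" using I by (simp add: W_def)
  show "W * transpose_mat (U_mat mu d) = 1\<^sub>m (d + 1)"
    unfolding W_def using transpose_mult[OF U_mat_carrier[of mu d] I(1)] I(2) by simp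
  show "transpose_mat (U_mat mu d) * W = 1\<^sub>m (d + 1)"
    unfolding W_def using transpose_mult[OF I(1) U_mat_carrier[of mu d]] I(3) by simp
qed

text \<open>C and \<eta> depend neither on the sample nor on n or \<open>b0\<close>, so randomness
  enters later only through the size e of the deviations. The term with \<open>G0\<close> is the
  first-order effect that estimating \<beta> has on the quadratic form.\<close>

lemma estimator_expansion:
  fixes H G0 :: "real mat" and \<beta> :: "real vec" and md mu :: "nat \<Rightarrow> real" and d :: nat
  assumes H: "H \<in> carrier_mat (d + 1) (d + 1)" "det H \<noteq> 0"
    and G0: "G0 \<in> carrier_mat (d + 1) (d + 1)"
    and \<beta>: "\<beta> \<in> carrier_vec (d + 1)" and mu0: "mu 0 = 1"
  defines "W \<equiv> transpose_mat (inv_mat (U_mat mu d))"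
    and "bs \<equiv> transpose_mat (U_mat mu d) *\<^sub>v \<beta>"
  shows "\<exists>C \<eta>. C \<ge> 0 \<and> \<eta> > 0 \<and> (\<forall>n w y b0 e.
    (let Tb = avg_mat (d + 1) n (\<lambda>i. T_mat md d (w i));
         Gb = avg_mat (d + 1) n (\<lambda>i. G_mat md mu d (w i));
         r = avg_vec (d + 1) n (\<lambda>i. h_vec md d (w i) (y i)) - Tb *\<^sub>v bs;
         l = W *\<^sub>v (inv_mat H *\<^sub>v r);
         b = beta_hat md mu d b0 n w y
     in (\<forall>i\<le>d. \<forall>j\<le>d. \<bar>(Tb - H) $$ (i, j)\<bar> \<le> e) \<longrightarrow> (\<forall>i\<le>d. \<forall>j\<le>d. \<bar>(Gb - G0) $$ (i, j)\<bar> \<le> e) \<longrightarrow>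
        (\<forall>i\<le>d. \<bar>r $ i\<bar> \<le> e) \<longrightarrow> e \<le> \<eta> \<longrightarrow>
        vec_l1 (b - \<beta> - l) \<le> C * e\<^sup>2 \<and>
        \<bar>sigma2_hat md mu d b0 n w y - (avg n (\<lambda>i. (y i)\<^sup>2) - \<beta> \<bullet> (Gb *\<^sub>v \<beta>) - 2 * (\<beta> \<bullet> (G0 *\<^sub>v l)))\<bar> \<le> C * e\<^sup>2))"
proof -
  define m where "m = d + 1"
  define P where "P = inv_mat H"
  define p where "p = mat_l1 P"
  define \<omega> where "\<omega> = mat_l1 W"
  \<comment> \<open>An m by m matrix with entries at most e has l1 norm at most m^2 e, so this
    \<eta> provides the factor 1/2 for \<open>perturbed_solution\<close>. The summand in p + 1
    guards against p = 0, and e <= 1 turns a cubic term into a quadratic one.\<close>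
  define \<eta> where "\<eta> = min 1 (1 / (2 * (real m)\<^sup>2 * (p + 1)))"
  \<comment> \<open>Constants for b - \<beta> (of order e), for b - \<beta> - l and for the
    quadratic form (both of order e^2).\<close>
  define K1 where "K1 = 2 * \<omega> * p * real m"
  define K2 where "K2 = 2 * \<omega> * p\<^sup>2 * (real m) ^ 3"
  define K3 where "K3 = 2 * vec_l1 \<beta> * (real m)\<^sup>2 * K1 + 2 * vec_l1 \<beta> * mat_l1 G0 * K2 + (mat_l1 G0 + (real m)\<^sup>2) * K1\<^sup>2"
  have p: "p \<ge> 0" and \<omega>: "\<omega> \<ge> 0" by (auto simp: p_def \<omega>_def mat_l1_nonneg)
  have m: "real m > 0" by (simp add: m_def)
  have \<eta>: "\<eta> > 0" using p m by (simp add: \<eta>_def)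
  have K: "K1 \<ge> 0" "K2 \<ge> 0" using p \<omega> by (auto simp: K1_def K2_def)
  then have K3: "K3 \<ge> 0" using vec_l1_nonneg mat_l1_nonneg by (auto simp: K3_def)
  have Pc: "P \<in> carrier_mat m m" and PH: "P * H = 1\<^sub>m m"
    using inv_mat[OF H] by (auto simp: P_def m_def)
  have Hc: "H \<in> carrier_mat m m" and G0c: "G0 \<in> carrier_mat m m" and \<beta>c: "\<beta> \<in> carrier_vec m"
    using H G0 \<beta> by (auto simp: m_def)
  have Wc: "W \<in> carrier_mat m m" and WU: "W * transpose_mat (U_mat mu d) = 1\<^sub>m m"
    using U_mat_transpose_inverse[of mu d] mu0 by (auto simp: W_def m_def)
  have Uc: "U_mat mu d \<in> carrier_mat m m" using U_mat_carrier by (simp add: m_def)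
  have bsc: "bs \<in> carrier_vec m" using \<beta>c Uc by (auto simp: bs_def)
  have Wbs: "W *\<^sub>v bs = \<beta>"
    unfolding bs_def using WU Wc Uc \<beta>c by (simp flip: assoc_mult_mat_vec)
  have main: "vec_l1 (b - \<beta> - l) \<le> (K2 + K3) * e\<^sup>2 \<and>
      \<bar>sigma2_hat md mu d b0 n w y - (avg n (\<lambda>i. (y i)\<^sup>2) - \<beta> \<bullet> (Gb *\<^sub>v \<beta>) - 2 * (\<beta> \<bullet> (G0 *\<^sub>v l)))\<bar> \<le> (K2 + K3) * e\<^sup>2"
    if Tb: "Tb = avg_mat m n (\<lambda>i. T_mat md d (w i))"
      and Gb: "Gb = avg_mat m n (\<lambda>i. G_mat md mu d (w i))"
      and hb: "hb = avg_vec m n (\<lambda>i. h_vec md d (w i) (y i))"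
      and r: "r = hb - Tb *\<^sub>v bs"
      and l: "l = W *\<^sub>v (P *\<^sub>v r)"
      and b: "b = beta_hat md mu d b0 n w y"
      and eT: "\<forall>i<m. \<forall>j<m. \<bar>(Tb - H) $$ (i, j)\<bar> \<le> e"
      and eG: "\<forall>i<m. \<forall>j<m. \<bar>(Gb - G0) $$ (i, j)\<bar> \<le> e"
      and er: "\<forall>i<m. \<bar>r $ i\<bar> \<le> e"
      and e\<eta>: "e \<le> \<eta>"
    for n w y b0 e Tb Gb hb r l b
  proof -
    have Tc: "Tb \<in> carrier_mat m m" and Gc: "Gb \<in> carrier_mat m m" and hc: "hb \<in> carrier_vec m"
      by (auto simp: Tb Gb hb avg_mat_def avg_vec_def)
    have rc: "r \<in> carrier_vec m" using Tc hc bsc by (auto simp: r)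
    have e: "e \<ge> 0" using er m abs_ge_zero[of "r $ 0"] by fastforce
    have e1: "e \<le> 1" using e\<eta> by (simp add: \<eta>_def)
    have TH: "Tb - H \<in> carrier_mat m m" and GG: "Gb - G0 \<in> carrier_mat m m"
      using Tc Hc Gc G0c by auto
    have T: "mat_l1 (Tb - H) \<le> (real m)\<^sup>2 * e"
      using mat_l1_le[OF TH, of e] eT by (simp add: power2_eq_square)
    have G: "mat_l1 (Gb - G0) \<le> (real m)\<^sup>2 * e"
      using mat_l1_le[OF GG, of e] eG by (simp add: power2_eq_square)
    have R: "vec_l1 r \<le> real m * e" using vec_l1_le[OF rc, of e] er by auto
    have small: "mat_l1 P * mat_l1 (Tb - H) \<le> 1 / 2"
    proof -
      have "mat_l1 P * mat_l1 (Tb - H) \<le> (p + 1) * ((real m)\<^sup>2 * \<eta>)"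
        using T e\<eta> p m mat_l1_nonneg[of "Tb - H"] unfolding p_def[symmetric]
        by (intro mult_mono) (auto intro: order_trans mult_left_mono)
      also have "\<dots> \<le> (p + 1) * ((real m)\<^sup>2 * (1 / (2 * (real m)\<^sup>2 * (p + 1))))"
        using p by (intro mult_left_mono) (auto simp: \<eta>_def)
      also have "\<dots> = 1 / 2"
      proof -
        have "x * (y * (1 / (2 * y * x))) = 1 / 2" if "x \<noteq> 0" "y \<noteq> 0" for x y :: real
          using that by simp
        then show ?thesis using p m by simp
      qed
      finally show ?thesis .
    qed
    have nz: "det Tb \<noteq> 0" by (rule perturbed_det_nonzero[OF Pc Hc Tc PH small])
    note I = inv_mat[OF Tc nz]
    define bt where "bt = inv_mat Tb *\<^sub>v hb"
    have btc: "bt \<in> carrier_vec m" using I hc by (auto simp: bt_def)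
    have Tbt: "Tb *\<^sub>v bt = hb"
      unfolding bt_def using I Tc hc by (simp flip: assoc_mult_mat_vec)
    have bW: "b = W *\<^sub>v bt"
      using nz Tc invertible_mat_iff_det[OF Tc]
      by (simp add: b beta_hat_def bt_def Tb hb W_def m_def Let_def)
    \<comment> \<open>The perturbation lemma is applied to this difference, whose image under
      \<open>Tb\<close> is the residual \<open>r\<close>; the inverse of \<open>Tb\<close> is never
      expanded.\<close>
    define v where "v = bt - bs"
    have vc: "v \<in> carrier_vec m" using btc bsc by (auto simp: v_def)
    have Tv: "Tb *\<^sub>v v = r"
      using mult_minus_distrib_mat_vec[OF Tc btc bsc] by (simp add: v_def r Tbt)
    have c: "b - \<beta> = W *\<^sub>v v"
      using mult_minus_distrib_mat_vec[OF Wc btc bsc] by (simp add: v_def bW Wbs)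
    have Prc: "P *\<^sub>v r \<in> carrier_vec m" using Pc rc by auto
    have cl: "b - \<beta> - l = W *\<^sub>v (v - P *\<^sub>v r)"
      using mult_minus_distrib_mat_vec[OF Wc vc Prc] by (simp add: c l)
    note S = perturbed_solution[OF Pc Hc Tc vc PH small, unfolded Tv, folded p_def]
    have "vec_l1 (b - \<beta>) \<le> \<omega> * vec_l1 v"
      unfolding c \<omega>_def by (rule vec_l1_mult_mat_vec[OF Wc vc])
    also have "vec_l1 v \<le> 2 * p * (real m * e)"
      using S(1) R p by (meson mult_left_mono mult_nonneg_nonneg order_trans zero_le_numeral)
    then have "\<omega> * vec_l1 v \<le> K1 * e"
      using mult_left_mono[OF _ \<omega>] by (fastforce simp: K1_def mult_ac)
    finally have L1: "vec_l1 (b - \<beta>) \<le> K1 * e" .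
    have vPr: "v - P *\<^sub>v r \<in> carrier_vec m" using vc Prc by auto
    have "vec_l1 (b - \<beta> - l) \<le> \<omega> * vec_l1 (v - P *\<^sub>v r)"
      unfolding cl \<omega>_def by (rule vec_l1_mult_mat_vec[OF Wc vPr])
    also have "vec_l1 (v - P *\<^sub>v r) \<le> 2 * p\<^sup>2 * ((real m)\<^sup>2 * e) * (real m * e)"
      using S(2) T R e mat_l1_nonneg vec_l1_nonneg
      by (rule_tac order_trans[OF S(2)]) (intro mult_mono mult_left_mono; simp)
    then have "\<omega> * vec_l1 (v - P *\<^sub>v r) \<le> \<omega> * (2 * p\<^sup>2 * ((real m)\<^sup>2 * e) * (real m * e))"
      using \<omega> by (intro mult_left_mono)
    also have "\<dots> = K2 * e\<^sup>2" by (simp add: K2_def power2_eq_square power3_eq_cube mult_ac)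
    finally have L2: "vec_l1 (b - \<beta> - l) \<le> K2 * e\<^sup>2" .
    have bc: "b \<in> carrier_vec m" using Wc btc by (auto simp: bW)
    have lc: "l \<in> carrier_vec m" using Wc Prc by (auto simp: l)
    have sym: "transpose_mat Gb = Gb"
      by (auto simp: Gb avg_mat_def G_mat_def m_def add.commute intro!: eq_matI)
    have "\<bar>b \<bullet> (Gb *\<^sub>v b) - \<beta> \<bullet> (Gb *\<^sub>v \<beta>) - 2 * (\<beta> \<bullet> (G0 *\<^sub>v l))\<bar> \<le>
        2 * vec_l1 \<beta> * mat_l1 (Gb - G0) * vec_l1 (b - \<beta>) + 2 * vec_l1 \<beta> * mat_l1 G0 * vec_l1 (b - \<beta> - l) +
        (mat_l1 G0 + mat_l1 (Gb - G0)) * (vec_l1 (b - \<beta>))\<^sup>2"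
      by (rule quadratic_form_perturbation[OF Gc G0c bc \<beta>c lc sym])
    also have "\<dots> \<le> 2 * vec_l1 \<beta> * ((real m)\<^sup>2 * e) * (K1 * e) + 2 * vec_l1 \<beta> * mat_l1 G0 * (K2 * e\<^sup>2) +
        (mat_l1 G0 + (real m)\<^sup>2 * 1) * (K1 * e)\<^sup>2"
    proof -
      \<comment> \<open>In the term quadratic in b - \<beta>, the deviation of \<open>Gb\<close>
        only has to stay bounded.\<close>
      have "(real m)\<^sup>2 * e \<le> (real m)\<^sup>2 * 1" using e1 by (intro mult_left_mono) auto
      then show ?thesis
        using G L1 L2 K e vec_l1_nonneg mat_l1_nonneg
        by (intro add_mono mult_mono power_mono mult_nonneg_nonneg; simp)
    qed
    also have "\<dots> = K3 * e\<^sup>2" by (simp add: K3_def power2_eq_square algebra_simps)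
    finally have L3: "\<bar>b \<bullet> (Gb *\<^sub>v b) - \<beta> \<bullet> (Gb *\<^sub>v \<beta>) - 2 * (\<beta> \<bullet> (G0 *\<^sub>v l))\<bar> \<le> K3 * e\<^sup>2" .
    have s: "sigma2_hat md mu d b0 n w y = avg n (\<lambda>i. (y i)\<^sup>2) - b \<bullet> (Gb *\<^sub>v b)"
      by (simp add: sigma2_hat_def Let_def b Gb m_def)
    have "0 \<le> K2 * e\<^sup>2" "0 \<le> K3 * e\<^sup>2" using K K3 by auto
    with L2 L3 show ?thesis unfolding s by (simp add: distrib_right abs_le_iff)
  qed
  show ?thesis
    by (rule exI[of _ "K2 + K3"], rule exI[of _ \<eta>], unfold Let_def, intro conjI allI impI)
      (use K K3 \<eta> main[OF refl refl refl refl refl refl, unfolded m_def P_def] in \<open>auto simp: less_Suc_eq_le\<close>)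
qed

subsection \<open>Multivariate normal laws\<close>

text \<open>Cholesky factorization, peeling off the last index: subtracting v v^T leaves the Schur
  complement, again positive semidefinite. A zero pivot may occur, but then its whole column
  vanishes.\<close>

lemma psd_factorization:
  fixes S :: "nat \<Rightarrow> nat \<Rightarrow> real"
  assumes "\<And>i j. i < k \<Longrightarrow> j < k \<Longrightarrow> S i j = S j i"
    and "\<And>a. 0 \<le> (\<Sum>i<k. \<Sum>j<k. a i * a j * S i j)"
  shows "\<exists>A. \<forall>i<k. \<forall>j<k. S i j = (\<Sum>l<k. A i l * A j l)"
  using assms
proof (induction k arbitrary: S)
  case 0
  then show ?case by simp
next
  case (Suc k)
  define s where "s = S k k"
  \<comment> \<open>For s = 0 division by zero gives v = 0, in agreement with the vanishing
    column.\<close>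
  define v where "v i = S i k / sqrt s" for i
  have expand: "(\<Sum>i<Suc k. \<Sum>j<Suc k. a i * a j * S i j) =
      (\<Sum>i<k. \<Sum>j<k. a i * a j * S i j) + 2 * a k * (\<Sum>i<k. a i * S i k) + (a k)\<^sup>2 * s" for a
  proof -
    have "(\<Sum>j<k. a k * a j * S k j) = a k * (\<Sum>i<k. a i * S i k)"
      unfolding sum_distrib_left using Suc.prems(1) by (intro sum.cong) auto
    moreover have "(\<Sum>i<k. a i * a k * S i k) = a k * (\<Sum>i<k. a i * S i k)"
      unfolding sum_distrib_left by (intro sum.cong) auto
    ultimately show ?thesis
      by (simp add: sum.distrib s_def power2_eq_square algebra_simps)
  qed
  have upd: "(\<Sum>i<k. \<Sum>j<k. (a(k := c)) i * (a(k := c)) j * S i j) = (\<Sum>i<k. \<Sum>j<k. a i * a j * S i j)"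
    "(\<Sum>i<k. (a(k := c)) i * S i k) = (\<Sum>i<k. a i * S i k)" for a c
    by (intro sum.cong refl; simp)+
  have delta: "(\<Sum>i<k. (if i = m then t else 0) * f i) = t * f m" if "m < k" for m t and f :: "nat \<Rightarrow> real"
    using that by (simp add: if_distrib[where f="\<lambda>x. x * _"] cong: if_cong)
  have s: "s \<ge> 0"
    using Suc.prems(2)[of "\<lambda>i. if i = k then 1 else 0"] unfolding expand by simp
  have Sk0: "S m k = 0" if "s = 0" "m < k" for m
  proof (rule ccontr)
    assume nz: "S m k \<noteq> 0"
    \<comment> \<open>Chosen so that the form takes the value -1 at the m-th unit vector plus t
      times the k-th.\<close>
    define t where "t = - (S m m + 1) / (2 * S m k)"
    have form: "(\<Sum>i<k. \<Sum>j<k. a i * a j * S i j) = (\<Sum>i<k. a i * (\<Sum>j<k. a j * S i j))" for a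
      by (simp add: sum_distrib_left mult.assoc)
    have "0 \<le> (\<Sum>i<Suc k. \<Sum>j<Suc k. (if i = k then t else if i = m then 1 else 0) *
        (if j = k then t else if j = m then 1 else 0) * S i j)"
      by (rule Suc.prems(2))
    also have "\<dots> = S m m + 2 * t * S m k"
    proof -
      have e: "(\<Sum>i<k. (if i = k then t else if i = m then 1 else 0) * f i) = f m" for f :: "nat \<Rightarrow> real"
      proof -
        have "(\<Sum>i<k. (if i = k then t else if i = m then 1 else 0) * f i) = (\<Sum>i<k. (if i = m then 1 else 0) * f i)"
          by (intro sum.cong) auto
        then show ?thesis using delta[OF that(2), of 1 f] by simp
      qed
      show ?thesis unfolding expand form by (simp only: e) (simp add: that)
    qed
    also have "\<dots> = - 1" using nz by (simp add: t_def field_simps)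
    finally show False by simp
  qed
  have Sv: "S i k = v i * sqrt s" if "i < k" for i
    using Sk0[OF _ that] s by (cases "s = 0") (auto simp: v_def)
  have "\<exists>A. \<forall>i<k. \<forall>j<k. S i j - v i * v j = (\<Sum>l<k. A i l * A j l)"
  proof (rule Suc.IH)
    fix a :: "nat \<Rightarrow> real"
    define b where "b = (\<Sum>i<k. a i * v i)"
    have b': "(\<Sum>i<k. a i * S i k) = b * sqrt s"
      unfolding b_def sum_distrib_right using Sv by (intro sum.cong) auto
    have "(\<Sum>i<k. \<Sum>j<k. a i * a j * (v i * v j)) = b\<^sup>2"
      unfolding b_def power2_eq_square sum_product by (simp add: mult_ac)
    then have eq: "(\<Sum>i<k. \<Sum>j<k. a i * a j * (S i j - v i * v j)) = (\<Sum>i<k. \<Sum>j<k. a i * a j * S i j) - b\<^sup>2"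
      by (simp add: right_diff_distrib sum_subtractf)
    show "0 \<le> (\<Sum>i<k. \<Sum>j<k. a i * a j * (S i j - v i * v j))"
    proof (cases "s = 0")
      case True
      then have "b = 0" by (simp add: b_def v_def)
      have "0 \<le> (\<Sum>i<Suc k. \<Sum>j<Suc k. (a(k := 0)) i * (a(k := 0)) j * S i j)" by (rule Suc.prems(2))
      also have "\<dots> = (\<Sum>i<k. \<Sum>j<k. a i * a j * S i j)" unfolding expand upd by simp
      finally show ?thesis using eq \<open>b = 0\<close> by simp
    next
      case False
      \<comment> \<open>The minimizer of the form over the last coordinate; the minimum is the form
        of the Schur complement.\<close>
      define c where "c = - b / sqrt s"
      have "0 \<le> (\<Sum>i<Suc k. \<Sum>j<Suc k. (a(k := c)) i * (a(k := c)) j * S i j)" by (rule Suc.prems(2))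
      also have "\<dots> = (\<Sum>i<k. \<Sum>j<k. a i * a j * S i j) + 2 * c * (\<Sum>i<k. a i * S i k) + c\<^sup>2 * s"
        unfolding expand upd by simp
      also have "\<dots> = (\<Sum>i<k. \<Sum>j<k. a i * a j * S i j) - b\<^sup>2"
        unfolding b' c_def using s False by (simp add: power2_eq_square field_simps flip: real_sqrt_mult)
      finally show ?thesis using eq by simp
    qed
  qed (use Suc.prems(1) in auto)
  then obtain A where A: "\<And>i j. i < k \<Longrightarrow> j < k \<Longrightarrow> S i j - v i * v j = (\<Sum>l<k. A i l * A j l)" by blast
  \<comment> \<open>The factor of the Schur complement, bordered by the column v and the corner sqrt
    s, with zeros in the rest of the last row.\<close>
  define A' where "A' i l = (if l < k then if i < k then A i l else 0 else if i < k then v i else sqrt s)" for i l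
  have "S i j = (\<Sum>l<Suc k. A' i l * A' j l)" if ij: "i < Suc k" "j < Suc k" for i j
  proof -
    consider "i < k" "j < k" | "i < k" "j = k" | "i = k" "j < k" | "i = k" "j = k"
      using ij by (auto simp: less_Suc_eq)
    then show ?thesis
    proof cases
      case 1 with A[of i j] show ?thesis by (simp add: A'_def)
    next
      case 2 with Sv[of i] show ?thesis by (simp add: A'_def)
    next
      case 3 with Sv[of j] Suc.prems(1)[of j k] show ?thesis by (simp add: A'_def)
    next
      case 4 with s show ?thesis by (simp add: A'_def s_def)
    qed
  qed
  then show ?case by blast
qed

lemma prob_space_normal_law: "v \<ge> 0 \<Longrightarrow> prob_space (normal_law m v)"
  by (auto simp: normal_law_def intro!: prob_space_return prob_space_normal_density)

lemma real_distribution_normal_law: "v \<ge> 0 \<Longrightarrow> real_distribution (normal_law m v)"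
  using prob_space_normal_law[of v m]
  by (auto simp: real_distribution_def real_distribution_axioms_def normal_law_def)

text \<open>For v > 0 the law is the image of the standard normal law under scaling by sqrt v; the
  point mass fits the same formula.\<close>

lemma char_normal_law:
  assumes "v \<ge> 0"
  shows "char (normal_law 0 v) t = of_real (exp (- v * t\<^sup>2 / 2))"
proof (cases "v = 0")
  case True
  then show ?thesis by (simp add: normal_law_def char_def integral_return)
next
  case False
  define s where "s = sqrt v"
  have s: "s > 0" using False assms by (simp add: s_def)
  interpret prob_space std_normal_distribution
    by (simp add: prob_space_normal_density)
  have "distributed std_normal_distribution lborel (\<lambda>x. x) (normal_density 0 1)"
    unfolding distributed_def by (simp add: distr_id2)
  from normal_density_affine[OF this, of s 0] s
  have D: "distr std_normal_distribution lborel (\<lambda>x. s * x) = normal_law 0 v"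
    using False by (simp add: distributed_def normal_law_def s_def)
  have "char (normal_law 0 v) t = (\<integral>x. iexp (t * (s * x)) \<partial>std_normal_distribution)"
    unfolding char_def D[symmetric] by (subst integral_distr) simp_all
  also have "\<dots> = char std_normal_distribution (t * s)"
    by (simp add: char_def mult.assoc)
  finally show ?thesis
    using assms by (simp add: char_std_normal_distribution s_def power_mult_distrib mult_ac)
qed

lemma char_linear_std_normal_product:
  fixes b :: "nat \<Rightarrow> real"
  shows "(\<integral>z. iexp (\<Sum>l<k. b l * z l) \<partial>PiM {..<k} (\<lambda>_. std_normal_distribution)) =
    of_real (exp (- (\<Sum>l<k. (b l)\<^sup>2) / 2))"
proof -
  interpret P: product_sigma_finite "\<lambda>_. std_normal_distribution"
    by (simp add: product_sigma_finite_def prob_space_normal_density prob_space_imp_sigma_finite)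
  interpret prob_space std_normal_distribution
    by (simp add: prob_space_normal_density)
  have "(\<integral>z. iexp (\<Sum>l<k. b l * z l) \<partial>PiM {..<k} (\<lambda>_. std_normal_distribution)) =
      (\<integral>z. (\<Prod>l<k. iexp (b l * z l)) \<partial>PiM {..<k} (\<lambda>_. std_normal_distribution))"
    by (intro Bochner_Integration.integral_cong refl) (simp add: sum_distrib_left exp_sum)
  also have "\<dots> = (\<Prod>l<k. \<integral>z. iexp (b l * z) \<partial>std_normal_distribution)"
    by (intro P.product_integral_prod finite_lessThan integrable_iexp) simp_all
  also have "\<dots> = (\<Prod>l<k. char std_normal_distribution (b l))"
    by (simp add: char_def)
  also have "\<dots> = of_real (exp (\<Sum>l<k. - (b l)\<^sup>2 / 2))"
    by (simp add: char_std_normal_distribution exp_sum)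
  also have "(\<Sum>l<k. - (b l)\<^sup>2 / 2) = - (\<Sum>l<k. (b l)\<^sup>2) / 2"
    by (simp add: sum_negf sum_divide_distrib)
  finally show ?thesis .
qed

text \<open>\<open>multivariate_normal\<close> is a property and not a construction, so existence
  must be shown. The image of independent standard normals under a factor of \<open>S\<close> works
  for singular \<open>S\<close> too.\<close>

lemma multivariate_normal_exists:
  assumes S: "covariance_mat k S"
  shows "\<exists>N. multivariate_normal k (0\<^sub>v k) S N"
proof -
  from S have Sc: "S \<in> carrier_mat k k" and St: "transpose_mat S = S"
    and psd: "\<And>a. a \<in> carrier_vec k \<Longrightarrow> 0 \<le> a \<bullet> (S *\<^sub>v a)"
    by (auto simp: covariance_mat_def)
  have "\<exists>A. \<forall>i<k. \<forall>j<k. S $$ (i, j) = (\<Sum>l<k. A i l * A j l)"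
  proof (rule psd_factorization)
    show "S $$ (i, j) = S $$ (j, i)" if "i < k" "j < k" for i j
      using that Sc arg_cong[OF St, of "\<lambda>A. A $$ (i, j)"] by auto
    show "0 \<le> (\<Sum>i<k. \<Sum>j<k. a i * a j * S $$ (i, j))" for a
      using psd[of "vec k a"] quadratic_form_eq_sum[OF Sc, of "vec k a"] by simp
  qed
  then obtain A where A: "\<And>i j. i < k \<Longrightarrow> j < k \<Longrightarrow> S $$ (i, j) = (\<Sum>l<k. A i l * A j l)" by blast
  define P where "P = PiM {..<k} (\<lambda>_::nat. std_normal_distribution)"
  interpret P: prob_space P
    unfolding P_def by (intro prob_space_PiM) (simp add: prob_space_normal_density)
  have comp: "(\<lambda>z. z l) \<in> borel_measurable P" if "l < k" for l
    unfolding P_def using measurable_component_singleton[of l "{..<k}" "\<lambda>_. std_normal_distribution"] that by simp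
  define T where "T z = (\<lambda>i\<in>{..<k}. \<Sum>l<k. A i l * z l)" for z :: "nat \<Rightarrow> real"
  have T [measurable]: "T \<in> measurable P (\<Pi>\<^sub>M i\<in>{..<k}. borel)"
    unfolding T_def using comp by (intro measurable_restrict borel_measurable_sum borel_measurable_times) auto
  define N where "N = distr P (\<Pi>\<^sub>M i\<in>{..<k}. borel) T"
  have "distr N borel (\<lambda>z. \<Sum>i<k. a $ i * z i) = normal_law (a \<bullet> 0\<^sub>v k) (a \<bullet> (S *\<^sub>v a))"
    if a: "a \<in> carrier_vec k" for a
  proof -
    define b where "b l = (\<Sum>i<k. a $ i * A i l)" for l
    have v: "a \<bullet> (S *\<^sub>v a) = (\<Sum>l<k. (b l)\<^sup>2)"
    proof -
      have "a \<bullet> (S *\<^sub>v a) = (\<Sum>i<k. \<Sum>j<k. \<Sum>l<k. a $ i * a $ j * (A i l * A j l))"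
        unfolding quadratic_form_eq_sum[OF Sc a] using A by (simp add: sum_distrib_left)
      also have "\<dots> = (\<Sum>i<k. \<Sum>l<k. \<Sum>j<k. a $ i * a $ j * (A i l * A j l))"
        by (intro sum.cong refl sum.swap)
      also have "\<dots> = (\<Sum>l<k. \<Sum>i<k. \<Sum>j<k. a $ i * a $ j * (A i l * A j l))"
        by (rule sum.swap)
      also have "\<dots> = (\<Sum>l<k. (b l)\<^sup>2)"
        unfolding b_def power2_eq_square sum_product by (simp add: mult_ac)
      finally show ?thesis .
    qed
    have lin [measurable]: "(\<lambda>z. \<Sum>i<k. a $ i * z i) \<in> borel_measurable (\<Pi>\<^sub>M i\<in>{..<k}. borel)"
      by (intro borel_measurable_sum borel_measurable_times borel_measurable_const measurable_component_singleton) auto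
    have D: "distr N borel (\<lambda>z. \<Sum>i<k. a $ i * z i) = distr P borel (\<lambda>z. \<Sum>l<k. b l * z l)"
    proof -
      have "(\<lambda>z. \<Sum>i<k. a $ i * z i) \<circ> T = (\<lambda>z. \<Sum>l<k. b l * z l)"
      proof
        fix z
        have "((\<lambda>z. \<Sum>i<k. a $ i * z i) \<circ> T) z = (\<Sum>i<k. \<Sum>l<k. a $ i * (A i l * z l))"
          by (simp add: T_def sum_distrib_left)
        also have "\<dots> = (\<Sum>l<k. \<Sum>i<k. a $ i * (A i l * z l))" by (rule sum.swap)
        finally show "((\<lambda>z. \<Sum>i<k. a $ i * z i) \<circ> T) z = (\<Sum>l<k. b l * z l)"
          by (simp add: b_def sum_distrib_right mult.assoc)
      qed
      then show ?thesis unfolding N_def by (subst distr_distr) simp_all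
    qed
    have lb [measurable]: "(\<lambda>z. \<Sum>l<k. b l * z l) \<in> borel_measurable P"
      using comp by (intro borel_measurable_sum borel_measurable_times) auto
    \<comment> \<open>A linear combination of independent standard normals is identified by its
      characteristic function.\<close>
    have "distr P borel (\<lambda>z. \<Sum>l<k. b l * z l) = normal_law 0 (\<Sum>l<k. (b l)\<^sup>2)"
    proof (rule Levy_uniqueness)
      show "real_distribution (distr P borel (\<lambda>z. \<Sum>l<k. b l * z l))"
        by (simp add: real_distribution_def real_distribution_axioms_def P.prob_space_distr)
      show "real_distribution (normal_law 0 (\<Sum>l<k. (b l)\<^sup>2))"
        by (intro real_distribution_normal_law sum_nonneg) simp
      show "char (distr P borel (\<lambda>z. \<Sum>l<k. b l * z l)) = char (normal_law 0 (\<Sum>l<k. (b l)\<^sup>2))"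
      proof
        fix t
        have "char (distr P borel (\<lambda>z. \<Sum>l<k. b l * z l)) t = (\<integral>z. iexp (\<Sum>l<k. (t * b l) * z l) \<partial>P)"
          unfolding char_def by (subst integral_distr) (simp_all add: sum_distrib_left mult.assoc)
        also have "\<dots> = char (normal_law 0 (\<Sum>l<k. (b l)\<^sup>2)) t"
          unfolding P_def char_linear_std_normal_product
          by (subst char_normal_law) (auto simp: sum_nonneg power_mult_distrib sum_distrib_left mult.commute)
        finally show "char (distr P borel (\<lambda>z. \<Sum>l<k. b l * z l)) t = char (normal_law 0 (\<Sum>l<k. (b l)\<^sup>2)) t" .
      qed
    qed
    then show ?thesis using D v a by simp
  qed
  then have "multivariate_normal k (0\<^sub>v k) S N"
    using S by (simp add: multivariate_normal_def N_def)
  then show ?thesis by blast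
qed

text \<open>Total mass one is hidden in the requirement for a = 0: the image under the zero
  functional is a probability law.\<close>

lemma prob_space_multivariate_normal:
  assumes "multivariate_normal k m S N"
  shows "prob_space N"
proof -
  have "distr N borel (\<lambda>z. \<Sum>i<k. 0\<^sub>v k $ i * z i) = normal_law (0\<^sub>v k \<bullet> m) (0\<^sub>v k \<bullet> (S *\<^sub>v 0\<^sub>v k))"
    using assms zero_carrier_vec[of k] unfolding multivariate_normal_def by blast
  moreover have "0\<^sub>v k \<bullet> (S *\<^sub>v 0\<^sub>v k) \<ge> 0"
    using assms by (auto simp: multivariate_normal_def covariance_mat_def)
  ultimately have "prob_space (distr N borel (\<lambda>z. \<Sum>i<k. 0\<^sub>v k $ i * z i))"
    by (simp add: prob_space_normal_law)
  moreover have "(\<lambda>z::nat \<Rightarrow> real. \<Sum>i<k. 0\<^sub>v k $ i * z i) = (\<lambda>z. 0)"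
    by (auto intro!: sum.neutral)
  ultimately have "emeasure (distr N borel (\<lambda>z. 0::real)) UNIV = 1"
    using prob_space.emeasure_space_1 by fastforce
  then show ?thesis by (intro prob_spaceI) (simp add: emeasure_distr)
qed

lemma multivariate_normal_component_measurable:
  assumes "multivariate_normal k m S N" "j < k"
  shows "(\<lambda>z. z j) \<in> borel_measurable N"
proof -
  have "measurable N borel = measurable (\<Pi>\<^sub>M i\<in>{..<k}. borel) (borel :: real measure)"
    using assms(1) by (intro measurable_cong_sets) (auto simp: multivariate_normal_def)
  with assms(2) show ?thesis by (simp add: measurable_component_singleton)
qed

lemma iexp_multivariate_normal:
  assumes N: "multivariate_normal k (0\<^sub>v k) S N"
  shows "(\<integral>z. iexp (\<Sum>i<k. t i * z i) \<partial>N) = of_real (exp (- (vec k t \<bullet> (S *\<^sub>v vec k t)) / 2))"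
proof -
  let ?a = "vec k t"
  have m [measurable]: "(\<lambda>z. \<Sum>i<k. t i * z i) \<in> borel_measurable N"
    using multivariate_normal_component_measurable[OF N]
    by (intro borel_measurable_sum borel_measurable_times) auto
  have "distr N borel (\<lambda>z. \<Sum>i<k. ?a $ i * z i) = normal_law (?a \<bullet> 0\<^sub>v k) (?a \<bullet> (S *\<^sub>v ?a))"
    using N vec_carrier[of k t] unfolding multivariate_normal_def by blast
  moreover have "(\<lambda>z. \<Sum>i<k. ?a $ i * z i) = (\<lambda>z. \<Sum>i<k. t i * z i)"
    by (intro ext sum.cong) auto
  ultimately have D: "distr N borel (\<lambda>z. \<Sum>i<k. t i * z i) = normal_law 0 (?a \<bullet> (S *\<^sub>v ?a))"
    by simp
  have "(\<integral>z. iexp (\<Sum>i<k. t i * z i) \<partial>N) = char (distr N borel (\<lambda>z. \<Sum>i<k. t i * z i)) 1"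
    unfolding char_def by (subst integral_distr) simp_all
  also have "\<dots> = of_real (exp (- (?a \<bullet> (S *\<^sub>v ?a)) / 2))"
    unfolding D using N by (subst char_normal_law) (auto simp: multivariate_normal_def covariance_mat_def)
  finally show ?thesis .
qed

subsection \<open>The central limit theorem and remainder terms\<close>

text \<open>Shifts samples indexed from 1 to sequences indexed by all natural numbers, the form used
  in the central limit theorem.\<close>

lemma (in prob_space) indep_vars_reindex_inj:
  assumes I: "indep_vars M' X (f ` I)" and inj: "inj_on f I"
  shows "indep_vars (\<lambda>i. M' (f i)) (\<lambda>i. X (f i)) I"
  unfolding indep_vars_def2
proof (intro conjI ballI indep_setsI)
  show rv: "random_variable (M' (f i)) (X (f i))" if "i \<in> I" for i
    using I that by (auto simp: indep_vars_def2)
  show "{X (f i) -` A \<inter> space M |A. A \<in> sets (M' (f i))} \<subseteq> events" if "i \<in> I" for i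
    using rv[OF that] by auto
  fix A J assume J: "J \<noteq> {}" "J \<subseteq> I" "finite J"
    and A: "\<forall>j\<in>J. A j \<in> {X (f j) -` A \<inter> space M |A. A \<in> sets (M' (f j))}"
  then obtain B where B: "\<And>j. j \<in> J \<Longrightarrow> B j \<in> sets (M' (f j)) \<and> A j = X (f j) -` B j \<inter> space M"
    by (simp add: Bex_def) metis
  have injJ: "inj_on f J" using inj J(2) by (rule inj_on_subset)
  define C where "C i = B (the_inv_into J f i)" for i
  have C: "C (f j) = B j" if "j \<in> J" for j
    using that injJ by (simp add: C_def the_inv_into_f_f)
  have "prob (\<Inter>i\<in>f ` J. X i -` C i \<inter> space M) = (\<Prod>i\<in>f ` J. prob (X i -` C i \<inter> space M))"
    using J B C by (intro indep_varsD[OF I]) auto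
  moreover have "(\<Inter>i\<in>f ` J. X i -` C i \<inter> space M) = (\<Inter>j\<in>J. A j)"
    using B C by auto
  moreover have "(\<Prod>i\<in>f ` J. prob (X i -` C i \<inter> space M)) = (\<Prod>j\<in>J. prob (A j))"
    using B C by (subst prod.reindex[OF injJ]) (auto intro!: prod.cong)
  ultimately show "prob (\<Inter>j\<in>J. A j) = (\<Prod>j\<in>J. prob (A j))" by simp
qed

locale iid_centered = prob_space +
  fixes V :: "nat \<Rightarrow> 'a \<Rightarrow> real" and v :: real
  assumes indep: "indep_vars (\<lambda>_. borel) V {1..}"
    and ident: "\<And>i. i \<ge> 1 \<Longrightarrow> distr M borel (V i) = distr M borel (V 1)"
    and square_integrable: "integrable M (\<lambda>\<omega>. (V 1 \<omega>)\<^sup>2)"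
    and mean_zero: "expectation (V 1) = 0"
    and second_moment: "expectation (\<lambda>\<omega>. (V 1 \<omega>)\<^sup>2) = v"
begin

lemma measurable_V [measurable]: "i \<ge> 1 \<Longrightarrow> V i \<in> borel_measurable M"
  using indep by (auto simp: indep_vars_def2)

lemma v_nonneg: "v \<ge> 0"
  unfolding second_moment[symmetric] by simp

lemma integral_transfer:
  assumes "i \<ge> 1" and [measurable]: "f \<in> borel_measurable borel"
  shows "integrable M (\<lambda>\<omega>. f (V i \<omega>)) = integrable M (\<lambda>\<omega>. f (V 1 \<omega>) :: real)"
    "expectation (\<lambda>\<omega>. f (V i \<omega>)) = expectation (\<lambda>\<omega>. f (V 1 \<omega>))"
proof -
  have [measurable]: "V i \<in> borel_measurable M" "V 1 \<in> borel_measurable M" using assms by auto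
  show "integrable M (\<lambda>\<omega>. f (V i \<omega>)) = integrable M (\<lambda>\<omega>. f (V 1 \<omega>))"
    using integrable_distr_eq[of "V i" M borel f] integrable_distr_eq[of "V 1" M borel f] ident[OF assms(1)] by simp
  show "expectation (\<lambda>\<omega>. f (V i \<omega>)) = expectation (\<lambda>\<omega>. f (V 1 \<omega>))"
    using integral_distr[of "V i" M borel f] integral_distr[of "V 1" M borel f] ident[OF assms(1)] by simp
qed

lemma moments:
  assumes "i \<ge> 1"
  shows "integrable M (\<lambda>\<omega>. (V i \<omega>)\<^sup>2)" "integrable M (V i)" "expectation (V i) = 0"
    "expectation (\<lambda>\<omega>. (V i \<omega>)\<^sup>2) = v"
proof -
  show 1: "integrable M (\<lambda>\<omega>. (V i \<omega>)\<^sup>2)"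
    using integral_transfer(1)[OF assms, of "\<lambda>x. x\<^sup>2"] square_integrable by simp
  show "integrable M (V i)"
    by (rule square_integrable_imp_integrable[OF measurable_V[OF assms] 1])
  show "expectation (V i) = 0"
    using integral_transfer(2)[OF assms, of "\<lambda>x. x"] mean_zero by simp
  show "expectation (\<lambda>\<omega>. (V i \<omega>)\<^sup>2) = v"
    using integral_transfer(2)[OF assms, of "\<lambda>x. x\<^sup>2"] second_moment by simp
qed

text \<open>Cross terms vanish, because the new variable is centred and independent of the partial
  sum.\<close>

lemma second_moment_sum:
  "integrable M (\<lambda>\<omega>. (\<Sum>i=1..n. V i \<omega>)\<^sup>2) \<and> expectation (\<lambda>\<omega>. (\<Sum>i=1..n. V i \<omega>)\<^sup>2) = n * v"
proof (induction n)
  case 0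
  then show ?case by simp
next
  case (Suc n)
  let ?S = "\<lambda>\<omega>. \<Sum>i=1..n. V i \<omega>" and ?V = "V (Suc n)"
  have "indep_vars (\<lambda>_. borel) V (insert (Suc n) {1..n})"
    by (rule indep_vars_subset[OF indep]) auto
  then have ind: "indep_var borel ?V borel ?S" by (intro indep_vars_sum) auto
  have iS: "integrable M ?S" by (intro Bochner_Integration.integrable_sum moments) auto
  have iV: "integrable M ?V" by (intro moments) auto
  have iP: "integrable M (\<lambda>\<omega>. ?V \<omega> * ?S \<omega>)" by (rule indep_var_integrable[OF ind iV iS])
  have eP: "expectation (\<lambda>\<omega>. ?V \<omega> * ?S \<omega>) = 0"
    unfolding indep_var_lebesgue_integral[OF ind iV iS] using moments(3)[of "Suc n"] by simp
  have eq: "(\<Sum>i=1..Suc n. V i \<omega>)\<^sup>2 = (?S \<omega>)\<^sup>2 + 2 * (?V \<omega> * ?S \<omega>) + (?V \<omega>)\<^sup>2" for \<omega>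
    by (simp add: power2_eq_square algebra_simps)
  have "integrable M (\<lambda>\<omega>. (?V \<omega>)\<^sup>2)" "expectation (\<lambda>\<omega>. (?V \<omega>)\<^sup>2) = v"
    using moments[of "Suc n"] by auto
  with Suc iP eP show ?case
    unfolding eq by (simp add: algebra_simps)
qed

text \<open>For n = 0 both the average and the bound are zero, since division by zero is
  zero.\<close>

lemma second_moment_avg:
  "integrable M (\<lambda>\<omega>. (avg n (\<lambda>i. V i \<omega>))\<^sup>2)" "expectation (\<lambda>\<omega>. (avg n (\<lambda>i. V i \<omega>))\<^sup>2) = v / n"
  using second_moment_sum[of n] by (auto simp: avg_def power_divide power2_eq_square)

lemma measurable_avg [measurable]: "(\<lambda>\<omega>. avg n (\<lambda>i. V i \<omega>)) \<in> borel_measurable M"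
  unfolding avg_def by (intro borel_measurable_divide borel_measurable_sum borel_measurable_const) auto

text \<open>Variance zero is a case of its own, as normalizing by the standard deviation fails
  there; a linear combination of influence functions may well be degenerate.\<close>

lemma clt_iexp:
  "(\<lambda>n. \<integral>\<omega>. iexp (sqrt n * avg n (\<lambda>i. V i \<omega>)) \<partial>M) \<longlonglongrightarrow> of_real (exp (- v / 2))"
proof (cases "v = 0")
  case True
  have avg0: "AE \<omega> in M. avg n (\<lambda>i. V i \<omega>) = 0" for n
    using integral_nonneg_eq_0_iff_AE[OF second_moment_avg(1)[of n]] second_moment_avg(2)[of n] True
    by simp
  have "AE \<omega> in M. iexp (sqrt n * avg n (\<lambda>i. V i \<omega>)) = 1" for n :: nat
    using avg0[of n] by (rule eventually_mono) simp
  then have "(\<integral>\<omega>. iexp (sqrt n * avg n (\<lambda>i. V i \<omega>)) \<partial>M) = (\<integral>\<omega>. 1 \<partial>M)" for n :: nat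
    by (intro integral_cong_AE) simp_all
  then show ?thesis using True by (simp add: prob_space)
next
  case False
  define \<sigma> where "\<sigma> = sqrt v"
  have \<sigma>: "\<sigma> > 0" "\<sigma>\<^sup>2 = v" using False v_nonneg by (auto simp: \<sigma>_def)
  define X where "X i = V (Suc i)" for i
  have "indep_vars (\<lambda>_. borel) V (Suc ` UNIV)"
    by (rule indep_vars_subset[OF indep]) auto
  from indep_vars_reindex_inj[OF this] have iX: "indep_vars (\<lambda>_. borel) X UNIV"
    by (simp add: X_def[abs_def])
  have [measurable]: "X i \<in> borel_measurable M" for i unfolding X_def by simp
  have "weak_conv_m (\<lambda>n. distr M borel (\<lambda>x. (\<Sum>i<n. X i x) / sqrt (n * \<sigma>\<^sup>2))) std_normal_distribution"
  proof (rule central_limit_theorem_zero_mean[OF iX])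
    show "expectation (X n) = 0" for n unfolding X_def by (rule moments) simp
    then show "variance (X n) = \<sigma>\<^sup>2" for n
      using moments(4)[of "Suc n"] \<sigma> by (simp add: X_def)
    show "integrable M (\<lambda>x. (X n x)\<^sup>2)" for n unfolding X_def by (rule moments) simp
    show "distr M borel (X n) = distr M borel (V 1)" for n unfolding X_def by (rule ident) simp
  qed (rule \<sigma>)
  \<comment> \<open>Evaluating the characteristic function at \<sigma> undoes the division by the
    standard deviation.\<close>
  from levy_continuity1[OF _ real_dist_normal_dist this, of \<sigma>]
  have "(\<lambda>n. char (distr M borel (\<lambda>x. (\<Sum>i<n. X i x) / sqrt (n * \<sigma>\<^sup>2))) \<sigma>) \<longlonglongrightarrow> char std_normal_distribution \<sigma>"
    by (simp add: real_distribution_def real_distribution_axioms_def prob_space_distr)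
  moreover have "char (distr M borel (\<lambda>x. (\<Sum>i<n. X i x) / sqrt (n * \<sigma>\<^sup>2))) \<sigma> =
      (\<integral>\<omega>. iexp (sqrt n * avg n (\<lambda>i. V i \<omega>)) \<partial>M)" for n :: nat
  proof -
    have "\<sigma> * ((\<Sum>i<n. X i x) / sqrt (n * \<sigma>\<^sup>2)) = sqrt n * avg n (\<lambda>i. V i x)" for x
    proof -
      have "(\<Sum>i<n. X i x) = (\<Sum>i=1..n. V i x)"
        unfolding X_def by (simp add: sum.atLeast1_atMost_eq)
      moreover have "sqrt (n * \<sigma>\<^sup>2) = sqrt n * \<sigma>" using \<sigma>(1) by (simp add: real_sqrt_mult)
      moreover have "\<sigma> * (S / (sqrt n * \<sigma>)) = sqrt n * (S / (sqrt n * sqrt n))" for S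
        using \<sigma>(1) by (cases "n = 0") (simp_all del: real_sqrt_mult_self)
      ultimately show ?thesis by (simp add: avg_def)
    qed
    then show ?thesis unfolding char_def by (subst integral_distr) simp_all
  qed
  ultimately show ?thesis using \<sigma> by (simp add: char_std_normal_distribution)
qed

end

section \<open>From a linearization to the limit of characteristic functions\<close>

lemma cmod_iexp_diff_le: "cmod (iexp a - iexp b) \<le> \<bar>a - b\<bar>"
proof -
  have "iexp a - iexp b = iexp b * (iexp (a - b) - 1)"
    by (simp add: right_diff_distrib flip: exp_add)
  then have "cmod (iexp a - iexp b) = cmod (iexp (a - b) - 1)"
    by (simp add: norm_mult)
  also have "\<dots> \<le> \<bar>a - b\<bar>" using iexp_approx1[of "a - b" 0] by simp
  finally show ?thesis .
qed

text \<open>A quantitative Slutsky argument. Where |\<open>e n\<close>| exceeds \<eta>, the trivial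
  bound 2 is at most 2 e^2/\<eta>^2, as in Chebyshev's inequality; elsewhere \<open>close\<close>
  applies. Both bounds are multiples of e^2, whose mean is O(1/n), with factors of order at most
  sqrt(n).\<close>

lemma (in prob_space) slutsky_iexp:
  fixes Y A e :: "nat \<Rightarrow> 'a \<Rightarrow> real"
  assumes [measurable]: "\<And>n. Y n \<in> borel_measurable M" "\<And>n. A n \<in> borel_measurable M"
    and e2: "\<And>n. integrable M (\<lambda>\<omega>. (e n \<omega>)\<^sup>2)" "\<And>n. expectation (\<lambda>\<omega>. (e n \<omega>)\<^sup>2) \<le> K / n"
    and \<eta>: "\<eta> > 0" and C: "C \<ge> 0"
    and close: "\<And>n \<omega>. n \<ge> 1 \<Longrightarrow> \<bar>e n \<omega>\<bar> \<le> \<eta> \<Longrightarrow> \<bar>Y n \<omega> - A n \<omega>\<bar> \<le> C * sqrt n * (e n \<omega>)\<^sup>2"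
    and lim: "(\<lambda>n. \<integral>\<omega>. iexp (A n \<omega>) \<partial>M) \<longlonglongrightarrow> L"
  shows "(\<lambda>n. \<integral>\<omega>. iexp (Y n \<omega>) \<partial>M) \<longlonglongrightarrow> L"
proof -
  have bound: "cmod ((\<integral>\<omega>. iexp (Y n \<omega>) \<partial>M) - (\<integral>\<omega>. iexp (A n \<omega>) \<partial>M)) \<le> (2 / \<eta>\<^sup>2 + C * sqrt n) * (K / n)"
    if n: "n \<ge> 1" for n :: nat
  proof -
    have iY: "integrable M (\<lambda>\<omega>. iexp (Y n \<omega>))" and iA: "integrable M (\<lambda>\<omega>. iexp (A n \<omega>))"
      by (intro integrable_iexp; simp)+
    have pt: "cmod (iexp (Y n \<omega>) - iexp (A n \<omega>)) \<le> (2 / \<eta>\<^sup>2 + C * sqrt n) * (e n \<omega>)\<^sup>2" for \<omega>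
    proof (cases "\<bar>e n \<omega>\<bar> \<le> \<eta>")
      case True
      have "cmod (iexp (Y n \<omega>) - iexp (A n \<omega>)) \<le> C * sqrt n * (e n \<omega>)\<^sup>2"
        using cmod_iexp_diff_le close[OF n True] by (rule order_trans)
      also have "\<dots> \<le> (2 / \<eta>\<^sup>2 + C * sqrt n) * (e n \<omega>)\<^sup>2"
        by (intro mult_right_mono) auto
      finally show ?thesis .
    next
      case False
      have "cmod (iexp (Y n \<omega>) - iexp (A n \<omega>)) \<le> 2"
        using norm_triangle_ineq4[of "iexp (Y n \<omega>)" "iexp (A n \<omega>)"] by simp
      also have "\<eta>\<^sup>2 \<le> (e n \<omega>)\<^sup>2" using False \<eta> by (simp add: abs_le_square_iff[symmetric])
      then have "2 \<le> 2 / \<eta>\<^sup>2 * (e n \<omega>)\<^sup>2" using \<eta> by (simp add: field_simps)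
      also have "\<dots> \<le> (2 / \<eta>\<^sup>2 + C * sqrt n) * (e n \<omega>)\<^sup>2"
        using C by (intro mult_right_mono) auto
      finally show ?thesis .
    qed
    have "cmod ((\<integral>\<omega>. iexp (Y n \<omega>) \<partial>M) - (\<integral>\<omega>. iexp (A n \<omega>) \<partial>M)) = cmod (\<integral>\<omega>. iexp (Y n \<omega>) - iexp (A n \<omega>) \<partial>M)"
      by (simp only: Bochner_Integration.integral_diff[OF iY iA])
    also have "\<dots> \<le> (\<integral>\<omega>. cmod (iexp (Y n \<omega>) - iexp (A n \<omega>)) \<partial>M)"
      by (rule integral_norm_bound)
    also have "\<dots> \<le> (\<integral>\<omega>. (2 / \<eta>\<^sup>2 + C * sqrt n) * (e n \<omega>)\<^sup>2 \<partial>M)"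
      using pt by (intro integral_mono integrable_norm Bochner_Integration.integrable_diff iY iA
          integrable_mult_right e2) auto
    also have "\<dots> = (2 / \<eta>\<^sup>2 + C * sqrt n) * expectation (\<lambda>\<omega>. (e n \<omega>)\<^sup>2)"
      by simp
    also have "\<dots> \<le> (2 / \<eta>\<^sup>2 + C * sqrt n) * (K / n)"
      using C by (intro mult_left_mono e2) auto
    finally show ?thesis .
  qed
  have "(\<lambda>n::nat. (2 / \<eta>\<^sup>2 + C * sqrt n) * (K / n)) \<longlonglongrightarrow> 0" by real_asymp
  then have "(\<lambda>n. (\<integral>\<omega>. iexp (Y n \<omega>) \<partial>M) - (\<integral>\<omega>. iexp (A n \<omega>) \<partial>M)) \<longlonglongrightarrow> 0"
    by (rule Lim_null_comparison[rotated]) (use bound in \<open>auto intro!: eventually_sequentiallyI[of 1]\<close>)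
  from tendsto_add[OF this lim] show ?thesis by simp
qed

text \<open>Cauchy-Schwarz for a sum with \<open>card J\<close> terms, followed by the second
  moments of the single averages.\<close>

lemma (in prob_space) second_moment_sum_avg:
  fixes \<phi> :: "'i \<Rightarrow> nat \<Rightarrow> 'a \<Rightarrow> real" and v :: "'i \<Rightarrow> real"
  assumes J: "finite J" and iid: "\<And>j. j \<in> J \<Longrightarrow> iid_centered M (\<phi> j) (v j)"
  shows "integrable M (\<lambda>\<omega>. (\<Sum>j\<in>J. \<bar>avg n (\<lambda>i. \<phi> j i \<omega>)\<bar>)\<^sup>2)"
    "expectation (\<lambda>\<omega>. (\<Sum>j\<in>J. \<bar>avg n (\<lambda>i. \<phi> j i \<omega>)\<bar>)\<^sup>2) \<le> (card J * (\<Sum>j\<in>J. v j)) / n"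
proof -
  let ?a = "\<lambda>j \<omega>. avg n (\<lambda>i. \<phi> j i \<omega>)"
  have [measurable]: "(\<lambda>\<omega>. ?a j \<omega>) \<in> borel_measurable M" if "j \<in> J" for j
    using iid_centered.measurable_avg[OF iid[OF that]] by simp
  have i2: "integrable M (\<lambda>\<omega>. (\<Sum>j\<in>J. (?a j \<omega>)\<^sup>2) * card J)"
    by (intro integrable_mult_left Bochner_Integration.integrable_sum iid_centered.second_moment_avg[OF iid])
  have le: "(\<Sum>j\<in>J. \<bar>?a j \<omega>\<bar>)\<^sup>2 \<le> (\<Sum>j\<in>J. (?a j \<omega>)\<^sup>2) * card J" for \<omega>
    using sum_squared_le_sum_of_squares[of "\<lambda>j. \<bar>?a j \<omega>\<bar>" J] by simp
  show 1: "integrable M (\<lambda>\<omega>. (\<Sum>j\<in>J. \<bar>?a j \<omega>\<bar>)\<^sup>2)"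
    by (rule Bochner_Integration.integrable_bound[OF i2]) (use le in \<open>auto simp: sum_nonneg\<close>)
  have "expectation (\<lambda>\<omega>. (\<Sum>j\<in>J. \<bar>?a j \<omega>\<bar>)\<^sup>2) \<le> expectation (\<lambda>\<omega>. (\<Sum>j\<in>J. (?a j \<omega>)\<^sup>2) * card J)"
    using le by (intro integral_mono 1 i2)
  also have "\<dots> = (\<Sum>j\<in>J. v j / n) * card J"
    using iid_centered.second_moment_avg[OF iid]
    by (simp add: Bochner_Integration.integral_sum)
  finally show "expectation (\<lambda>\<omega>. (\<Sum>j\<in>J. \<bar>?a j \<omega>\<bar>)\<^sup>2) \<le> (card J * (\<Sum>j\<in>J. v j)) / n"
    by (simp add: sum_divide_distrib[symmetric] mult.commute)
qed

subsection \<open>Unbiased polynomials and growth\<close>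

text \<open>The joint law is a product, so Y can be integrated out first; its inner integral is
  again taken over \<open>M\<close>, at a second sample point.\<close>

lemma (in prob_space) indep_var_fubini:
  fixes f :: "'b \<times> 'b \<Rightarrow> real"
  assumes ind: "indep_var S X T Y" and f [measurable]: "f \<in> borel_measurable (S \<Otimes>\<^sub>M T)"
    and int: "integrable M (\<lambda>\<omega>. f (X \<omega>, Y \<omega>))"
  shows "expectation (\<lambda>\<omega>. f (X \<omega>, Y \<omega>)) = expectation (\<lambda>\<omega>. expectation (\<lambda>\<omega>'. f (X \<omega>, Y \<omega>')))"
proof -
  from ind have [measurable]: "X \<in> measurable M S" "Y \<in> measurable M T"
    and D: "distr M S X \<Otimes>\<^sub>M distr M T Y = distr M (S \<Otimes>\<^sub>M T) (\<lambda>x. (X x, Y x))"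
    by (auto simp: indep_var_distribution_eq)
  interpret X: prob_space "distr M S X" by (rule prob_space_distr) simp
  interpret Y: prob_space "distr M T Y" by (rule prob_space_distr) simp
  interpret XY: pair_sigma_finite "distr M S X" "distr M T Y" ..
  have "integrable (distr M S X \<Otimes>\<^sub>M distr M T Y) f"
    unfolding D by (subst integrable_distr_eq) (simp_all add: int)
  from XY.integral_fst'[OF this]
  have "expectation (\<lambda>\<omega>. f (X \<omega>, Y \<omega>)) = (\<integral>x. (\<integral>y. f (x, y) \<partial>distr M T Y) \<partial>distr M S X)"
    unfolding D by (subst (asm) (3) integral_distr) simp_all
  also have "\<dots> = expectation (\<lambda>\<omega>. (\<integral>y. f (X \<omega>, y) \<partial>distr M T Y))"
    by (subst integral_distr) simp_all
  also have "\<dots> = expectation (\<lambda>\<omega>. expectation (\<lambda>\<omega>'. f (X \<omega>, Y \<omega>')))"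
    by (intro Bochner_Integration.integral_cong refl, subst integral_distr) (auto intro: measurable_space)
  finally show ?thesis .
qed

text \<open>The almost-sure counterpart: it lets one variable move while the other stays
  frozen.\<close>

lemma (in prob_space) indep_var_AE:
  assumes ind: "indep_var S X T Y" and P [measurable]: "Measurable.pred (S \<Otimes>\<^sub>M T) P"
    and ae: "AE \<omega> in M. P (X \<omega>, Y \<omega>)"
  shows "AE \<omega> in M. AE \<omega>' in M. P (X \<omega>, Y \<omega>')"
proof -
  from ind have [measurable]: "X \<in> measurable M S" "Y \<in> measurable M T"
    and D: "distr M S X \<Otimes>\<^sub>M distr M T Y = distr M (S \<Otimes>\<^sub>M T) (\<lambda>x. (X x, Y x))"
    by (auto simp: indep_var_distribution_eq)
  interpret X: prob_space "distr M S X" by (rule prob_space_distr) simp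
  interpret Y: prob_space "distr M T Y" by (rule prob_space_distr) simp
  interpret XY: pair_sigma_finite "distr M S X" "distr M T Y" ..
  have "AE z in distr M S X \<Otimes>\<^sub>M distr M T Y. P z"
    unfolding D by (subst AE_distr_iff) (use ae in auto)
  from XY.AE_pair[OF this] have "AE x in distr M S X. AE y in distr M T Y. P (x, y)" .
  then have "AE \<omega> in M. AE y in distr M T Y. P (X \<omega>, y)"
    by (rule AE_distrD[rotated]) simp
  then show ?thesis
    by (rule AE_mp[OF _ AE_I2]) (auto dest: AE_distrD[rotated] intro!: impI)
qed

lemma (in prob_space) integrable_powers_le:
  fixes X :: "'a \<Rightarrow> real"
  assumes [measurable]: "X \<in> borel_measurable M" and "even n" "integrable M (\<lambda>\<omega>. X \<omega> ^ n)" "k \<le> n"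
  shows "integrable M (\<lambda>\<omega>. X \<omega> ^ k)"
proof (rule Bochner_Integration.integrable_bound[where f="\<lambda>\<omega>. 1 + X \<omega> ^ n"])
  have "\<bar>a\<bar> ^ k \<le> 1 + \<bar>a\<bar> ^ n" for a :: real
  proof (cases "\<bar>a\<bar> \<le> 1")
    case True
    then have "\<bar>a\<bar> ^ k \<le> 1" by (intro power_le_one) auto
    then show ?thesis by (meson add_increasing2 order_trans zero_le_power_abs)
  next
    case False
    then have "\<bar>a\<bar> ^ k \<le> \<bar>a\<bar> ^ n" using assms(4) by (intro power_increasing) auto
    then show ?thesis by simp
  qed
  moreover have "\<bar>a\<bar> ^ n = a ^ n" for a :: real using assms(2) by (simp add: power_even_abs)
  ultimately show "AE \<omega> in M. norm (X \<omega> ^ k) \<le> norm (1 + X \<omega> ^ n)"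
    by (auto simp: power_abs zero_le_even_power[OF assms(2)] intro!: AE_I2)
qed (use assms in auto)

lemma measurable_t_pol [measurable]: "t_pol md r \<in> borel_measurable borel"
proof (induction r rule: less_induct)
  case (less r)
  have t_pol_eq: "t_pol md r = (\<lambda>w. w ^ r - (\<Sum>i<r. real (r choose i) * md (r - i) * t_pol md i w))"
    by (rule ext) (rule t_pol.simps)
  show ?case
    unfolding t_pol_eq
    using less by (intro borel_measurable_diff borel_measurable_sum borel_measurable_times borel_measurable_power) auto
qed

lemma measurable_g_pol [measurable]: "g_pol md mu r \<in> borel_measurable borel"
  unfolding g_pol_def[abs_def] by measurable

text \<open>Makes \<open>t_pol\<close> a polynomial object, so that roots can be counted in the
  nonsingularity proof.\<close>

lemma t_pol_eq_poly:
  "\<exists>p. Polynomial.degree p \<le> r \<and> (\<forall>w. t_pol md r w = poly p w)"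
proof (induction r rule: less_induct)
  case (less r)
  then obtain p where p: "\<And>i. i < r \<Longrightarrow> Polynomial.degree (p i) \<le> i" "\<And>i w. i < r \<Longrightarrow> t_pol md i w = poly (p i) w"
    by metis
  define q where "q = Polynomial.monom 1 r - (\<Sum>i<r. Polynomial.smult (real (r choose i) * md (r - i)) (p i))"
  have "t_pol md r w = poly q w" for w
    using p(2) by (subst t_pol.simps) (simp add: q_def poly_sum poly_monom)
  moreover have "Polynomial.degree q \<le> r"
    unfolding q_def
  proof (intro degree_diff_le degree_sum_le)
    show "Polynomial.degree (Polynomial.smult (real (r choose i) * md (r - i)) (p i)) \<le> r" if "i \<in> {..<r}" for i
      using p(1)[of i] that degree_smult_le[of "real (r choose i) * md (r - i)" "p i"] by simp
  qed (auto simp: degree_monom_le)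
  ultimately show ?case by blast
qed

lemma (in prob_space) expectation_power_shift:
  fixes X :: "'a \<Rightarrow> real"
  assumes "\<And>k. k \<le> r \<Longrightarrow> integrable M (\<lambda>\<omega>. X \<omega> ^ k)"
  shows "integrable M (\<lambda>\<omega>. (a + X \<omega>) ^ r)"
    "expectation (\<lambda>\<omega>. (a + X \<omega>) ^ r) = (\<Sum>i\<le>r. real (r choose i) * a ^ i * expectation (\<lambda>\<omega>. X \<omega> ^ (r - i)))"
proof -
  have int: "integrable M (\<lambda>\<omega>. real (r choose i) * a ^ i * X \<omega> ^ (r - i))" for i
    by (intro integrable_mult_right assms) simp
  then show "integrable M (\<lambda>\<omega>. (a + X \<omega>) ^ r)"
    unfolding binomial_ring by (intro Bochner_Integration.integrable_sum)
  show "expectation (\<lambda>\<omega>. (a + X \<omega>) ^ r) = (\<Sum>i\<le>r. real (r choose i) * a ^ i * expectation (\<lambda>\<omega>. X \<omega> ^ (r - i)))"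
    unfolding binomial_ring
    by (subst Bochner_Integration.integral_sum, rule int) simp
qed

text \<open>The recursion for \<open>t_pol\<close> subtracts precisely the lower binomial terms of
  the mean of (a + X)^r, so by induction a^r alone remains. This is the unbiasedness on which all
  the estimators rest.\<close>

lemma (in prob_space) expectation_t_pol_shift:
  fixes X :: "'a \<Rightarrow> real"
  assumes "\<And>k. k \<le> r \<Longrightarrow> integrable M (\<lambda>\<omega>. X \<omega> ^ k)"
    and md: "\<And>k. md k = expectation (\<lambda>\<omega>. X \<omega> ^ k)"
  shows "integrable M (\<lambda>\<omega>. t_pol md r (a + X \<omega>)) \<and> expectation (\<lambda>\<omega>. t_pol md r (a + X \<omega>)) = a ^ r"
  using assms(1)
proof (induction r rule: less_induct)
  case (less r)
  let ?s = "\<lambda>\<omega>. \<Sum>i<r. real (r choose i) * md (r - i) * t_pol md i (a + X \<omega>)"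
  have IH: "integrable M (\<lambda>\<omega>. t_pol md i (a + X \<omega>))" "expectation (\<lambda>\<omega>. t_pol md i (a + X \<omega>)) = a ^ i"
    if "i < r" for i
    using less.IH[OF that] less.prems that by auto
  have sh: "integrable M (\<lambda>\<omega>. (a + X \<omega>) ^ r)"
    "expectation (\<lambda>\<omega>. (a + X \<omega>) ^ r) = (\<Sum>i\<le>r. real (r choose i) * a ^ i * expectation (\<lambda>\<omega>. X \<omega> ^ (r - i)))"
    by (rule expectation_power_shift, erule less.prems)+
  have isum: "integrable M ?s"
    by (intro Bochner_Integration.integrable_sum integrable_mult_right IH) simp
  have "expectation ?s = (\<Sum>i<r. real (r choose i) * md (r - i) * a ^ i)"
    using IH by (subst Bochner_Integration.integral_sum) auto
  moreover have "expectation (\<lambda>\<omega>. (a + X \<omega>) ^ r) = (\<Sum>i<r. real (r choose i) * md (r - i) * a ^ i) + a ^ r"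
  proof -
    have "expectation (\<lambda>\<omega>. (a + X \<omega>) ^ r) = (\<Sum>i<Suc r. real (r choose i) * a ^ i * md (r - i))"
      unfolding lessThan_Suc_atMost md by (rule sh(2))
    also have "\<dots> = (\<Sum>i<r. real (r choose i) * a ^ i * md (r - i)) + a ^ r"
      by (simp add: md prob_space)
    also have "(\<Sum>i<r. real (r choose i) * a ^ i * md (r - i)) = (\<Sum>i<r. real (r choose i) * md (r - i) * a ^ i)"
      by (intro sum.cong refl) simp
    finally show ?thesis .
  qed
  ultimately show ?case
    unfolding t_pol.simps[of md r] using sh(1) isum by simp
qed

section \<open>Weighted growth classes\<close>

type_synonym quadruple = "real \<times> real \<times> real \<times> real"

text \<open>Weighted growth: \<open>x\<close>, \<open>\<delta>\<close>, \<open>u\<close> count with weight one and \<open>\<epsilon>\<close> with weight \<open>d\<close>.\<close>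

definition growth_scale :: "nat \<Rightarrow> quadruple \<Rightarrow> real" where
  "growth_scale d = (\<lambda>(x, \<delta>, u, \<epsilon>). 1 + \<bar>x\<bar> ^ d + \<bar>\<delta>\<bar> ^ d + \<bar>u\<bar> ^ d + \<bar>\<epsilon>\<bar>)"

text \<open>Level k stands for weighted degree k d. In the model the fourth power of the scale is
  integrable, so level 4 gives integrability and level 2 square integrability.\<close>

definition growth :: "nat \<Rightarrow> nat \<Rightarrow> (quadruple \<Rightarrow> real) \<Rightarrow> bool" where
  "growth d k f \<longleftrightarrow> f \<in> borel_measurable borel \<and> (\<exists>C\<ge>0. \<forall>z. \<bar>f z\<bar> \<le> C * growth_scale d z ^ k)"

lemma growth_scale_ge_1: "growth_scale d z \<ge> 1"
  by (cases z) (simp add: growth_scale_def)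

lemma growth_measurable: "growth d k f \<Longrightarrow> f \<in> borel_measurable borel"
  by (simp add: growth_def)

lemma growth_mono:
  assumes "growth d k f" "k \<le> l"
  shows "growth d l f"
proof -
  from assms(1) obtain C where C: "C \<ge> 0" "\<And>z. \<bar>f z\<bar> \<le> C * growth_scale d z ^ k"
    by (auto simp: growth_def)
  have "C * growth_scale d z ^ k \<le> C * growth_scale d z ^ l" for z
    using C(1) growth_scale_ge_1 assms(2) by (intro mult_left_mono power_increasing) auto
  with C assms(1) show ?thesis unfolding growth_def by (meson order_trans)
qed

lemma growth_const: "growth d k (\<lambda>_. c)"
proof -
  have "\<bar>c\<bar> \<le> \<bar>c\<bar> * growth_scale d z ^ k" for z
    using one_le_power[OF growth_scale_ge_1[of d z], of k] by (simp add: mult_le_cancel_left1)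
  then show ?thesis unfolding growth_def by (auto intro!: exI[of _ "\<bar>c\<bar>"])
qed

lemma growth_add:
  assumes "growth d k f" "growth d k g"
  shows "growth d k (\<lambda>z. f z + g z)"
proof -
  from assms obtain C D where C: "C \<ge> 0" "\<And>z. \<bar>f z\<bar> \<le> C * growth_scale d z ^ k"
    and D: "D \<ge> 0" "\<And>z. \<bar>g z\<bar> \<le> D * growth_scale d z ^ k"
    by (auto simp: growth_def)
  have "\<bar>f z + g z\<bar> \<le> (C + D) * growth_scale d z ^ k" for z
    using C(2)[of z] D(2)[of z] abs_triangle_ineq[of "f z" "g z"] by (simp add: distrib_right)
  with C(1) D(1) assms show ?thesis unfolding growth_def by (auto intro!: exI[of _ "C + D"])
qed

lemma growth_mult:
  assumes "growth d k f" "growth d l g"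
  shows "growth d (k + l) (\<lambda>z. f z * g z)"
proof -
  from assms obtain C D where C: "C \<ge> 0" "\<And>z. \<bar>f z\<bar> \<le> C * growth_scale d z ^ k"
    and D: "D \<ge> 0" "\<And>z. \<bar>g z\<bar> \<le> D * growth_scale d z ^ l"
    by (auto simp: growth_def)
  have "\<bar>f z * g z\<bar> \<le> (C * D) * growth_scale d z ^ (k + l)" for z
    using mult_mono[OF C(2)[of z] D(2)[of z]] C(1) growth_scale_ge_1[of d z]
    by (simp add: abs_mult power_add mult_ac)
  with C(1) D(1) assms show ?thesis unfolding growth_def by (auto intro!: exI[of _ "C * D"])
qed

lemma growth_cmult: "growth d k f \<Longrightarrow> growth d k (\<lambda>z. c * f z)"
  using growth_mult[OF growth_const[of d 0 c]] by simp

lemma growth_diff: "growth d k f \<Longrightarrow> growth d k g \<Longrightarrow> growth d k (\<lambda>z. f z - g z)"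
  using growth_add[of d k f "\<lambda>z. -1 * g z"] growth_cmult[of d k g "-1"] by simp

lemma growth_sum: "(\<And>i. i \<in> I \<Longrightarrow> growth d k (f i)) \<Longrightarrow> growth d k (\<lambda>z. \<Sum>i\<in>I. f i z)"
proof (induction I rule: infinite_finite_induct)
  case (insert i I)
  then show ?case using growth_add[of d k "f i" "\<lambda>z. \<Sum>i\<in>I. f i z"] by simp
qed (simp_all add: growth_const)

lemma power_add_le:
  fixes a b :: real
  assumes "r \<le> d"
  shows "\<bar>a + b\<bar> ^ r \<le> 2 ^ d * (1 + \<bar>a\<bar> ^ d + \<bar>b\<bar> ^ d)"
proof -
  define m where "m = max \<bar>a\<bar> \<bar>b\<bar>"
  have m: "0 \<le> m" by (simp add: m_def)
  have "\<bar>a + b\<bar> ^ r \<le> (2 * m) ^ r"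
    by (intro power_mono) (auto simp: m_def)
  also have "\<dots> = 2 ^ r * m ^ r" by (simp add: power_mult_distrib)
  also have "\<dots> \<le> 2 ^ d * m ^ r" using assms m by (intro mult_right_mono power_increasing) auto
  also have "m ^ r \<le> 1 + m ^ d"
  proof (cases "m \<le> 1")
    case True
    then show ?thesis using power_le_one[OF m, of r] zero_le_power[OF m, of d] by linarith
  next
    case False
    then have "m ^ r \<le> m ^ d" using assms by (intro power_increasing) auto
    then show ?thesis by simp
  qed
  also have "m ^ d \<le> \<bar>a\<bar> ^ d + \<bar>b\<bar> ^ d"
    by (auto simp: m_def max_def)
  finally show ?thesis by (simp add: add.assoc mult_left_mono)
qed

lemma growth_power_add:
  assumes r: "r \<le> d" and [measurable]: "a \<in> borel_measurable borel" "b \<in> borel_measurable borel"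
    and ab: "\<And>z. 1 + \<bar>a z\<bar> ^ d + \<bar>b z\<bar> ^ d \<le> growth_scale d z"
  shows "growth d 1 (\<lambda>z. (a z + b z) ^ r)"
  unfolding growth_def
proof (intro conjI exI[of _ "2 ^ d"] allI)
  show "(\<lambda>z. (a z + b z) ^ r) \<in> borel_measurable borel" by measurable
  have "\<bar>a z + b z\<bar> ^ r \<le> 2 ^ d * growth_scale d z" for z
    by (rule order_trans[OF power_add_le[OF r] mult_left_mono[OF ab]]) simp
  then show "\<bar>(a z + b z) ^ r\<bar> \<le> 2 ^ d * growth_scale d z ^ 1" for z by (simp add: power_abs)
qed simp

lemma growth_power_w: "r \<le> d \<Longrightarrow> growth d 1 (\<lambda>(x, \<delta>, u, \<epsilon>). (x + \<delta>) ^ r)"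
  using growth_power_add[of r d fst "\<lambda>z. fst (snd z)"]
  by (simp add: split_beta' growth_scale_def borel_prod[symmetric])

lemma growth_power_xi: "r \<le> d \<Longrightarrow> growth d 1 (\<lambda>(x, \<delta>, u, \<epsilon>). (x + u) ^ r)"
  using growth_power_add[of r d fst "\<lambda>z. fst (snd (snd z))"]
  by (simp add: split_beta' growth_scale_def borel_prod[symmetric])

lemma growth_power_x: "r \<le> d \<Longrightarrow> d \<ge> 1 \<Longrightarrow> growth d 1 (\<lambda>(x, \<delta>, u, \<epsilon>). x ^ r)"
  using growth_power_add[of r d fst "\<lambda>_. 0"]
  by (simp add: power_0_left split_beta' growth_scale_def borel_prod[symmetric])

lemma growth_eps: "growth d 1 (\<lambda>(x, \<delta>, u, \<epsilon>). \<epsilon>)"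
  unfolding growth_def
  by (intro conjI exI[of _ 1]) (simp_all add: split_beta' growth_scale_def borel_prod[symmetric])

lemma growth_power_w_2:
  assumes "r \<le> 2 * d"
  shows "growth d 2 (\<lambda>(x, \<delta>, u, \<epsilon>). (x + \<delta>) ^ r)"
proof -
  \<comment> \<open>An exponent up to 2 d splits into two exponents of at most d, each of level 1;
    truncated subtraction covers r < d.\<close>
  have "min r d \<le> d" "r - d \<le> d" "r = min r d + (r - d)" using assms by auto
  from growth_mult[OF growth_power_w[OF this(1)] growth_power_w[OF this(2)]]
  have "growth d 2 (\<lambda>z. (fst z + fst (snd z)) ^ (min r d + (r - d)))"
    by (simp add: split_beta' power_add numeral_2_eq_2)
  also have "min r d + (r - d) = r" by simp
  finally show ?thesis by (simp add: split_beta')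
qed

lemma growth_power_xi_2:
  assumes "r \<le> 2 * d"
  shows "growth d 2 (\<lambda>(x, \<delta>, u, \<epsilon>). (x + u) ^ r)"
proof -
  have "min r d \<le> d" "r - d \<le> d" "r = min r d + (r - d)" using assms by auto
  from growth_mult[OF growth_power_xi[OF this(1)] growth_power_xi[OF this(2)]]
  have "growth d 2 (\<lambda>z. (fst z + fst (snd (snd z))) ^ (min r d + (r - d)))"
    by (simp add: split_beta' power_add numeral_2_eq_2)
  also have "min r d + (r - d) = r" by simp
  finally show ?thesis by (simp add: split_beta')
qed

lemma growth_t_pol:
  assumes "\<And>i. i \<le> r \<Longrightarrow> growth d k (\<lambda>(x, \<delta>, u, \<epsilon>). (x + \<delta>) ^ i)"
  shows "growth d k (\<lambda>(x, \<delta>, u, \<epsilon>). t_pol md r (x + \<delta>))"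
  using assms
proof (induction r rule: less_induct)
  case (less r)
  have "growth d k (\<lambda>z. (fst z + fst (snd z)) ^ r - (\<Sum>i<r. real (r choose i) * md (r - i) * t_pol md i (fst z + fst (snd z))))"
    using less by (intro growth_diff growth_sum growth_cmult) (auto simp: split_beta')
  then show ?case by (simp add: split_beta' t_pol.simps[of md r])
qed

lemma power4_sum_le:
  fixes a b :: real
  shows "(a + b) ^ 4 \<le> 8 * (a ^ 4 + b ^ 4)"
proof -
  have sq: "(s + t)\<^sup>2 \<le> 2 * (s\<^sup>2 + t\<^sup>2)" for s t :: real
    using zero_le_power2[of "s - t"] by (simp add: power2_eq_square algebra_simps)
  have "(a + b) ^ 4 = ((a + b)\<^sup>2)\<^sup>2" by simp
  also have "\<dots> \<le> (2 * (a\<^sup>2 + b\<^sup>2))\<^sup>2" by (intro power_mono sq) simp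
  also have "\<dots> = 4 * (a\<^sup>2 + b\<^sup>2)\<^sup>2" by (simp only: power_mult_distrib) simp
  also have "\<dots> \<le> 8 * ((a\<^sup>2)\<^sup>2 + (b\<^sup>2)\<^sup>2)"
    using sq[of "a\<^sup>2" "b\<^sup>2"] by simp
  finally show ?thesis by simp
qed

text \<open>Four nested applications of \<open>power4_sum_le\<close> give the constant 8^4 =
  4096.\<close>

lemma growth_scale_pow4_le:
  "growth_scale d (x, \<delta>, u, \<epsilon>) ^ 4 \<le> 4096 * (1 + (x ^ (4 * d) + \<delta> ^ (4 * d) + u ^ (4 * d) + \<epsilon> ^ 4))"
proof -
  have e: "(\<bar>a\<bar> ^ d) ^ 4 = a ^ (4 * d)" for a :: real
    by (simp add: power_even_abs flip: power_mult) (simp add: mult.commute)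
  have nn: "0 \<le> a ^ (4 * d)" "0 \<le> a ^ 4" for a :: real by (simp_all add: zero_le_even_power)
  let ?a = "\<bar>x\<bar> ^ d" and ?b = "\<bar>\<delta>\<bar> ^ d" and ?c = "\<bar>u\<bar> ^ d" and ?e = "\<bar>\<epsilon>\<bar>"
  have "growth_scale d (x, \<delta>, u, \<epsilon>) = 1 + (?a + (?b + (?c + ?e)))" by (simp add: growth_scale_def)
  then show ?thesis
    using power4_sum_le[of 1 "?a + (?b + (?c + ?e))"] power4_sum_le[of ?a "?b + (?c + ?e)"]
      power4_sum_le[of ?b "?c + ?e"] power4_sum_le[of ?c ?e] nn(1)[of x] nn(1)[of \<delta>] nn(1)[of u] nn(2)[of \<epsilon>]
    by (simp add: e)
qed

subsection \<open>The measurement error model\<close>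

lemma measurable_update_coordinate:
  "(\<lambda>z. \<lambda>i\<in>{..<n}. if i = j then snd z i else fst z i) \<in>
    measurable (PiM ({..<n} - {j}) (\<lambda>_. borel) \<Otimes>\<^sub>M PiM {j} (\<lambda>_. borel)) (\<Pi>\<^sub>M i\<in>{..<n::nat}. borel :: real measure)"
proof (rule measurable_restrict)
  fix i assume i: "i \<in> {..<n}"
  show "(\<lambda>z. if i = j then snd z i else fst z i) \<in>
    borel_measurable (PiM ({..<n} - {j}) (\<lambda>_. borel) \<Otimes>\<^sub>M PiM {j} (\<lambda>_. borel :: real measure))"
    using i by (cases "i = j") (auto intro!: measurable_compose[OF measurable_snd]
        measurable_compose[OF measurable_fst] measurable_component_singleton)
qed

text \<open>One coordinate is resampled at \<omega>' while the others stay at \<omega>: the family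
  splits into that coordinate and the independent rest.\<close>

lemma (in prob_space) indep_vars_fubini_coordinate:
  fixes V :: "nat \<Rightarrow> 'a \<Rightarrow> real" and F :: "(nat \<Rightarrow> real) \<Rightarrow> real"
  assumes ind: "indep_vars (\<lambda>_. borel) V {..<n}" and j: "j < n"
    and F: "F \<in> borel_measurable (\<Pi>\<^sub>M i\<in>{..<n}. borel)"
    and int: "integrable M (\<lambda>\<omega>. F (\<lambda>i\<in>{..<n}. V i \<omega>))"
  shows "expectation (\<lambda>\<omega>. F (\<lambda>i\<in>{..<n}. V i \<omega>)) =
    expectation (\<lambda>\<omega>. expectation (\<lambda>\<omega>'. F (\<lambda>i\<in>{..<n}. V i (if i = j then \<omega>' else \<omega>))))"
proof -
  let ?A = "{..<n} - {j}" and ?B = "{j}"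
  define f where "f z = F (\<lambda>i\<in>{..<n}. if i = j then snd z i else fst z i)" for z :: "(nat \<Rightarrow> real) \<times> (nat \<Rightarrow> real)"
  have ind': "indep_var (PiM ?A (\<lambda>_. borel)) (\<lambda>\<omega>. \<lambda>i\<in>?A. V i \<omega>) (PiM ?B (\<lambda>_. borel)) (\<lambda>\<omega>. \<lambda>i\<in>?B. V i \<omega>)"
    by (rule indep_var_restrict[OF ind]) (use j in auto)
  have f: "f \<in> borel_measurable (PiM ?A (\<lambda>_. borel) \<Otimes>\<^sub>M PiM ?B (\<lambda>_. borel))"
    unfolding f_def[abs_def] by (rule measurable_compose[OF measurable_update_coordinate F])
  have eq: "f ((\<lambda>i\<in>?A. V i \<omega>), (\<lambda>i\<in>?B. V i \<omega>')) = F (\<lambda>i\<in>{..<n}. V i (if i = j then \<omega>' else \<omega>))" for \<omega> \<omega>'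
    unfolding f_def by (rule arg_cong[where f=F]) (auto simp: fun_eq_iff)
  have eq': "f ((\<lambda>i\<in>?A. V i \<omega>), (\<lambda>i\<in>?B. V i \<omega>)) = F (\<lambda>i\<in>{..<n}. V i \<omega>)" for \<omega>
    unfolding eq by simp
  show ?thesis
    using indep_var_fubini[OF ind' f] int unfolding eq eq' by simp
qed

lemma (in prob_space) indep_vars_AE_coordinate:
  fixes V :: "nat \<Rightarrow> 'a \<Rightarrow> real" and F :: "(nat \<Rightarrow> real) \<Rightarrow> real"
  assumes ind: "indep_vars (\<lambda>_. borel) V {..<n}" and j: "j < n"
    and F: "F \<in> borel_measurable (\<Pi>\<^sub>M i\<in>{..<n}. borel)"
    and ae: "AE \<omega> in M. F (\<lambda>i\<in>{..<n}. V i \<omega>) = 0"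
  shows "AE \<omega> in M. AE \<omega>' in M. F (\<lambda>i\<in>{..<n}. V i (if i = j then \<omega>' else \<omega>)) = 0"
proof -
  let ?A = "{..<n} - {j}" and ?B = "{j}"
  define f where "f z = F (\<lambda>i\<in>{..<n}. if i = j then snd z i else fst z i)" for z :: "(nat \<Rightarrow> real) \<times> (nat \<Rightarrow> real)"
  have ind': "indep_var (PiM ?A (\<lambda>_. borel)) (\<lambda>\<omega>. \<lambda>i\<in>?A. V i \<omega>) (PiM ?B (\<lambda>_. borel)) (\<lambda>\<omega>. \<lambda>i\<in>?B. V i \<omega>)"
    by (rule indep_var_restrict[OF ind]) (use j in auto)
  have f: "f \<in> borel_measurable (PiM ?A (\<lambda>_. borel) \<Otimes>\<^sub>M PiM ?B (\<lambda>_. borel))"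
    unfolding f_def[abs_def] by (rule measurable_compose[OF measurable_update_coordinate F])
  have eq: "f ((\<lambda>i\<in>?A. V i \<omega>), (\<lambda>i\<in>?B. V i \<omega>')) = F (\<lambda>i\<in>{..<n}. V i (if i = j then \<omega>' else \<omega>))" for \<omega> \<omega>'
    unfolding f_def by (rule arg_cong[where f=F]) (auto simp: fun_eq_iff)
  have eq': "f ((\<lambda>i\<in>?A. V i \<omega>), (\<lambda>i\<in>?B. V i \<omega>)) = F (\<lambda>i\<in>{..<n}. V i \<omega>)" for \<omega>
    unfolding eq by simp
  have "Measurable.pred (PiM ?A (\<lambda>_. borel) \<Otimes>\<^sub>M PiM ?B (\<lambda>_. borel)) (\<lambda>z. f z = 0)"
    using f by measurable
  from indep_var_AE[OF ind' this] ae show ?thesis unfolding eq eq' by simp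
qed

locale errors_in_variables = prob_space M for M :: "'a measure" +
  fixes d :: nat and x \<delta> u \<epsilon> :: "'a \<Rightarrow> real" and md mu :: "nat \<Rightarrow> real" and \<beta> :: "real vec"
  assumes d: "d \<ge> 1"
    and beta: "\<beta> \<in> carrier_vec (d + 1)"
    and indep: "indep_vars (\<lambda>_. borel) (\<lambda>j. [x, \<delta>, u, \<epsilon>] ! j) {..<4::nat}"
    and mean0: "expectation \<delta> = 0" "expectation u = 0" "expectation \<epsilon> = 0"
    and md: "\<And>k. md k = expectation (\<lambda>\<omega>. \<delta> \<omega> ^ k)"
    and mu: "\<And>k. mu k = expectation (\<lambda>\<omega>. u \<omega> ^ k)"
    and nonconc: "\<not> (\<exists>A. finite A \<and> card A \<le> d \<and> (AE \<omega> in M. x \<omega> \<in> A))"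
    and mom4: "integrable M (\<lambda>\<omega>. x \<omega> ^ (4 * d) + \<delta> \<omega> ^ (4 * d) + u \<omega> ^ (4 * d) + \<epsilon> \<omega> ^ 4)"
begin

lemma measurable_errors [measurable]:
  "x \<in> borel_measurable M" "\<delta> \<in> borel_measurable M" "u \<in> borel_measurable M" "\<epsilon> \<in> borel_measurable M"
proof -
  have "[x, \<delta>, u, \<epsilon>] ! j \<in> borel_measurable M" if "j < 4" for j
    using indep that by (auto simp: indep_vars_def2)
  from this[of 0] this[of 1] this[of 2] this[of 3]
  show "x \<in> borel_measurable M" "\<delta> \<in> borel_measurable M" "u \<in> borel_measurable M" "\<epsilon> \<in> borel_measurable M"
    by (simp_all add: numeral_2_eq_2 numeral_3_eq_3)
qed

definition quad :: "'a \<Rightarrow> quadruple" where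
  "quad \<omega> = (x \<omega>, \<delta> \<omega>, u \<omega>, \<epsilon> \<omega>)"

lemma measurable_quad [measurable]: "quad \<in> borel_measurable M"
  unfolding quad_def[abs_def] by (simp add: borel_prod[symmetric])

lemma integrable_dominated:
  assumes "\<And>\<omega>. 0 \<le> f \<omega>" "\<And>\<omega>. f \<omega> \<le> x \<omega> ^ (4 * d) + \<delta> \<omega> ^ (4 * d) + u \<omega> ^ (4 * d) + \<epsilon> \<omega> ^ 4" "f \<in> borel_measurable M"
  shows "integrable M f"
  by (rule Bochner_Integration.integrable_bound[OF mom4])
    (use assms in \<open>auto intro!: AE_I2 order_trans[OF _ abs_ge_self]\<close>)

lemma integrable_powers:
  "k \<le> 4 * d \<Longrightarrow> integrable M (\<lambda>\<omega>. x \<omega> ^ k)" "k \<le> 4 * d \<Longrightarrow> integrable M (\<lambda>\<omega>. \<delta> \<omega> ^ k)"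
  "k \<le> 4 * d \<Longrightarrow> integrable M (\<lambda>\<omega>. u \<omega> ^ k)" "k \<le> 4 \<Longrightarrow> integrable M (\<lambda>\<omega>. \<epsilon> \<omega> ^ k)"
proof -
  have nn: "0 \<le> a ^ (4 * d)" "0 \<le> a ^ 4" for a :: real by (simp_all add: zero_le_even_power)
  have 1: "integrable M (\<lambda>\<omega>. x \<omega> ^ (4 * d))" "integrable M (\<lambda>\<omega>. \<delta> \<omega> ^ (4 * d))"
    "integrable M (\<lambda>\<omega>. u \<omega> ^ (4 * d))" "integrable M (\<lambda>\<omega>. \<epsilon> \<omega> ^ 4)"
    by (rule integrable_dominated; simp add: nn add_increasing add_increasing2)+
  have "even (4 * d)" "even (4::nat)" by auto
  then show "k \<le> 4 * d \<Longrightarrow> integrable M (\<lambda>\<omega>. x \<omega> ^ k)" "k \<le> 4 * d \<Longrightarrow> integrable M (\<lambda>\<omega>. \<delta> \<omega> ^ k)"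
    "k \<le> 4 * d \<Longrightarrow> integrable M (\<lambda>\<omega>. u \<omega> ^ k)" "k \<le> 4 \<Longrightarrow> integrable M (\<lambda>\<omega>. \<epsilon> \<omega> ^ k)"
    using 1 measurable_errors by (blast intro: integrable_powers_le)+
qed

lemma integrable_growth:
  assumes "growth d k f" "k \<le> 4"
  shows "integrable M (\<lambda>\<omega>. f (quad \<omega>))"
proof -
  have "growth d 4 f" by (rule growth_mono[OF assms])
  then obtain C where C: "C \<ge> 0" "\<And>z. \<bar>f z\<bar> \<le> C * growth_scale d z ^ 4" and [measurable]: "f \<in> borel_measurable borel"
    by (auto simp: growth_def)
  show ?thesis
  proof (rule Bochner_Integration.integrable_bound)
    show "integrable M (\<lambda>\<omega>. C * (4096 * (1 + (x \<omega> ^ (4 * d) + \<delta> \<omega> ^ (4 * d) + u \<omega> ^ (4 * d) + \<epsilon> \<omega> ^ 4))))"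
      by (intro integrable_mult_right Bochner_Integration.integrable_add mom4) simp
    show "(\<lambda>\<omega>. f (quad \<omega>)) \<in> borel_measurable M" by measurable
    have "\<bar>f (quad \<omega>)\<bar> \<le> C * (4096 * (1 + (x \<omega> ^ (4 * d) + \<delta> \<omega> ^ (4 * d) + u \<omega> ^ (4 * d) + \<epsilon> \<omega> ^ 4)))" for \<omega>
      using C(2)[of "quad \<omega>"] mult_left_mono[OF growth_scale_pow4_le C(1)]
      unfolding quad_def by (rule order_trans)
    then show "AE \<omega> in M. norm (f (quad \<omega>)) \<le> norm (C * (4096 * (1 + (x \<omega> ^ (4 * d) + \<delta> \<omega> ^ (4 * d) + u \<omega> ^ (4 * d) + \<epsilon> \<omega> ^ 4))))"
      by (auto intro!: AE_I2 order_trans[OF _ abs_ge_self])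
  qed
qed

lemma square_integrable_growth:
  assumes "growth d 2 f"
  shows "integrable M (\<lambda>\<omega>. (f (quad \<omega>))\<^sup>2)"
  using integrable_growth[OF growth_mult[OF assms assms]] by (simp add: power2_eq_square)

text \<open>Translates between quadruples and functions on \<open>{..<4}\<close>, the form in which
  independence of the four variables is stated.\<close>

lemma quad_coordinates:
  assumes f: "f \<in> borel_measurable borel"
  shows "(\<lambda>v. f (v 0, v 1, v 2, v 3)) \<in> borel_measurable (\<Pi>\<^sub>M i\<in>{..<4::nat}. borel :: real measure)"
    "f ((\<lambda>i\<in>{..<4::nat}. ([x, \<delta>, u, \<epsilon>] ! i) \<omega>) 0, (\<lambda>i\<in>{..<4}. ([x, \<delta>, u, \<epsilon>] ! i) \<omega>) 1,
       (\<lambda>i\<in>{..<4}. ([x, \<delta>, u, \<epsilon>] ! i) \<omega>) 2, (\<lambda>i\<in>{..<4}. ([x, \<delta>, u, \<epsilon>] ! i) \<omega>) 3) = f (quad \<omega>)"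
proof -
  have "(\<lambda>v. v i) \<in> borel_measurable (\<Pi>\<^sub>M i\<in>{..<4::nat}. borel :: real measure)" if "i < 4" for i
    using that by (intro measurable_component_singleton) simp
  then have "(\<lambda>v. (v 0, v 1, v 2, v 3)) \<in> borel_measurable (\<Pi>\<^sub>M i\<in>{..<4::nat}. borel :: real measure)"
    by (intro borel_measurable_Pair) auto
  from measurable_compose[OF this f]
  show "(\<lambda>v. f (v 0, v 1, v 2, v 3)) \<in> borel_measurable (\<Pi>\<^sub>M i\<in>{..<4::nat}. borel :: real measure)" .
qed (simp add: quad_def numeral_2_eq_2 numeral_3_eq_3)

text \<open>Plays the role of conditioning on the three other variables; the cases integrate out
  \<delta>, u and \<epsilon>.\<close>

lemma fubini:
  fixes f :: "quadruple \<Rightarrow> real"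
  assumes f: "f \<in> borel_measurable borel" and int: "integrable M (\<lambda>\<omega>. f (quad \<omega>))"
  shows "expectation (\<lambda>\<omega>. f (quad \<omega>)) = expectation (\<lambda>\<omega>. expectation (\<lambda>\<omega>'. f (x \<omega>, \<delta> \<omega>', u \<omega>, \<epsilon> \<omega>)))"
    "expectation (\<lambda>\<omega>. f (quad \<omega>)) = expectation (\<lambda>\<omega>. expectation (\<lambda>\<omega>'. f (x \<omega>, \<delta> \<omega>, u \<omega>', \<epsilon> \<omega>)))"
    "expectation (\<lambda>\<omega>. f (quad \<omega>)) = expectation (\<lambda>\<omega>. expectation (\<lambda>\<omega>'. f (x \<omega>, \<delta> \<omega>, u \<omega>, \<epsilon> \<omega>')))"
proof -
  let ?F = "\<lambda>v::nat \<Rightarrow> real. f (v 0, v 1, v 2, v 3)"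
  have int': "integrable M (\<lambda>\<omega>. ?F (\<lambda>i\<in>{..<4}. ([x, \<delta>, u, \<epsilon>] ! i) \<omega>))"
    unfolding quad_coordinates(2)[OF f] by (rule int)
  note fub = indep_vars_fubini_coordinate[where F="?F" and V="\<lambda>i. [x, \<delta>, u, \<epsilon>] ! i" and n=4, OF indep _ quad_coordinates(1)[OF f] int', unfolded quad_coordinates(2)[OF f]]
  show "expectation (\<lambda>\<omega>. f (quad \<omega>)) = expectation (\<lambda>\<omega>. expectation (\<lambda>\<omega>'. f (x \<omega>, \<delta> \<omega>', u \<omega>, \<epsilon> \<omega>)))"
    using fub[of 1] by (simp add: numeral_2_eq_2 numeral_3_eq_3)
  show "expectation (\<lambda>\<omega>. f (quad \<omega>)) = expectation (\<lambda>\<omega>. expectation (\<lambda>\<omega>'. f (x \<omega>, \<delta> \<omega>, u \<omega>', \<epsilon> \<omega>)))"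
    using fub[of 2] by (simp add: numeral_2_eq_2 numeral_3_eq_3)
  show "expectation (\<lambda>\<omega>. f (quad \<omega>)) = expectation (\<lambda>\<omega>. expectation (\<lambda>\<omega>'. f (x \<omega>, \<delta> \<omega>, u \<omega>, \<epsilon> \<omega>')))"
    using fub[of 3] by (simp add: numeral_2_eq_2 numeral_3_eq_3)
qed

lemma AE_coordinate:
  fixes f :: "quadruple \<Rightarrow> real"
  assumes f: "f \<in> borel_measurable borel" and ae: "AE \<omega> in M. f (quad \<omega>) = (0::real)"
  shows "AE \<omega> in M. AE \<omega>' in M. f (x \<omega>, \<delta> \<omega>', u \<omega>, \<epsilon> \<omega>) = 0"
    "AE \<omega> in M. AE \<omega>' in M. f (x \<omega>, \<delta> \<omega>, u \<omega>, \<epsilon> \<omega>') = 0"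
proof -
  let ?F = "\<lambda>v::nat \<Rightarrow> real. f (v 0, v 1, v 2, v 3)"
  have ae': "AE \<omega> in M. ?F (\<lambda>i\<in>{..<4}. ([x, \<delta>, u, \<epsilon>] ! i) \<omega>) = 0"
    unfolding quad_coordinates(2)[OF f] by (rule ae)
  note fub = indep_vars_AE_coordinate[where F="?F" and V="\<lambda>i. [x, \<delta>, u, \<epsilon>] ! i" and n=4, OF indep _ quad_coordinates(1)[OF f] ae', unfolded quad_coordinates(2)[OF f]]
  show "AE \<omega> in M. AE \<omega>' in M. f (x \<omega>, \<delta> \<omega>', u \<omega>, \<epsilon> \<omega>) = 0"
    using fub[of 1] by (simp add: numeral_2_eq_2 numeral_3_eq_3)
  show "AE \<omega> in M. AE \<omega>' in M. f (x \<omega>, \<delta> \<omega>, u \<omega>, \<epsilon> \<omega>') = 0"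
    using fub[of 3] by (simp add: numeral_2_eq_2 numeral_3_eq_3)
qed

end

section \<open>Averages and observed variables\<close>

lemma avg_diff: "avg n (\<lambda>i. a i - b i) = avg n a - avg n b"
  by (simp add: avg_def sum_subtractf diff_divide_distrib)

lemma avg_cmult: "avg n (\<lambda>i. c * a i) = c * avg n a"
  by (simp add: avg_def sum_distrib_left)

lemma avg_sum: "avg n (\<lambda>i. \<Sum>j\<in>J. a j i) = (\<Sum>j\<in>J. avg n (a j))"
  by (simp add: avg_def sum_divide_distrib sum.swap[of _ J])

lemma avg_const: "n \<ge> 1 \<Longrightarrow> avg n (\<lambda>_. c) = c"
  by (simp add: avg_def)

text \<open>Observables are functions of a quadruple rather than random variables, so they apply to
  the generic quadruple and to every copy in the sample alike.\<close>

definition obs_w :: "quadruple \<Rightarrow> real" where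
  "obs_w = (\<lambda>(x, \<delta>, u, \<epsilon>). x + \<delta>)"

definition obs_y :: "nat \<Rightarrow> real vec \<Rightarrow> quadruple \<Rightarrow> real" where
  "obs_y d \<beta> = (\<lambda>(x, \<delta>, u, \<epsilon>). (\<Sum>j\<le>d. \<beta> $ j * (x + u) ^ j) + \<epsilon>)"

lemma growth_t_pol_obs_w:
  "r \<le> d \<Longrightarrow> growth d 1 (\<lambda>z. t_pol md r (obs_w z))"
  "r \<le> 2 * d \<Longrightarrow> growth d 2 (\<lambda>z. t_pol md r (obs_w z))"
  using growth_t_pol[of r d 1 md, OF growth_power_w] growth_t_pol[of r d 2 md, OF growth_power_w_2]
  by (auto simp: obs_w_def split_beta')

lemma growth_g_pol_obs_w:
  "r \<le> 2 * d \<Longrightarrow> growth d 2 (\<lambda>z. g_pol md mu r (obs_w z))"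
  unfolding g_pol_def by (intro growth_sum growth_cmult growth_t_pol_obs_w(2)) simp

lemma growth_regression:
  "growth d 1 (\<lambda>(x, \<delta>, u, \<epsilon>). \<Sum>j\<le>d. \<beta> $ j * (x + u) ^ j)"
proof -
  have "growth d 1 (\<lambda>z. \<Sum>j\<le>d. \<beta> $ j * (\<lambda>(x, \<delta>, u, \<epsilon>). (x + u) ^ j) z)"
    by (intro growth_sum growth_cmult growth_power_xi) simp
  then show ?thesis by (simp add: split_beta')
qed

lemma growth_obs_y: "growth d 1 (obs_y d \<beta>)"
  using growth_add[OF growth_regression[of d \<beta>] growth_eps] by (simp add: obs_y_def split_beta')

section \<open>Moment identities of the model\<close>

context errors_in_variables
begin

text \<open>The expectation of T(w), by unbiasedness of \<open>t_pol\<close>;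
  \<open>xi_moment_mat\<close> is likewise that of G(w).\<close>

definition moment_mat :: "real mat" where
  "moment_mat = mat (d + 1) (d + 1) (\<lambda>(i, j). expectation (\<lambda>\<omega>. x \<omega> ^ (i + j)))"

definition xi_moment_mat :: "real mat" where
  "xi_moment_mat = mat (d + 1) (d + 1) (\<lambda>(i, j). expectation (\<lambda>\<omega>. (x \<omega> + u \<omega>) ^ (i + j)))"

text \<open>Coefficients of the conditional mean of y given x as a polynomial in x: they result from
  averaging the regression polynomial at x + u over u.\<close>

definition beta_x :: "real vec" where
  "beta_x = transpose_mat (U_mat mu d) *\<^sub>v \<beta>"

lemma mu_0: "mu 0 = 1"
  by (simp add: mu prob_space)

lemma beta_x_carrier: "beta_x \<in> carrier_vec (d + 1)"
  using U_mat_carrier[of mu d] beta by (auto simp: beta_x_def)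

lemma beta_x_index:
  assumes "l \<le> d"
  shows "beta_x $ l = (\<Sum>k\<le>d. \<beta> $ k * (real (k choose l) * mu (k - l)))"
proof -
  have "beta_x $ l = (\<Sum>k<d + 1. (real (k choose l) * mu (k - l)) * \<beta> $ k)"
    using assms U_mat_carrier[of mu d] beta unfolding beta_x_def U_mat_def
    by (simp add: scalar_prod_def atLeast0LessThan)
  then show ?thesis by (simp add: lessThan_Suc_atMost mult.commute)
qed

lemma expectation_t_pol:
  assumes "r \<le> 2 * d"
  shows "expectation (\<lambda>\<omega>. t_pol md r (obs_w (quad \<omega>))) = expectation (\<lambda>\<omega>. x \<omega> ^ r)"
proof -
  have "growth d 2 (\<lambda>z. t_pol md r (obs_w z))" by (rule growth_t_pol_obs_w(2)[OF assms])
  from fubini(1)[OF growth_measurable[OF this] integrable_growth[OF this]]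
  have "expectation (\<lambda>\<omega>. t_pol md r (obs_w (quad \<omega>))) = expectation (\<lambda>\<omega>. expectation (\<lambda>\<omega>'. t_pol md r (x \<omega> + \<delta> \<omega>')))"
    by (simp add: obs_w_def)
  also have "\<dots> = expectation (\<lambda>\<omega>. x \<omega> ^ r)"
    using expectation_t_pol_shift[OF integrable_powers(2) md] assms by simp
  finally show ?thesis .
qed

lemma expectation_xi_power:
  assumes "r \<le> 2 * d"
  shows "expectation (\<lambda>\<omega>. (x \<omega> + u \<omega>) ^ r) = (\<Sum>i\<le>r. real (r choose i) * mu (r - i) * expectation (\<lambda>\<omega>. x \<omega> ^ i))"
proof -
  note g = growth_power_xi_2[OF assms]
  have "expectation (\<lambda>\<omega>. (x \<omega> + u \<omega>) ^ r) = expectation (\<lambda>\<omega>. expectation (\<lambda>\<omega>'. (x \<omega> + u \<omega>') ^ r))"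
    using fubini(2)[OF growth_measurable[OF g] integrable_growth[OF g]] by (simp add: quad_def)
  also have "\<dots> = expectation (\<lambda>\<omega>. \<Sum>i\<le>r. real (r choose i) * x \<omega> ^ i * mu (r - i))"
    using assms by (subst expectation_power_shift(2)) (auto intro: integrable_powers simp: mu)
  also have "\<dots> = (\<Sum>i\<le>r. expectation (\<lambda>\<omega>. real (r choose i) * x \<omega> ^ i * mu (r - i)))"
    by (intro Bochner_Integration.integral_sum integrable_mult_left integrable_mult_right integrable_powers) (use assms in auto)
  finally show ?thesis by (simp add: mult_ac)
qed

lemma expectation_g_pol:
  assumes "r \<le> 2 * d"
  shows "expectation (\<lambda>\<omega>. g_pol md mu r (obs_w (quad \<omega>))) = expectation (\<lambda>\<omega>. (x \<omega> + u \<omega>) ^ r)"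
proof -
  have "expectation (\<lambda>\<omega>. g_pol md mu r (obs_w (quad \<omega>))) =
      (\<Sum>j\<le>r. expectation (\<lambda>\<omega>. real (r choose j) * mu (r - j) * t_pol md j (obs_w (quad \<omega>))))"
    unfolding g_pol_def
    by (intro Bochner_Integration.integral_sum integrable_mult_right
        integrable_growth[OF growth_t_pol_obs_w(2)]) (use assms in auto)
  also have "\<dots> = expectation (\<lambda>\<omega>. (x \<omega> + u \<omega>) ^ r)"
    using assms by (simp add: expectation_xi_power expectation_t_pol)
  finally show ?thesis .
qed

text \<open>Integrating \<delta> replaces t_j(w) by x^j, integrating \<epsilon> removes the noise,
  and integrating u leaves the polynomial with coefficients \<open>beta_x\<close>. The result is the
  population form of the normal equations.\<close>

lemma expectation_y_t_pol:
  assumes "j \<le> d"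
  shows "expectation (\<lambda>\<omega>. obs_y d \<beta> (quad \<omega>) * t_pol md j (obs_w (quad \<omega>))) =
    (\<Sum>l\<le>d. beta_x $ l * expectation (\<lambda>\<omega>. x \<omega> ^ (j + l)))"
proof -
  let ?f = "\<lambda>s. \<Sum>k\<le>d. \<beta> $ k * s ^ k"
  have g1: "growth d (1 + 1) (\<lambda>z. obs_y d \<beta> z * t_pol md j (obs_w z))"
    by (intro growth_mult growth_obs_y growth_t_pol_obs_w(1) assms)
  have g2: "growth d (1 + 1) (\<lambda>z. obs_y d \<beta> z * (\<lambda>(x, \<delta>, u, \<epsilon>). x ^ j) z)"
    by (intro growth_mult growth_obs_y growth_power_x assms d)
  have g3: "growth d (1 + 1) (\<lambda>z. (\<lambda>(x, \<delta>, u, \<epsilon>). ?f (x + u)) z * (\<lambda>(x, \<delta>, u, \<epsilon>). x ^ j) z)"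
    by (intro growth_mult growth_regression growth_power_x assms d)
  have "expectation (\<lambda>\<omega>. obs_y d \<beta> (quad \<omega>) * t_pol md j (obs_w (quad \<omega>))) =
      expectation (\<lambda>\<omega>. expectation (\<lambda>\<omega>'. obs_y d \<beta> (quad \<omega>) * t_pol md j (x \<omega> + \<delta> \<omega>')))"
    using fubini(1)[OF growth_measurable[OF g1] integrable_growth[OF g1]] by (simp add: obs_w_def obs_y_def quad_def)
  also have "\<dots> = expectation (\<lambda>\<omega>. obs_y d \<beta> (quad \<omega>) * x \<omega> ^ j)"
    using expectation_t_pol_shift[OF integrable_powers(2) md, of j] assms by simp
  also have "\<dots> = expectation (\<lambda>\<omega>. expectation (\<lambda>\<omega>'. (?f (x \<omega> + u \<omega>) + \<epsilon> \<omega>') * x \<omega> ^ j))"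
    using fubini(3)[OF growth_measurable[OF g2] integrable_growth[OF g2]] by (simp add: obs_y_def quad_def)
  also have "\<dots> = expectation (\<lambda>\<omega>. ?f (x \<omega> + u \<omega>) * x \<omega> ^ j)"
    using integrable_powers(4)[of 1] mean0 by (simp add: prob_space)
  also have "\<dots> = expectation (\<lambda>\<omega>. expectation (\<lambda>\<omega>'. ?f (x \<omega> + u \<omega>') * x \<omega> ^ j))"
    using fubini(2)[OF growth_measurable[OF g3] integrable_growth[OF g3]] by (simp add: quad_def)
  also have "\<dots> = expectation (\<lambda>\<omega>. \<Sum>l\<le>d. beta_x $ l * x \<omega> ^ (j + l))"
  proof (intro Bochner_Integration.integral_cong refl)
    fix \<omega>
    have sh: "integrable M (\<lambda>\<omega>'. (x \<omega> + u \<omega>') ^ k)"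
      "expectation (\<lambda>\<omega>'. (x \<omega> + u \<omega>') ^ k) = (\<Sum>l\<le>k. real (k choose l) * x \<omega> ^ l * mu (k - l))" if "k \<le> d" for k
      unfolding mu by (rule expectation_power_shift, rule integrable_powers, use that in simp)+
    have "expectation (\<lambda>\<omega>'. ?f (x \<omega> + u \<omega>')) = (\<Sum>k\<le>d. \<beta> $ k * expectation (\<lambda>\<omega>'. (x \<omega> + u \<omega>') ^ k))"
      by (subst Bochner_Integration.integral_sum) (auto intro!: integrable_mult_right sh)
    also have "\<dots> = (\<Sum>k\<le>d. \<Sum>l\<le>d. \<beta> $ k * (real (k choose l) * x \<omega> ^ l * mu (k - l)))"
    proof (intro sum.cong refl)
      fix k assume "k \<in> {..d}"
      then have k: "k \<le> d" by simp
      \<comment> \<open>The binomial coefficient vanishes for l > k, so all inner sums can share the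
        range up to d.\<close>
      have "(\<Sum>l\<le>k. real (k choose l) * x \<omega> ^ l * mu (k - l)) = (\<Sum>l\<le>d. real (k choose l) * x \<omega> ^ l * mu (k - l))"
        by (rule sum.mono_neutral_left) (use k in auto)
      then show "\<beta> $ k * expectation (\<lambda>\<omega>'. (x \<omega> + u \<omega>') ^ k) = (\<Sum>l\<le>d. \<beta> $ k * (real (k choose l) * x \<omega> ^ l * mu (k - l)))"
        unfolding sh(2)[OF k] by (simp add: sum_distrib_left)
    qed
    also have "\<dots> = (\<Sum>l\<le>d. \<Sum>k\<le>d. \<beta> $ k * (real (k choose l) * x \<omega> ^ l * mu (k - l)))" by (rule sum.swap)
    also have "\<dots> = (\<Sum>l\<le>d. beta_x $ l * x \<omega> ^ l)"
      by (intro sum.cong refl) (simp add: beta_x_index sum_distrib_left mult_ac)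
    finally have E: "expectation (\<lambda>\<omega>'. ?f (x \<omega> + u \<omega>')) = (\<Sum>l\<le>d. beta_x $ l * x \<omega> ^ l)" .
    have "expectation (\<lambda>\<omega>'. ?f (x \<omega> + u \<omega>') * x \<omega> ^ j) = expectation (\<lambda>\<omega>'. ?f (x \<omega> + u \<omega>')) * x \<omega> ^ j"
      by (rule Bochner_Integration.integral_mult_left_zero)
    also have "\<dots> = (\<Sum>l\<le>d. beta_x $ l * x \<omega> ^ (j + l))"
      unfolding E sum_distrib_right by (intro sum.cong refl) (simp add: power_add mult_ac)
    finally show "expectation (\<lambda>\<omega>'. ?f (x \<omega> + u \<omega>') * x \<omega> ^ j) = (\<Sum>l\<le>d. beta_x $ l * x \<omega> ^ (j + l))" .
  qed
  also have "\<dots> = (\<Sum>l\<le>d. beta_x $ l * expectation (\<lambda>\<omega>. x \<omega> ^ (j + l)))"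
    by (subst Bochner_Integration.integral_sum) (use assms in \<open>auto intro!: integrable_mult_right integrable_powers\<close>)
  finally show ?thesis .
qed

lemma expectation_y_square:
  "expectation (\<lambda>\<omega>. (obs_y d \<beta> (quad \<omega>))\<^sup>2) =
    (\<Sum>i\<le>d. \<Sum>j\<le>d. \<beta> $ i * \<beta> $ j * expectation (\<lambda>\<omega>. (x \<omega> + u \<omega>) ^ (i + j))) + variance \<epsilon>"
proof -
  let ?f = "\<lambda>s. \<Sum>k\<le>d. \<beta> $ k * s ^ k"
  have g1: "growth d (1 + 1) (\<lambda>z. obs_y d \<beta> z * obs_y d \<beta> z)"
    by (intro growth_mult growth_obs_y)
  have g2: "growth d (1 + 1) (\<lambda>z. (\<lambda>(x, \<delta>, u, \<epsilon>). ?f (x + u)) z * (\<lambda>(x, \<delta>, u, \<epsilon>). ?f (x + u)) z)"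
    by (intro growth_mult growth_regression)
  have i2: "integrable M (\<lambda>\<omega>. (?f (x \<omega> + u \<omega>))\<^sup>2)"
    using integrable_growth[OF g2] by (simp add: quad_def power2_eq_square)
  have v: "variance \<epsilon> = expectation (\<lambda>\<omega>. \<epsilon> \<omega> ^ 2)" using mean0 by simp
  have e: "integrable M \<epsilon>" "integrable M (\<lambda>\<omega>. \<epsilon> \<omega> ^ 2)"
    using integrable_powers(4)[of 1] integrable_powers(4)[of 2] by simp_all
  have "expectation (\<lambda>\<omega>. (obs_y d \<beta> (quad \<omega>))\<^sup>2) =
      expectation (\<lambda>\<omega>. expectation (\<lambda>\<omega>'. (?f (x \<omega> + u \<omega>) + \<epsilon> \<omega>')\<^sup>2))"
    using fubini(3)[OF growth_measurable[OF g1] integrable_growth[OF g1]] by (simp add: obs_y_def quad_def power2_eq_square)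
  also have "\<dots> = expectation (\<lambda>\<omega>. (?f (x \<omega> + u \<omega>))\<^sup>2 + variance \<epsilon>)"
    unfolding v using e mean0 by (simp add: power2_sum prob_space mult.assoc)
  also have "\<dots> = expectation (\<lambda>\<omega>. (?f (x \<omega> + u \<omega>))\<^sup>2) + variance \<epsilon>"
    using i2 by (simp add: prob_space)
  also have "expectation (\<lambda>\<omega>. (?f (x \<omega> + u \<omega>))\<^sup>2) =
      expectation (\<lambda>\<omega>. \<Sum>i\<le>d. \<Sum>j\<le>d. \<beta> $ i * \<beta> $ j * (x \<omega> + u \<omega>) ^ (i + j))"
    by (simp add: power2_eq_square sum_product power_add mult_ac)
  also have "\<dots> = (\<Sum>i\<le>d. \<Sum>j\<le>d. \<beta> $ i * \<beta> $ j * expectation (\<lambda>\<omega>. (x \<omega> + u \<omega>) ^ (i + j)))"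
  proof -
    have int: "integrable M (\<lambda>\<omega>. \<beta> $ i * \<beta> $ j * (x \<omega> + u \<omega>) ^ (i + j))" if "i \<le> d" "j \<le> d" for i j
      using integrable_growth[OF growth_power_xi_2[of "i + j" d]] that
      by (intro integrable_mult_right) (simp add: quad_def)
    have "expectation (\<lambda>\<omega>. \<Sum>i\<le>d. \<Sum>j\<le>d. \<beta> $ i * \<beta> $ j * (x \<omega> + u \<omega>) ^ (i + j)) =
        (\<Sum>i\<le>d. expectation (\<lambda>\<omega>. \<Sum>j\<le>d. \<beta> $ i * \<beta> $ j * (x \<omega> + u \<omega>) ^ (i + j)))"
      by (intro Bochner_Integration.integral_sum Bochner_Integration.integrable_sum int) auto
    also have "\<dots> = (\<Sum>i\<le>d. \<Sum>j\<le>d. expectation (\<lambda>\<omega>. \<beta> $ i * \<beta> $ j * (x \<omega> + u \<omega>) ^ (i + j)))"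
      by (intro sum.cong refl Bochner_Integration.integral_sum int) auto
    finally show ?thesis by simp
  qed
  finally show ?thesis .
qed

text \<open>A nonzero polynomial of degree at most d would confine x to at most d points, against
  assumption (iv).\<close>

lemma polynomial_AE_zero:
  assumes "AE \<omega> in M. (\<Sum>j\<le>d. a j * x \<omega> ^ j) = 0" "j \<le> d"
  shows "a j = 0"
proof -
  define p where "p = (\<Sum>j\<le>d. Polynomial.monom (a j) j)"
  have p: "poly p s = (\<Sum>j\<le>d. a j * s ^ j)" for s
    by (simp add: p_def poly_sum poly_monom)
  have deg: "Polynomial.degree p \<le> d"
    unfolding p_def by (intro degree_sum_le) (auto intro: order_trans[OF degree_monom_le])
  have "p = 0"
  proof (rule ccontr)
    assume nz: "p \<noteq> 0"
    have "AE \<omega> in M. x \<omega> \<in> {s. poly p s = 0}" using assms(1) by (simp add: p)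
    moreover have "card {s. poly p s = 0} \<le> d" using card_poly_roots_bound[OF nz] deg by linarith
    ultimately show False using nonconc poly_roots_finite[OF nz] by blast
  qed
  then have "Polynomial.coeff p j = 0" by simp
  then show ?thesis using assms(2) by (simp add: p_def Polynomial.coeff_sum)
qed

lemma moment_mat_carrier: "moment_mat \<in> carrier_mat (d + 1) (d + 1)"
  and xi_moment_mat_carrier: "xi_moment_mat \<in> carrier_mat (d + 1) (d + 1)"
  and xi_moment_mat_sym: "transpose_mat xi_moment_mat = xi_moment_mat"
  by (auto simp: moment_mat_def xi_moment_mat_def add.commute intro!: eq_matI)

text \<open>For a kernel vector v the quadratic form is the second moment of the polynomial in x
  with coefficients v, so this polynomial vanishes almost surely.\<close>

lemma det_moment_mat: "det moment_mat \<noteq> 0"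
proof
  assume "det moment_mat = 0"
  then obtain v where v: "v \<in> carrier_vec (d + 1)" "v \<noteq> 0\<^sub>v (d + 1)" "moment_mat *\<^sub>v v = 0\<^sub>v (d + 1)"
    using det_0_iff_vec_prod_zero[OF moment_mat_carrier] by blast
  let ?q = "\<lambda>\<omega>. \<Sum>j\<le>d. v $ j * x \<omega> ^ j"
  have int: "integrable M (\<lambda>\<omega>. v $ i * v $ j * x \<omega> ^ (i + j))" if "i \<le> d" "j \<le> d" for i j
    using that by (intro integrable_mult_right integrable_powers) simp
  have q: "(?q \<omega>)\<^sup>2 = (\<Sum>i\<le>d. \<Sum>j\<le>d. v $ i * v $ j * x \<omega> ^ (i + j))" for \<omega>
    by (simp add: power2_eq_square sum_product power_add mult_ac)
  have "expectation (\<lambda>\<omega>. (?q \<omega>)\<^sup>2) = (\<Sum>i\<le>d. expectation (\<lambda>\<omega>. \<Sum>j\<le>d. v $ i * v $ j * x \<omega> ^ (i + j)))"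
    unfolding q by (intro Bochner_Integration.integral_sum Bochner_Integration.integrable_sum int) auto
  also have "\<dots> = (\<Sum>i\<le>d. \<Sum>j\<le>d. expectation (\<lambda>\<omega>. v $ i * v $ j * x \<omega> ^ (i + j)))"
    by (intro sum.cong refl Bochner_Integration.integral_sum int) auto
  also have "\<dots> = (\<Sum>i<d+1. \<Sum>j<d+1. v $ i * v $ j * moment_mat $$ (i, j))"
    by (intro sum.cong) (auto simp: moment_mat_def)
  also have "\<dots> = v \<bullet> (moment_mat *\<^sub>v v)"
    by (rule quadratic_form_eq_sum[OF moment_mat_carrier v(1), symmetric])
  also have "\<dots> = 0" using v by simp
  finally have "expectation (\<lambda>\<omega>. (?q \<omega>)\<^sup>2) = 0" .
  moreover have "integrable M (\<lambda>\<omega>. (?q \<omega>)\<^sup>2)"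
    unfolding q by (intro Bochner_Integration.integrable_sum int) auto
  ultimately have "AE \<omega> in M. (?q \<omega>)\<^sup>2 = 0"
    by (subst (asm) integral_nonneg_eq_0_iff_AE) auto
  then have "AE \<omega> in M. ?q \<omega> = 0" by simp
  then have "v $ j = 0" if "j \<le> d" for j by (rule polynomial_AE_zero) (rule that)
  then have "v = 0\<^sub>v (d + 1)" using v(1) by (intro eq_vecI) auto
  with v(2) show False by simp
qed

end

text \<open>Cramer's rule where the determinant is nonzero; the fallback branch is measurable by
  assumption.\<close>

lemma borel_measurable_inv_mat:
  assumes A: "\<And>\<omega>. A \<omega> \<in> carrier_mat m m"
    and meas: "\<And>i j. i < m \<Longrightarrow> j < m \<Longrightarrow> (\<lambda>\<omega>. A \<omega> $$ (i, j) :: real) \<in> borel_measurable M"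
    and v: "\<And>\<omega>. v \<omega> \<in> carrier_vec m" "\<And>i. i < m \<Longrightarrow> (\<lambda>\<omega>. v \<omega> $ i) \<in> borel_measurable M"
    and W: "W \<in> carrier_mat m m" and j: "j < m"
    and c: "c \<in> borel_measurable M"
  shows "(\<lambda>\<omega>. if invertible_mat (A \<omega>) then (W *\<^sub>v (inv_mat (A \<omega>) *\<^sub>v v \<omega>)) $ j else c \<omega>) \<in> borel_measurable M"
proof -
  have det: "(\<lambda>\<omega>. det (A \<omega>)) \<in> borel_measurable M"
    by (rule borel_measurable_det[OF A meas])
  have eq: "(W *\<^sub>v (inv_mat (A \<omega>) *\<^sub>v v \<omega>)) $ j =
      (\<Sum>l<m. W $$ (j, l) * (\<Sum>k<m. adj_mat (A \<omega>) $$ (l, k) / det (A \<omega>) * v \<omega> $ k))" if "det (A \<omega>) \<noteq> 0" for \<omega>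
  proof -
    note I = inv_mat[OF A that]
    have "(inv_mat (A \<omega>) *\<^sub>v v \<omega>) $ l = (\<Sum>k<m. adj_mat (A \<omega>) $$ (l, k) / det (A \<omega>) * v \<omega> $ k)" if "l < m" for l
      using I(1) v(1)[of \<omega>] that inv_mat_eq_adj[OF A \<open>det (A \<omega>) \<noteq> 0\<close> that]
      by (simp add: scalar_prod_def atLeast0LessThan)
    then show ?thesis
      using W j I(1) v(1)[of \<omega>] by (simp add: scalar_prod_def atLeast0LessThan)
  qed
  have "(\<lambda>\<omega>. if det (A \<omega>) \<noteq> 0 then \<Sum>l<m. W $$ (j, l) * (\<Sum>k<m. adj_mat (A \<omega>) $$ (l, k) / det (A \<omega>) * v \<omega> $ k) else c \<omega>)
      \<in> borel_measurable M"
    using det c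
    by (intro measurable_If borel_measurable_sum borel_measurable_times borel_measurable_const borel_measurable_divide
        borel_measurable_adj[OF A meas] v(2)) auto
  moreover have "(\<lambda>\<omega>. if det (A \<omega>) \<noteq> 0 then \<Sum>l<m. W $$ (j, l) * (\<Sum>k<m. adj_mat (A \<omega>) $$ (l, k) / det (A \<omega>) * v \<omega> $ k) else c \<omega>) =
      (\<lambda>\<omega>. if invertible_mat (A \<omega>) then (W *\<^sub>v (inv_mat (A \<omega>) *\<^sub>v v \<omega>)) $ j else c \<omega>)"
    by (rule ext) (simp add: invertible_mat_iff_det[OF A] eq)
  ultimately show ?thesis by simp
qed

section \<open>Influence functions and the asymptotic covariance matrix\<close>

context errors_in_variables
begin

text \<open>Growth level 2 is built in, because a vanishing mean alone does not give the second
  moments that the central limit theorem needs.\<close>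

definition centered :: "(quadruple \<Rightarrow> real) \<Rightarrow> bool" where
  "centered f \<longleftrightarrow> growth d 2 f \<and> expectation (\<lambda>\<omega>. f (quad \<omega>)) = 0"

lemma centered_integrable: "centered f \<Longrightarrow> integrable M (\<lambda>\<omega>. f (quad \<omega>))"
  by (auto simp: centered_def intro: integrable_growth)

lemma centered_cmult: "centered f \<Longrightarrow> centered (\<lambda>z. c * f z)"
  by (simp add: centered_def growth_cmult)

lemma centered_diff: "centered f \<Longrightarrow> centered g \<Longrightarrow> centered (\<lambda>z. f z - g z)"
  using centered_integrable[of f] centered_integrable[of g] by (simp add: centered_def growth_diff)

lemma centered_sum:
  assumes "\<And>i. i \<in> I \<Longrightarrow> centered (f i)"
  shows "centered (\<lambda>z. \<Sum>i\<in>I. f i z)"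
  using assms centered_integrable
  by (auto simp: centered_def Bochner_Integration.integral_sum intro: growth_sum)

definition phi_T :: "nat \<Rightarrow> quadruple \<Rightarrow> real" where
  "phi_T r z = t_pol md r (obs_w z) - expectation (\<lambda>\<omega>. x \<omega> ^ r)"

definition phi_G :: "nat \<Rightarrow> quadruple \<Rightarrow> real" where
  "phi_G r z = g_pol md mu r (obs_w z) - expectation (\<lambda>\<omega>. (x \<omega> + u \<omega>) ^ r)"

text \<open>One summand of the residual h - T b of the linear system; it is centred by the normal
  equations.\<close>

definition phi_R :: "nat \<Rightarrow> quadruple \<Rightarrow> real" where
  "phi_R l z = obs_y d \<beta> z * t_pol md l (obs_w z) - (\<Sum>k\<le>d. beta_x $ k * t_pol md (l + k) (obs_w z))"

text \<open>Maps the averaged residual to the first-order error of the regression estimator.\<close>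

definition infl_mat :: "real mat" where
  "infl_mat = transpose_mat (inv_mat (U_mat mu d)) * inv_mat moment_mat"

definition phi_beta :: "nat \<Rightarrow> quadruple \<Rightarrow> real" where
  "phi_beta i z = (\<Sum>l\<le>d. infl_mat $$ (i, l) * phi_R l z)"

text \<open>The last sum is the effect of plugging in the estimate of \<beta>: 2
  \<open>xi_moment_mat *\<^sub>v \<beta>\<close> is the gradient of the limiting quadratic
  form.\<close>

definition phi_sigma :: "quadruple \<Rightarrow> real" where
  "phi_sigma z = (obs_y d \<beta> z)\<^sup>2 - variance \<epsilon> - (\<Sum>i\<le>d. \<Sum>j\<le>d. \<beta> $ i * \<beta> $ j * g_pol md mu (i + j) (obs_w z)) -
    2 * (\<Sum>i\<le>d. (xi_moment_mat *\<^sub>v \<beta>) $ i * phi_beta i z)"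

text \<open>The influence functions of the coordinates of the estimator, in the order of the statement.\<close>

definition psi :: "nat \<Rightarrow> quadruple \<Rightarrow> real" where
  "psi j = (if j < 2 * d then phi_T (j + 1) else if j < 3 * d + 1 then phi_beta (j - 2 * d) else phi_sigma)"

lemma centered_phi_T: "r \<le> 2 * d \<Longrightarrow> centered (phi_T r)"
  using integrable_growth[OF growth_t_pol_obs_w(2)[of r d md]] expectation_t_pol[of r]
  by (simp add: centered_def phi_T_def[abs_def] growth_diff growth_t_pol_obs_w(2) growth_const prob_space)

lemma centered_phi_G: "r \<le> 2 * d \<Longrightarrow> centered (phi_G r)"
  using integrable_growth[OF growth_g_pol_obs_w[of r d md mu]] expectation_g_pol[of r]
  by (simp add: centered_def phi_G_def[abs_def] growth_diff growth_g_pol_obs_w growth_const prob_space)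

lemma centered_phi_R:
  assumes "l \<le> d"
  shows "centered (phi_R l)"
proof -
  have g1: "growth d (1 + 1) (\<lambda>z. obs_y d \<beta> z * t_pol md l (obs_w z))"
    by (intro growth_mult growth_obs_y growth_t_pol_obs_w(1) assms)
  have g2: "growth d 2 (\<lambda>z. t_pol md (l + k) (obs_w z))" if "k \<le> d" for k
    using assms that by (intro growth_t_pol_obs_w(2)) simp
  have int: "integrable M (\<lambda>\<omega>. beta_x $ k * t_pol md (l + k) (obs_w (quad \<omega>)))" if "k \<le> d" for k
    by (intro integrable_mult_right integrable_growth[OF g2] that) simp
  have "expectation (\<lambda>\<omega>. \<Sum>k\<le>d. beta_x $ k * t_pol md (l + k) (obs_w (quad \<omega>))) =
      (\<Sum>k\<le>d. expectation (\<lambda>\<omega>. beta_x $ k * t_pol md (l + k) (obs_w (quad \<omega>))))"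
    by (intro Bochner_Integration.integral_sum int) simp
  also have "\<dots> = (\<Sum>k\<le>d. beta_x $ k * expectation (\<lambda>\<omega>. x \<omega> ^ (l + k)))"
    using assms by (intro sum.cong refl) (simp add: expectation_t_pol)
  finally have "expectation (\<lambda>\<omega>. phi_R l (quad \<omega>)) = 0"
    unfolding phi_R_def using expectation_y_t_pol[OF assms] integrable_growth[OF g1] int
    by (subst Bochner_Integration.integral_diff) (auto intro!: Bochner_Integration.integrable_sum)
  moreover have "growth d 2 (phi_R l)"
    unfolding phi_R_def[abs_def] using g1 by (intro growth_diff growth_sum growth_cmult g2) (auto simp: numeral_2_eq_2)
  ultimately show ?thesis by (simp add: centered_def)
qed

lemma centered_phi_beta: "centered (phi_beta i)"
  unfolding phi_beta_def[abs_def] by (intro centered_sum centered_cmult centered_phi_R) simp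

text \<open>By \<open>expectation_y_square\<close> the mean of y^2 is the error variance plus the
  quadratic form in the moments of x + u, so the constants regroup into centred pieces.\<close>

lemma centered_phi_sigma: "centered phi_sigma"
proof -
  define G where "G z = (\<Sum>i\<le>d. \<Sum>j\<le>d. \<beta> $ i * \<beta> $ j * phi_G (i + j) z)" for z
  have cG: "centered G"
    unfolding G_def[abs_def] by (intro centered_sum centered_cmult centered_phi_G) simp
  define c where "c = expectation (\<lambda>\<omega>. (obs_y d \<beta> (quad \<omega>))\<^sup>2)"
  have g: "growth d 2 (\<lambda>z. (obs_y d \<beta> z)\<^sup>2)"
    using growth_mult[OF growth_obs_y growth_obs_y, of d \<beta> \<beta>] by (simp add: power2_eq_square numeral_2_eq_2)
  have cy: "centered (\<lambda>z. (obs_y d \<beta> z)\<^sup>2 - c)"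
    using g integrable_growth[OF g] by (simp add: centered_def growth_diff growth_const c_def prob_space)
  have "phi_sigma z = (obs_y d \<beta> z)\<^sup>2 - c - G z - 2 * (\<Sum>i\<le>d. (xi_moment_mat *\<^sub>v \<beta>) $ i * phi_beta i z)" for z
    unfolding phi_sigma_def G_def phi_G_def c_def expectation_y_square
    by (simp add: right_diff_distrib sum_subtractf)
  then have eq: "phi_sigma = (\<lambda>z. (obs_y d \<beta> z)\<^sup>2 - c - G z - 2 * (\<Sum>i\<le>d. (xi_moment_mat *\<^sub>v \<beta>) $ i * phi_beta i z))"
    by (rule ext)
  show ?thesis
    unfolding eq by (intro centered_diff cy cG centered_cmult centered_sum centered_phi_beta)
qed

lemma centered_psi: "centered (psi j)"
  by (auto simp: psi_def centered_phi_beta centered_phi_sigma intro: centered_phi_T)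

definition asym_cov :: "real mat" where
  "asym_cov = mat (3 * d + 2) (3 * d + 2) (\<lambda>(i, j). expectation (\<lambda>\<omega>. psi i (quad \<omega>) * psi j (quad \<omega>)))"

lemma asym_cov_carrier: "asym_cov \<in> carrier_mat (3 * d + 2) (3 * d + 2)"
  by (simp add: asym_cov_def)

text \<open>Semidefiniteness, the limiting variance in direction \<open>a\<close> and nonsingularity
  are all read off this second moment.\<close>

lemma quadratic_form_asym_cov:
  assumes a: "a \<in> carrier_vec (3 * d + 2)"
  shows "a \<bullet> (asym_cov *\<^sub>v a) = expectation (\<lambda>\<omega>. (\<Sum>j<3 * d + 2. a $ j * psi j (quad \<omega>))\<^sup>2)"
proof -
  let ?k = "3 * d + 2"
  have g: "growth d 2 (psi j)" for j using centered_psi[of j] by (simp add: centered_def)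
  have int: "integrable M (\<lambda>\<omega>. a $ i * a $ j * (psi i (quad \<omega>) * psi j (quad \<omega>)))" for i j
    using integrable_growth[OF growth_mult[OF g[of i] g[of j]]] by (intro integrable_mult_right) simp
  have "(\<Sum>j<?k. a $ j * psi j (quad \<omega>))\<^sup>2 = (\<Sum>i<?k. \<Sum>j<?k. a $ i * a $ j * (psi i (quad \<omega>) * psi j (quad \<omega>)))" for \<omega>
    unfolding power2_eq_square sum_product by (intro sum.cong refl) simp
  then have "expectation (\<lambda>\<omega>. (\<Sum>j<?k. a $ j * psi j (quad \<omega>))\<^sup>2) =
      expectation (\<lambda>\<omega>. \<Sum>i<?k. \<Sum>j<?k. a $ i * a $ j * (psi i (quad \<omega>) * psi j (quad \<omega>)))"
    by simp
  also have "\<dots> = (\<Sum>i<?k. expectation (\<lambda>\<omega>. \<Sum>j<?k. a $ i * a $ j * (psi i (quad \<omega>) * psi j (quad \<omega>))))"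
    by (intro Bochner_Integration.integral_sum Bochner_Integration.integrable_sum int)
  also have "\<dots> = (\<Sum>i<?k. \<Sum>j<?k. expectation (\<lambda>\<omega>. a $ i * a $ j * (psi i (quad \<omega>) * psi j (quad \<omega>))))"
    by (intro sum.cong refl Bochner_Integration.integral_sum int)
  also have "\<dots> = (\<Sum>i<?k. \<Sum>j<?k. a $ i * a $ j * asym_cov $$ (i, j))"
    by (intro sum.cong refl) (simp add: asym_cov_def)
  finally show ?thesis using quadratic_form_eq_sum[OF asym_cov_carrier a] by simp
qed

lemma covariance_mat_asym_cov: "covariance_mat (3 * d + 2) asym_cov"
  unfolding covariance_mat_def
proof (intro conjI ballI asym_cov_carrier)
  show "transpose_mat asym_cov = asym_cov"
    by (rule eq_matI) (auto simp: asym_cov_def mult.commute)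
  show "0 \<le> a \<bullet> (asym_cov *\<^sub>v a)" if "a \<in> carrier_vec (3 * d + 2)" for a
    unfolding quadratic_form_asym_cov[OF that] by simp
qed

lemma inverse_carriers:
  "transpose_mat (inv_mat (U_mat mu d)) \<in> carrier_mat (d + 1) (d + 1)"
  "inv_mat moment_mat \<in> carrier_mat (d + 1) (d + 1)" "infl_mat \<in> carrier_mat (d + 1) (d + 1)"
  using U_mat_transpose_inverse(1)[of mu d] mu_0 inv_mat(1)[OF moment_mat_carrier det_moment_mat]
  by (auto simp: infl_mat_def)

text \<open>Exact identities without remainder. They require n >= 1, as only then is the average of
  a constant that constant.\<close>

lemma avg_matrices:
  fixes z :: "nat \<Rightarrow> quadruple" and n :: nat
  assumes n: "n \<ge> 1"
  defines "Tb \<equiv> avg_mat (d + 1) n (\<lambda>i. T_mat md d (obs_w (z i)))"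
    and "Gb \<equiv> avg_mat (d + 1) n (\<lambda>i. G_mat md mu d (obs_w (z i)))"
    and "r \<equiv> avg_vec (d + 1) n (\<lambda>i. h_vec md d (obs_w (z i)) (obs_y d \<beta> (z i))) -
      avg_mat (d + 1) n (\<lambda>i. T_mat md d (obs_w (z i))) *\<^sub>v beta_x"
  defines "l \<equiv> transpose_mat (inv_mat (U_mat mu d)) *\<^sub>v (inv_mat moment_mat *\<^sub>v r)"
  shows "\<And>i j. i \<le> d \<Longrightarrow> j \<le> d \<Longrightarrow> (Tb - moment_mat) $$ (i, j) = avg n (\<lambda>k. phi_T (i + j) (z k))"
    and "\<And>i j. i \<le> d \<Longrightarrow> j \<le> d \<Longrightarrow> (Gb - xi_moment_mat) $$ (i, j) = avg n (\<lambda>k. phi_G (i + j) (z k))"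
    and "\<And>i. i \<le> d \<Longrightarrow> r $ i = avg n (\<lambda>k. phi_R i (z k))"
    and "\<And>i. i \<le> d \<Longrightarrow> l $ i = avg n (\<lambda>k. phi_beta i (z k))"
    and "avg n (\<lambda>i. (obs_y d \<beta> (z i))\<^sup>2) - \<beta> \<bullet> (Gb *\<^sub>v \<beta>) - 2 * (\<beta> \<bullet> (xi_moment_mat *\<^sub>v l)) - variance \<epsilon> =
      avg n (\<lambda>k. phi_sigma (z k))"
proof -
  show "(Tb - moment_mat) $$ (i, j) = avg n (\<lambda>k. phi_T (i + j) (z k))" if "i \<le> d" "j \<le> d" for i j
    using that n by (simp add: Tb_def avg_mat_def T_mat_def moment_mat_def phi_T_def avg_diff avg_const)
  show "(Gb - xi_moment_mat) $$ (i, j) = avg n (\<lambda>k. phi_G (i + j) (z k))" if "i \<le> d" "j \<le> d" for i j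
    using that n by (simp add: Gb_def avg_mat_def G_mat_def xi_moment_mat_def phi_G_def avg_diff avg_const)
  show r: "r $ i = avg n (\<lambda>k. phi_R i (z k))" if "i \<le> d" for i
  proof -
    have "r $ i = avg n (\<lambda>k. obs_y d \<beta> (z k) * t_pol md i (obs_w (z k))) -
        (\<Sum>k<d + 1. avg n (\<lambda>m. t_pol md (i + k) (obs_w (z m))) * beta_x $ k)"
      using that beta_x_carrier
      by (simp add: r_def avg_vec_def h_vec_def avg_mat_def T_mat_def scalar_prod_def atLeast0LessThan)
    also have "(\<Sum>k<d + 1. avg n (\<lambda>m. t_pol md (i + k) (obs_w (z m))) * beta_x $ k) =
        (\<Sum>k\<le>d. beta_x $ k * avg n (\<lambda>m. t_pol md (i + k) (obs_w (z m))))"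
      by (simp add: lessThan_Suc_atMost mult.commute)
    finally show ?thesis by (simp add: phi_R_def avg_diff avg_sum avg_cmult)
  qed
  have rc: "r \<in> carrier_vec (d + 1)"
    unfolding r_def using beta_x_carrier
    by (intro minus_carrier_vec mult_mat_vec_carrier) (simp_all add: avg_vec_def avg_mat_def)
  have "l = infl_mat *\<^sub>v r"
    unfolding l_def infl_mat_def using inverse_carriers rc by simp
  then show l: "l $ i = avg n (\<lambda>k. phi_beta i (z k))" if "i \<le> d" for i
  proof -
    have "l $ i = (\<Sum>k<d + 1. infl_mat $$ (i, k) * r $ k)"
      using \<open>l = infl_mat *\<^sub>v r\<close> that inverse_carriers(3) rc by (simp add: scalar_prod_def atLeast0LessThan)
    also have "\<dots> = (\<Sum>k\<le>d. infl_mat $$ (i, k) * avg n (\<lambda>m. phi_R k (z m)))"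
      by (intro sum.cong) (auto simp: r)
    finally show ?thesis by (simp add: phi_beta_def avg_sum avg_cmult)
  qed
  have lc: "l \<in> carrier_vec (d + 1)" using \<open>l = infl_mat *\<^sub>v r\<close> inverse_carriers(3) by (auto intro!: carrier_vecI)
  have "\<beta> \<bullet> (Gb *\<^sub>v \<beta>) = (\<Sum>i<d + 1. \<Sum>j<d + 1. \<beta> $ i * \<beta> $ j * Gb $$ (i, j))"
    using beta by (intro quadratic_form_eq_sum) (auto simp: Gb_def avg_mat_def)
  also have "\<dots> = (\<Sum>i\<le>d. \<Sum>j\<le>d. \<beta> $ i * \<beta> $ j * avg n (\<lambda>k. g_pol md mu (i + j) (obs_w (z k))))"
    by (intro sum.cong) (auto simp: Gb_def avg_mat_def G_mat_def)
  finally have G: "\<beta> \<bullet> (Gb *\<^sub>v \<beta>) = avg n (\<lambda>k. \<Sum>i\<le>d. \<Sum>j\<le>d. \<beta> $ i * \<beta> $ j * g_pol md mu (i + j) (obs_w (z k)))"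
    by (simp add: avg_sum avg_cmult)
  have "\<beta> \<bullet> (xi_moment_mat *\<^sub>v l) = l \<bullet> (xi_moment_mat *\<^sub>v \<beta>)"
    by (rule symmetric_scalar_prod[OF xi_moment_mat_carrier xi_moment_mat_sym beta lc])
  also have "\<dots> = (\<Sum>i<d + 1. l $ i * (xi_moment_mat *\<^sub>v \<beta>) $ i)"
    using xi_moment_mat_carrier by (simp add: scalar_prod_def[of l] atLeast0LessThan)
  also have "\<dots> = (\<Sum>i\<le>d. (xi_moment_mat *\<^sub>v \<beta>) $ i * avg n (\<lambda>k. phi_beta i (z k)))"
    by (intro sum.cong) (auto simp: l)
  finally have B: "\<beta> \<bullet> (xi_moment_mat *\<^sub>v l) = avg n (\<lambda>k. \<Sum>i\<le>d. (xi_moment_mat *\<^sub>v \<beta>) $ i * phi_beta i (z k))"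
    by (simp add: avg_sum avg_cmult)
  show "avg n (\<lambda>i. (obs_y d \<beta> (z i))\<^sup>2) - \<beta> \<bullet> (Gb *\<^sub>v \<beta>) - 2 * (\<beta> \<bullet> (xi_moment_mat *\<^sub>v l)) - variance \<epsilon> =
      avg n (\<lambda>k. phi_sigma (z k))"
    unfolding G B phi_sigma_def avg_diff avg_cmult avg_const[OF n] by simp
qed

end

subsection \<open>Asymptotic normality of the estimators\<close>

text \<open>Carries \<open>cramer_wold\<close>, which speaks of the full function space, over to
  test functions on the k-dimensional product.\<close>

lemma converges_in_distributionI:
  assumes M: "prob_space M" and N: "multivariate_normal k (0\<^sub>v k) S N"
    and car: "\<And>n \<omega>. X n \<omega> \<in> carrier_vec k"
    and meas: "\<And>n j. j < k \<Longrightarrow> (\<lambda>\<omega>. X n \<omega> $ j) \<in> borel_measurable M"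
    and chr: "\<And>t. (\<lambda>n. \<integral>\<omega>. iexp (\<Sum>j<k. t j * X n \<omega> $ j) \<partial>M) \<longlonglongrightarrow> of_real (exp (- (vec k t \<bullet> (S *\<^sub>v vec k t)) / 2))"
  shows "converges_in_distribution M k X N"
  unfolding converges_in_distribution_def
proof (intro conjI allI impI)
  show "X n \<omega> \<in> carrier_vec k" for n \<omega> by (rule car)
  show "(\<lambda>\<omega>. coords k (X n \<omega>)) \<in> measurable M (\<Pi>\<^sub>M i\<in>{..<k}. borel)" for n
    unfolding coords_def by (intro measurable_restrict meas) simp
next
  fix f assume f: "continuous_map (product_topology (\<lambda>_. euclideanreal) {..<k}) euclideanreal f"
    and bdd: "bounded (f ` (\<Pi>\<^sub>E i\<in>{..<k}. UNIV))"
  \<comment> \<open>Points of the product are \<open>undefined\<close> outside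
    \<open>{..<k}\<close>; composing with restriction extends f continuously to the full function
    space.\<close>
  define g where "g z = f (restrict z {..<k})" for z :: "nat \<Rightarrow> real"
  have "continuous_map (product_topology (\<lambda>_. euclideanreal) UNIV) (product_topology (\<lambda>_. euclideanreal) {..<k}) (\<lambda>z. restrict z {..<k})"
    by (auto simp: continuous_map_componentwise intro: continuous_map_product_projection)
  from continuous_map_compose[OF this f] have "continuous_map euclidean euclideanreal g"
    by (simp add: euclidean_product_topology g_def[abs_def] o_def)
  then have g: "continuous_on UNIV g" by simp
  then have gm: "g \<in> borel_measurable borel" by (rule borel_measurable_continuous_onI)
  obtain B where "\<And>y. y \<in> f ` (\<Pi>\<^sub>E i\<in>{..<k}. UNIV) \<Longrightarrow> norm y \<le> B"
    using bdd by (auto simp: bounded_iff)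
  then have B: "\<bar>g z\<bar> \<le> B" for z
    unfolding g_def by (metis imageI real_norm_def restrict_PiE_iff UNIV_I)
  have dep: "g z = g z'" if "\<And>j. j < k \<Longrightarrow> z j = z' j" for z z'
    unfolding g_def using that by (metis lessThan_iff restrict_ext)
  \<comment> \<open>Coordinates from k on are uncontrolled, so measurability is obtained after
    padding with zeros, which does not change g.\<close>
  have gmeas: "(\<lambda>\<omega>. g (Y \<omega>)) \<in> borel_measurable L" if Y: "\<And>j. j < k \<Longrightarrow> (\<lambda>\<omega>. Y \<omega> j) \<in> borel_measurable L"
    for Y and L :: "'b measure"
  proof -
    have "(\<lambda>\<omega> j. if j < k then Y \<omega> j else 0) \<in> borel_measurable L"
    proof (rule measurable_coordinatewise_then_product)
      show "(\<lambda>\<omega>. if j < k then Y \<omega> j else 0) \<in> borel_measurable L" for j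
        by (cases "j < k") (simp_all add: Y)
    qed
    from measurable_compose[OF this gm]
    have "(\<lambda>\<omega>. g (\<lambda>j. if j < k then Y \<omega> j else 0)) \<in> borel_measurable L" .
    moreover have "g (\<lambda>j. if j < k then Y \<omega> j else 0) = g (Y \<omega>)" for \<omega> by (rule dep) simp
    ultimately show ?thesis by simp
  qed
  have chr': "(\<lambda>n. \<integral>\<omega>. iexp (\<Sum>j<k. t j * X n \<omega> $ j) \<partial>M) \<longlonglongrightarrow> (\<integral>z. iexp (\<Sum>j<k. t j * z j) \<partial>N)" for t
    unfolding iexp_multivariate_normal[OF N] by (rule chr)
  have comp: "\<And>j. j < k \<Longrightarrow> (\<lambda>z. z j) \<in> borel_measurable N"
    by (rule multivariate_normal_component_measurable[OF N])
  have "(\<lambda>n. \<integral>\<omega>. g (\<lambda>j. X n \<omega> $ j) \<partial>M) \<longlonglongrightarrow> (\<integral>z. g z \<partial>N)"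
  proof (rule cramer_wold[OF M prob_space_multivariate_normal[OF N] _ comp chr' g B dep])
    show "(\<lambda>\<omega>. X n \<omega> $ j) \<in> borel_measurable M" if "j < k" for n j by (rule meas[OF that])
    show "(\<lambda>\<omega>. g (\<lambda>j. X n \<omega> $ j)) \<in> borel_measurable M" for n by (rule gmeas) (rule meas)
    show "g \<in> borel_measurable N" using gmeas[of "\<lambda>z. z" N] comp by simp
  qed
  moreover have "g (\<lambda>j. X n \<omega> $ j) = f (coords k (X n \<omega>))" for n \<omega>
    by (simp add: g_def coords_def)
  \<comment> \<open>The points of the space of \<open>N\<close> are already restricted, so g and f
    agree there.\<close>
  moreover have "(\<integral>z. g z \<partial>N) = (\<integral>z. f z \<partial>N)"
  proof (intro Bochner_Integration.integral_cong refl)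
    fix z assume "z \<in> space N"
    moreover have "space N = space (\<Pi>\<^sub>M i\<in>{..<k}. (borel :: real measure))"
      using N by (intro sets_eq_imp_space_eq) (simp add: multivariate_normal_def)
    ultimately have "z \<in> extensional {..<k}" by (simp add: space_PiM PiE_def)
    then show "g z = f z" by (simp add: g_def extensional_restrict)
  qed
  ultimately show "(\<lambda>n. \<integral>\<omega>. f (coords k (X n \<omega>)) \<partial>M) \<longlonglongrightarrow> (\<integral>z. f z \<partial>N)" by simp
qed

section \<open>The i.i.d. sample and the estimation error\<close>

locale errors_in_variables_sample = errors_in_variables +
  fixes z :: "nat \<Rightarrow> 'a \<Rightarrow> quadruple" and b0 :: "nat \<Rightarrow> 'a \<Rightarrow> real vec"
  assumes copies_indep: "indep_vars (\<lambda>_. borel) z {1..}"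
    and copies_distr: "\<And>i. i \<ge> 1 \<Longrightarrow> distr M borel (z i) = distr M borel quad"
    and b0: "\<And>n \<omega>. b0 n \<omega> \<in> carrier_vec (d + 1)" "\<And>n j. j \<le> d \<Longrightarrow> (\<lambda>\<omega>. b0 n \<omega> $ j) \<in> borel_measurable M"
begin

lemma measurable_z: "i \<ge> 1 \<Longrightarrow> z i \<in> borel_measurable M"
  using copies_indep by (auto simp: indep_vars_def2)

text \<open>Makes the one-dimensional limit theory available for every centred function of an
  observation; moments transfer from the generic quadruple through the common law.\<close>

lemma iid_centered_copies:
  assumes "centered f"
  shows "iid_centered M (\<lambda>i \<omega>. f (z i \<omega>)) (expectation (\<lambda>\<omega>. (f (quad \<omega>))\<^sup>2))"
proof -
  have f: "growth d 2 f" and f0: "expectation (\<lambda>\<omega>. f (quad \<omega>)) = 0"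
    using assms by (auto simp: centered_def)
  have [measurable]: "f \<in> borel_measurable borel" by (rule growth_measurable[OF f])
  have z1: "z 1 \<in> borel_measurable M" by (rule measurable_z) simp
  have D: "distr M borel (\<lambda>\<omega>. f (z i \<omega>)) = distr (distr M borel quad) borel f" if "i \<ge> 1" for i
    using distr_distr[of f borel borel "z i" M] measurable_z[OF that] copies_distr[OF that] by (simp add: o_def)
  have tr: "integrable M (\<lambda>\<omega>. h (z 1 \<omega>)) = integrable M (\<lambda>\<omega>. h (quad \<omega>))"
    "expectation (\<lambda>\<omega>. h (z 1 \<omega>)) = expectation (\<lambda>\<omega>. h (quad \<omega>))"
    if h: "h \<in> borel_measurable borel" for h :: "_ \<Rightarrow> real"
    using integrable_distr_eq[OF z1 h] integrable_distr_eq[OF measurable_quad h]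
      integral_distr[OF z1 h] integral_distr[OF measurable_quad h] copies_distr[of 1] by auto
  show ?thesis
  proof
    show "indep_vars (\<lambda>_. borel) (\<lambda>i \<omega>. f (z i \<omega>)) {1..}"
      by (rule indep_vars_compose2[OF copies_indep]) simp
    show "distr M borel (\<lambda>\<omega>. f (z i \<omega>)) = distr M borel (\<lambda>\<omega>. f (z 1 \<omega>))" if "i \<ge> 1" for i
      using D[OF that] D[of 1] by simp
    show "integrable M (\<lambda>\<omega>. (f (z 1 \<omega>))\<^sup>2)"
      using tr(1)[of "\<lambda>z. (f z)\<^sup>2"] square_integrable_growth[OF f] by simp
    show "expectation (\<lambda>\<omega>. f (z 1 \<omega>)) = 0" using tr(2)[of f] f0 by simp
    show "expectation (\<lambda>\<omega>. (f (z 1 \<omega>))\<^sup>2) = expectation (\<lambda>\<omega>. (f (quad \<omega>))\<^sup>2)"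
      using tr(2)[of "\<lambda>z. (f z)\<^sup>2"] by simp
  qed
qed

text \<open>The functions whose averages are the deviations in the deterministic expansion. Indexing
  by the functions themselves lets one sum range over three families.\<close>

definition deviation_set :: "(quadruple \<Rightarrow> real) set" where
  "deviation_set = phi_T ` {..2 * d} \<union> phi_G ` {..2 * d} \<union> phi_R ` {..d}"

text \<open>The sum majorizes every single deviation, so it can serve as the common bound e, and its
  second moment is easily estimated.\<close>

definition deviation :: "nat \<Rightarrow> 'a \<Rightarrow> real" where
  "deviation n \<omega> = (\<Sum>f\<in>deviation_set. \<bar>avg n (\<lambda>i. f (z i \<omega>))\<bar>)"

definition beta_est :: "nat \<Rightarrow> 'a \<Rightarrow> real vec" where
  "beta_est n \<omega> = beta_hat md mu d (b0 n \<omega>) n (\<lambda>i. obs_w (z i \<omega>)) (\<lambda>i. obs_y d \<beta> (z i \<omega>))"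

definition sigma2_est :: "nat \<Rightarrow> 'a \<Rightarrow> real" where
  "sigma2_est n \<omega> = sigma2_hat md mu d (b0 n \<omega>) n (\<lambda>i. obs_w (z i \<omega>)) (\<lambda>i. obs_y d \<beta> (z i \<omega>))"

definition est_error :: "nat \<Rightarrow> 'a \<Rightarrow> real vec" where
  "est_error n \<omega> = sqrt (real n) \<cdot>\<^sub>v
    ((mx_hat md d n (\<lambda>i. obs_w (z i \<omega>)) - vec (2 * d) (\<lambda>k. expectation (\<lambda>\<omega>'. x \<omega>' ^ (k + 1))))
     @\<^sub>v (beta_est n \<omega> - \<beta>)
     @\<^sub>v vec 1 (\<lambda>_. sigma2_est n \<omega> - variance \<epsilon>))"

lemma beta_est_carrier: "beta_est n \<omega> \<in> carrier_vec (d + 1)"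
  unfolding beta_est_def beta_hat_def Let_def using b0(1)[of n \<omega>] inverse_carriers(1)
  by (auto intro!: carrier_vecI dest: carrier_vecD)

lemma est_error_carrier: "est_error n \<omega> \<in> carrier_vec (3 * d + 2)"
  using carrier_vecD[OF beta] by (intro carrier_vecI) (simp add: est_error_def)

lemma est_error_index:
  assumes "j < 3 * d + 2"
  shows "est_error n \<omega> $ j = sqrt n *
    (if j < 2 * d then avg n (\<lambda>i. t_pol md (j + 1) (obs_w (z i \<omega>))) - expectation (\<lambda>\<omega>'. x \<omega>' ^ (j + 1))
     else if j < 3 * d + 1 then
       (beta_est n \<omega> - \<beta>) $ (j - 2 * d)
     else sigma2_est n \<omega> - variance \<epsilon>)"
proof -
  note dims = carrier_vecD[OF beta] carrier_vecD[OF beta_est_carrier[of n \<omega>]]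
  consider "j < 2 * d" | "\<not> j < 2 * d" "j - 2 * d < d + 1" "j < 3 * d + 1" | "\<not> j < 2 * d" "j = 3 * d + 1"
    using assms by linarith
  then show ?thesis
  proof cases
    case 1
    then show ?thesis using dims by (simp add: est_error_def mx_hat_def)
  next
    case 2
    then show ?thesis using dims by (simp add: est_error_def mx_hat_def)
  next
    case 3
    then show ?thesis using dims by (simp add: est_error_def mx_hat_def)
  qed
qed

lemma finite_deviation_set: "finite deviation_set"
  by (simp add: deviation_set_def)

lemma centered_deviation_set: "f \<in> deviation_set \<Longrightarrow> centered f"
  unfolding deviation_set_def
  by (elim UnE imageE) (simp_all add: centered_phi_T centered_phi_G centered_phi_R)

lemma abs_avg_le_deviation:
  "f \<in> deviation_set \<Longrightarrow> \<bar>avg n (\<lambda>i. f (z i \<omega>))\<bar> \<le> deviation n \<omega>"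
  unfolding deviation_def by (rule member_le_sum) (auto simp: finite_deviation_set)

text \<open>The deterministic expansion, with the deviation in the role of e. The moment block is
  exactly linear and contributes no remainder.\<close>

lemma est_error_linearization:
  "\<exists>C \<eta>. C \<ge> 0 \<and> \<eta> > 0 \<and> (\<forall>n\<ge>1. \<forall>\<omega>. deviation n \<omega> \<le> \<eta> \<longrightarrow>
    (\<forall>j<3 * d + 2. \<bar>est_error n \<omega> $ j - sqrt n * avg n (\<lambda>i. psi j (z i \<omega>))\<bar> \<le> C * sqrt n * (deviation n \<omega>)\<^sup>2))"
proof -
  obtain C \<eta> where C: "C \<ge> 0" and \<eta>: "\<eta> > 0" and exp: "\<And>n w y b0 e.
    (let Tb = avg_mat (d + 1) n (\<lambda>i. T_mat md d (w i));
         Gb = avg_mat (d + 1) n (\<lambda>i. G_mat md mu d (w i));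
         r = avg_vec (d + 1) n (\<lambda>i. h_vec md d (w i) (y i)) - Tb *\<^sub>v (transpose_mat (U_mat mu d) *\<^sub>v \<beta>);
         l = transpose_mat (inv_mat (U_mat mu d)) *\<^sub>v (inv_mat moment_mat *\<^sub>v r);
         b = beta_hat md mu d b0 n w y
     in (\<forall>i\<le>d. \<forall>j\<le>d. \<bar>(Tb - moment_mat) $$ (i, j)\<bar> \<le> e) \<longrightarrow> (\<forall>i\<le>d. \<forall>j\<le>d. \<bar>(Gb - xi_moment_mat) $$ (i, j)\<bar> \<le> e) \<longrightarrow>
        (\<forall>i\<le>d. \<bar>r $ i\<bar> \<le> e) \<longrightarrow> e \<le> \<eta> \<longrightarrow>
        vec_l1 (b - \<beta> - l) \<le> C * e\<^sup>2 \<and>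
        \<bar>sigma2_hat md mu d b0 n w y - (avg n (\<lambda>i. (y i)\<^sup>2) - \<beta> \<bullet> (Gb *\<^sub>v \<beta>) - 2 * (\<beta> \<bullet> (xi_moment_mat *\<^sub>v l)))\<bar> \<le> C * e\<^sup>2)"
    using estimator_expansion[where mu=mu and md=md, OF moment_mat_carrier det_moment_mat xi_moment_mat_carrier beta mu_0] by blast
  have "\<bar>est_error n \<omega> $ j - sqrt n * avg n (\<lambda>i. psi j (z i \<omega>))\<bar> \<le> C * sqrt n * (deviation n \<omega>)\<^sup>2"
    if n: "n \<ge> 1" and dev: "deviation n \<omega> \<le> \<eta>" and j: "j < 3 * d + 2" for n \<omega> j
  proof -
    define Tb where "Tb = avg_mat (d + 1) n (\<lambda>i. T_mat md d (obs_w (z i \<omega>)))"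
    define Gb where "Gb = avg_mat (d + 1) n (\<lambda>i. G_mat md mu d (obs_w (z i \<omega>)))"
    define r where "r = avg_vec (d + 1) n (\<lambda>i. h_vec md d (obs_w (z i \<omega>)) (obs_y d \<beta> (z i \<omega>))) - Tb *\<^sub>v beta_x"
    define l where "l = transpose_mat (inv_mat (U_mat mu d)) *\<^sub>v (inv_mat moment_mat *\<^sub>v r)"
    define b where "b = beta_est n \<omega>"
    define s where "s = sigma2_est n \<omega>"
    note A = avg_matrices[OF n, where z="\<lambda>i. z i \<omega>", folded Tb_def Gb_def, folded r_def, folded l_def]
    have e1: "\<forall>i\<le>d. \<forall>j\<le>d. \<bar>(Tb - moment_mat) $$ (i, j)\<bar> \<le> deviation n \<omega>"
      using A(1) by (auto intro!: abs_avg_le_deviation simp: deviation_set_def)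
    have e2: "\<forall>i\<le>d. \<forall>j\<le>d. \<bar>(Gb - xi_moment_mat) $$ (i, j)\<bar> \<le> deviation n \<omega>"
      using A(2) by (auto intro!: abs_avg_le_deviation simp: deviation_set_def)
    have e3: "\<forall>i\<le>d. \<bar>r $ i\<bar> \<le> deviation n \<omega>"
      using A(3) by (auto intro!: abs_avg_le_deviation simp: deviation_set_def)
    have main: "vec_l1 (b - \<beta> - l) \<le> C * (deviation n \<omega>)\<^sup>2"
      "\<bar>s - (avg n (\<lambda>i. (obs_y d \<beta> (z i \<omega>))\<^sup>2) - \<beta> \<bullet> (Gb *\<^sub>v \<beta>) - 2 * (\<beta> \<bullet> (xi_moment_mat *\<^sub>v l)))\<bar> \<le> C * (deviation n \<omega>)\<^sup>2"
      using exp[of n "\<lambda>i. obs_w (z i \<omega>)" "\<lambda>i. obs_y d \<beta> (z i \<omega>)" "b0 n \<omega>" "deviation n \<omega>"] e1 e2 e3 dev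
      unfolding Let_def Tb_def[symmetric] Gb_def[symmetric] beta_x_def[symmetric] r_def[symmetric] l_def[symmetric]
        beta_est_def[symmetric] sigma2_est_def[symmetric] b_def[symmetric] s_def[symmetric] by blast+
    consider "j < 2 * d" | "2 * d \<le> j" "j < 3 * d + 1" | "j = 3 * d + 1" using j by linarith
    then have "\<exists>D. est_error n \<omega> $ j = sqrt n * D \<and> \<bar>D - avg n (\<lambda>i. psi j (z i \<omega>))\<bar> \<le> C * (deviation n \<omega>)\<^sup>2"
    proof cases
      case 1
      then show ?thesis
        using C n j unfolding est_error_index[OF j]
        by (intro exI conjI, simp, simp add: psi_def phi_T_def avg_diff avg_const)
    next
      case 2
      define i where "i = j - 2 * d"
      have i: "i \<le> d" using 2 by (simp add: i_def)
      have bc: "b \<in> carrier_vec (d + 1)" unfolding b_def by (rule beta_est_carrier)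
      have lc: "dim_vec l = d + 1" using inverse_carriers(1) by (simp add: l_def)
      have "(b - \<beta> - l) $ i = (b - \<beta>) $ i - avg n (\<lambda>k. psi j (z k \<omega>))"
        using i bc lc beta A(4)[OF i] 2 by (simp add: psi_def i_def)
      moreover have "\<bar>(b - \<beta> - l) $ i\<bar> \<le> vec_l1 (b - \<beta> - l)"
        using i bc lc beta by (intro abs_index_le_vec_l1) simp
      ultimately show ?thesis
        using main(1) 2 unfolding est_error_index[OF j] b_def[symmetric] i_def[symmetric]
        by (intro exI[of _ "(b - \<beta>) $ i"]) simp
    next
      case 3
      then show ?thesis
        using main(2) A(5) unfolding est_error_index[OF j] s_def[symmetric]
        by (intro exI[of _ "s - variance \<epsilon>"]) (simp add: psi_def abs_le_iff)
    qed
    then obtain D where D: "est_error n \<omega> $ j = sqrt n * D" "\<bar>D - avg n (\<lambda>i. psi j (z i \<omega>))\<bar> \<le> C * (deviation n \<omega>)\<^sup>2"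
      by blast
    have "\<bar>est_error n \<omega> $ j - sqrt n * avg n (\<lambda>i. psi j (z i \<omega>))\<bar> = sqrt n * \<bar>D - avg n (\<lambda>i. psi j (z i \<omega>))\<bar>"
      unfolding D(1) by (simp add: abs_mult flip: right_diff_distrib)
    also have "\<dots> \<le> sqrt n * (C * (deviation n \<omega>)\<^sup>2)" by (intro mult_left_mono D(2)) simp
    finally show ?thesis by (simp add: mult_ac)
  qed
  with C \<eta> show ?thesis by blast
qed

lemma measurable_avg_obs:
  fixes f :: "quadruple \<Rightarrow> real"
  assumes "f \<in> borel_measurable borel"
  shows "(\<lambda>\<omega>. avg n (\<lambda>i. f (z i \<omega>))) \<in> borel_measurable M"
  unfolding avg_def
  by (intro borel_measurable_divide borel_measurable_sum borel_measurable_const measurable_compose[OF measurable_z assms]) simp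

text \<open>The one nonpolynomial ingredient is the matrix inverse, handled by
  \<open>borel_measurable_inv_mat\<close>.\<close>

lemma measurable_est_error:
  assumes j: "j < 3 * d + 2"
  shows "(\<lambda>\<omega>. est_error n \<omega> $ j) \<in> borel_measurable M"
proof -
  let ?T = "\<lambda>\<omega>. avg_mat (d + 1) n (\<lambda>i. T_mat md d (obs_w (z i \<omega>)))"
  let ?G = "\<lambda>\<omega>. avg_mat (d + 1) n (\<lambda>i. G_mat md mu d (obs_w (z i \<omega>)))"
  let ?h = "\<lambda>\<omega>. avg_vec (d + 1) n (\<lambda>i. h_vec md d (obs_w (z i \<omega>)) (obs_y d \<beta> (z i \<omega>)))"
  let ?b = "beta_est n"
  have w [measurable]: "obs_w \<in> borel_measurable borel"
    unfolding obs_w_def by (simp add: split_beta' borel_prod[symmetric])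
  have y [measurable]: "obs_y d \<beta> \<in> borel_measurable borel"
    by (rule growth_measurable[OF growth_obs_y])
  have t: "(\<lambda>\<omega>. avg n (\<lambda>i. t_pol md r (obs_w (z i \<omega>)))) \<in> borel_measurable M" for r
    by (rule measurable_avg_obs) simp
  have g: "(\<lambda>\<omega>. avg n (\<lambda>i. g_pol md mu r (obs_w (z i \<omega>)))) \<in> borel_measurable M" for r
    by (rule measurable_avg_obs) simp
  have h: "(\<lambda>\<omega>. avg n (\<lambda>i. obs_y d \<beta> (z i \<omega>) * t_pol md r (obs_w (z i \<omega>)))) \<in> borel_measurable M" for r
    by (rule measurable_avg_obs) simp
  have y2: "(\<lambda>\<omega>. avg n (\<lambda>i. (obs_y d \<beta> (z i \<omega>))\<^sup>2)) \<in> borel_measurable M"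
    by (rule measurable_avg_obs) simp
  have b: "(\<lambda>\<omega>. ?b \<omega> $ i) \<in> borel_measurable M" if i: "i \<le> d" for i
  proof -
    have "(\<lambda>\<omega>. if invertible_mat (?T \<omega>) then (transpose_mat (inv_mat (U_mat mu d)) *\<^sub>v (inv_mat (?T \<omega>) *\<^sub>v ?h \<omega>)) $ i else b0 n \<omega> $ i)
        \<in> borel_measurable M"
      using i inverse_carriers(1) t h
      by (intro borel_measurable_inv_mat[where m="d + 1"] b0(2))
        (auto simp: avg_mat_def avg_vec_def T_mat_def h_vec_def)
    moreover have "(\<lambda>\<omega>. if invertible_mat (?T \<omega>) then (transpose_mat (inv_mat (U_mat mu d)) *\<^sub>v (inv_mat (?T \<omega>) *\<^sub>v ?h \<omega>)) $ i else b0 n \<omega> $ i)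
        = (\<lambda>\<omega>. ?b \<omega> $ i)"
      by (rule ext) (simp add: beta_est_def beta_hat_def Let_def)
    ultimately show ?thesis by simp
  qed
  have G: "(\<lambda>\<omega>. ?G \<omega> $$ (i, k)) \<in> borel_measurable M" if "i \<le> d" "k \<le> d" for i k
    using that g by (simp add: avg_mat_def G_mat_def)
  have "(\<lambda>\<omega>. \<Sum>i<d + 1. \<Sum>k<d + 1. ?b \<omega> $ i * ?b \<omega> $ k * ?G \<omega> $$ (i, k)) \<in> borel_measurable M"
    by (intro borel_measurable_sum borel_measurable_times b G) auto
  moreover have "?b \<omega> \<bullet> (?G \<omega> *\<^sub>v ?b \<omega>) = (\<Sum>i<d + 1. \<Sum>k<d + 1. ?b \<omega> $ i * ?b \<omega> $ k * ?G \<omega> $$ (i, k))" for \<omega>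
    by (intro quadratic_form_eq_sum beta_est_carrier) (simp add: avg_mat_def)
  ultimately have "(\<lambda>\<omega>. ?b \<omega> \<bullet> (?G \<omega> *\<^sub>v ?b \<omega>)) \<in> borel_measurable M" by simp
  then have s: "(\<lambda>\<omega>. sigma2_est n \<omega>) \<in> borel_measurable M"
    unfolding sigma2_est_def sigma2_hat_def Let_def beta_est_def[symmetric] using y2 by simp
  have "(\<lambda>\<omega>. (?b \<omega> - \<beta>) $ (j - 2 * d)) \<in> borel_measurable M" if "\<not> j < 2 * d" "j < 3 * d + 1"
    using b[of "j - 2 * d"] that beta by simp
  then show ?thesis
    unfolding est_error_index[OF j] using t s by (cases "j < 2 * d"; cases "j < 3 * d + 1") simp_all
qed

text \<open>For fixed t the combination of influence functions is a single centred function, so the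
  one-dimensional limit theorem and the Slutsky bound suffice.\<close>

lemma iexp_est_error_tendsto:
  "(\<lambda>n. \<integral>\<omega>. iexp (\<Sum>j<3 * d + 2. t j * est_error n \<omega> $ j) \<partial>M) \<longlonglongrightarrow>
    of_real (exp (- (vec (3 * d + 2) t \<bullet> (asym_cov *\<^sub>v vec (3 * d + 2) t)) / 2))"
proof -
  let ?k = "3 * d + 2"
  define f where "f z = (\<Sum>j<?k. t j * psi j z)" for z
  have cf: "centered f"
    unfolding f_def[abs_def] by (intro centered_sum centered_cmult centered_psi)
  interpret V: iid_centered M "\<lambda>i \<omega>. f (z i \<omega>)" "expectation (\<lambda>\<omega>. (f (quad \<omega>))\<^sup>2)"
    by (rule iid_centered_copies[OF cf])
  have v: "vec ?k t \<bullet> (asym_cov *\<^sub>v vec ?k t) = expectation (\<lambda>\<omega>. (f (quad \<omega>))\<^sup>2)"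
    by (simp add: quadratic_form_asym_cov f_def)
  obtain C \<eta> where C: "C \<ge> 0" and \<eta>: "\<eta> > 0" and lin: "\<And>n \<omega> j. n \<ge> 1 \<Longrightarrow> deviation n \<omega> \<le> \<eta> \<Longrightarrow> j < ?k \<Longrightarrow>
      \<bar>est_error n \<omega> $ j - sqrt n * avg n (\<lambda>i. psi j (z i \<omega>))\<bar> \<le> C * sqrt n * (deviation n \<omega>)\<^sup>2"
    using est_error_linearization by blast
  note dev = second_moment_sum_avg[OF finite_deviation_set, of "\<lambda>f i \<omega>. f (z i \<omega>)" "\<lambda>f. expectation (\<lambda>\<omega>. (f (quad \<omega>))\<^sup>2)",
      OF iid_centered_copies[OF centered_deviation_set], folded deviation_def]
  show ?thesis
    unfolding v
  proof (rule slutsky_iexp[OF _ _ dev \<eta> _ _ V.clt_iexp])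
    show "(\<lambda>\<omega>. \<Sum>j<?k. t j * est_error n \<omega> $ j) \<in> borel_measurable M" for n
      by (intro borel_measurable_sum borel_measurable_times borel_measurable_const measurable_est_error) simp
    show "(\<lambda>\<omega>. sqrt n * avg n (\<lambda>i. f (z i \<omega>))) \<in> borel_measurable M" for n
      by (intro borel_measurable_times borel_measurable_const V.measurable_avg)
    show "0 \<le> (\<Sum>j<?k. \<bar>t j\<bar>) * C" using C by (intro mult_nonneg_nonneg sum_nonneg) auto
    show "\<bar>(\<Sum>j<?k. t j * est_error n \<omega> $ j) - sqrt n * avg n (\<lambda>i. f (z i \<omega>))\<bar>
        \<le> (\<Sum>j<?k. \<bar>t j\<bar>) * C * sqrt n * (deviation n \<omega>)\<^sup>2" if n: "n \<ge> 1" and e: "\<bar>deviation n \<omega>\<bar> \<le> \<eta>" for n \<omega>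
    proof -
      have lin_comb: "(\<Sum>j\<in>J. t j * a j) - s * (\<Sum>j\<in>J. t j * c j) = (\<Sum>j\<in>J. t j * (a j - s * c j))"
        for J s and a c :: "nat \<Rightarrow> real"
        by (simp add: right_diff_distrib sum_subtractf sum_distrib_left mult.left_commute)
      have eq: "(\<Sum>j<?k. t j * est_error n \<omega> $ j) - sqrt n * avg n (\<lambda>i. f (z i \<omega>)) =
          (\<Sum>j<?k. t j * (est_error n \<omega> $ j - sqrt n * avg n (\<lambda>i. psi j (z i \<omega>))))"
        unfolding f_def avg_sum avg_cmult by (rule lin_comb)
      have "\<bar>\<Sum>j<?k. t j * (est_error n \<omega> $ j - sqrt n * avg n (\<lambda>i. psi j (z i \<omega>)))\<bar> \<le>
          (\<Sum>j<?k. \<bar>t j\<bar> * (C * sqrt n * (deviation n \<omega>)\<^sup>2))"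
      proof (rule order_trans[OF sum_abs], rule sum_mono)
        fix j assume "j \<in> {..<?k}"
        then have "\<bar>est_error n \<omega> $ j - sqrt n * avg n (\<lambda>i. psi j (z i \<omega>))\<bar> \<le> C * sqrt n * (deviation n \<omega>)\<^sup>2"
          using lin[OF n] e by simp
        then show "\<bar>t j * (est_error n \<omega> $ j - sqrt n * avg n (\<lambda>i. psi j (z i \<omega>)))\<bar> \<le> \<bar>t j\<bar> * (C * sqrt n * (deviation n \<omega>)\<^sup>2)"
          unfolding abs_mult by (rule mult_left_mono) simp
      qed
      also have "\<dots> = (\<Sum>j<?k. \<bar>t j\<bar>) * (C * sqrt n * (deviation n \<omega>)\<^sup>2)"
        by (rule sum_distrib_right[symmetric])
      finally show ?thesis unfolding eq by (simp only: mult.assoc)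
    qed
  qed
qed

theorem est_error_asymptotically_normal:
  assumes "multivariate_normal (3 * d + 2) (0\<^sub>v (3 * d + 2)) asym_cov N"
  shows "converges_in_distribution M (3 * d + 2) est_error N"
  by (rule converges_in_distributionI[OF prob_space_axioms assms est_error_carrier measurable_est_error iexp_est_error_tendsto])

end

subsection \<open>Nonsingularity of the asymptotic covariance matrix\<close>

text \<open>Otherwise the open set where f is nonzero would be a neighbourhood of s, hence of
  positive mass.\<close>

lemma (in prob_space) continuous_AE_zero_on_support:
  fixes X :: "'a \<Rightarrow> real" and f :: "real \<Rightarrow> real"
  assumes [measurable]: "X \<in> borel_measurable M" and f: "continuous_on UNIV f"
    and ae: "AE \<omega> in M. f (X \<omega>) = 0" and s: "s \<in> support_of (distr M borel X)"
  shows "f s = 0"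
proof (rule ccontr)
  assume nz: "f s \<noteq> 0"
  have V: "open {t. f t \<noteq> 0}" using f by (intro open_Collect_neq) auto
  then have [measurable]: "{t. f t \<noteq> 0} \<in> sets borel" by simp
  from V s nz have "0 < emeasure (distr M borel X) {t. f t \<noteq> 0}"
    unfolding support_of_def by blast
  also have "emeasure (distr M borel X) {t. f t \<noteq> 0} = emeasure M {\<omega> \<in> space M. f (X \<omega>) \<noteq> 0}"
    by (subst emeasure_distr) (auto simp: vimage_def Int_def conj_commute)
  also have "\<dots> = 0"
    using ae by (intro emeasure_eq_0_AE) auto
  finally show False by simp
qed

lemma (in prob_space) AE_ex:
  assumes "AE \<omega> in M. P \<omega>"
  shows "\<exists>\<omega>\<in>space M. P \<omega>"
proof (rule ccontr)
  assume "\<not> ?thesis"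
  then have "AE \<omega> in M. \<not> P \<omega>" by (auto intro: AE_I2)
  with assms have "AE \<omega> in M. False" by eventually_elim simp
  then show False by simp
qed

lemma poly_zero_of_many_roots:
  fixes p :: "real poly"
  assumes "finite A" "Polynomial.degree p < card A" "\<And>s. s \<in> A \<Longrightarrow> poly p s = 0"
  shows "p = 0"
proof (rule ccontr)
  assume nz: "p \<noteq> 0"
  have "card A \<le> card {s. poly p s = 0}"
    using assms by (intro card_mono poly_roots_finite[OF nz]) auto
  also have "\<dots> \<le> Polynomial.degree p" by (rule card_poly_roots_bound[OF nz])
  finally show False using assms(2) by simp
qed

lemma quadratic_zero_of_three_roots:
  fixes a b c :: real
  assumes "finite B" "card B = 3" "\<And>s. s \<in> B \<Longrightarrow> c * s\<^sup>2 + b * s + a = 0"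
  shows "c = 0" "b = 0" "a = 0"
proof -
  have "[:a, b, c:] = 0"
    by (rule poly_zero_of_many_roots[OF assms(1)]) (use assms in \<open>auto simp: power2_eq_square algebra_simps\<close>)
  then show "c = 0" "b = 0" "a = 0" by auto
qed

context errors_in_variables
begin

lemma det_infl_mat: "det infl_mat \<noteq> 0"
proof -
  have U: "transpose_mat (U_mat mu d) \<in> carrier_mat (d + 1) (d + 1)" using U_mat_carrier[of mu d] by simp
  have "det (transpose_mat (inv_mat (U_mat mu d))) * det (transpose_mat (U_mat mu d)) = 1"
    using det_mult[OF inverse_carriers(1) U] U_mat_transpose_inverse(2)[of mu d] mu_0 by simp
  moreover have "det (inv_mat moment_mat) * det moment_mat = 1"
    using det_mult[OF inverse_carriers(2) moment_mat_carrier] inv_mat(3)[OF moment_mat_carrier det_moment_mat] by simp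
  moreover have "det infl_mat = det (transpose_mat (inv_mat (U_mat mu d))) * det (inv_mat moment_mat)"
    unfolding infl_mat_def by (rule det_mult[OF inverse_carriers(1,2)])
  ultimately show ?thesis by auto
qed

text \<open>\<open>infl_mat\<close> is a product of two inverses, so its transpose has trivial
  kernel.\<close>

lemma infl_mat_left_kernel:
  assumes "\<And>l. l \<le> d \<Longrightarrow> (\<Sum>i\<le>d. b i * infl_mat $$ (i, l)) = 0" "i \<le> d"
  shows "b i = 0"
proof -
  let ?b = "vec (d + 1) b"
  have "transpose_mat infl_mat *\<^sub>v ?b = 0\<^sub>v (d + 1)"
  proof (rule eq_vecI)
    fix l assume "l < dim_vec (0\<^sub>v (d + 1) :: real vec)"
    then have l: "l \<le> d" by simp
    have "(transpose_mat infl_mat *\<^sub>v ?b) $ l = (\<Sum>i<d + 1. infl_mat $$ (i, l) * b i)"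
      using l inverse_carriers(3) by (simp add: scalar_prod_def atLeast0LessThan)
    also have "\<dots> = (\<Sum>i\<le>d. b i * infl_mat $$ (i, l))"
      by (simp add: lessThan_Suc_atMost mult.commute)
    finally show "(transpose_mat infl_mat *\<^sub>v ?b) $ l = 0\<^sub>v (d + 1) $ l" using assms(1)[OF l] l by simp
  qed (use inverse_carriers(3) in simp)
  moreover have "det (transpose_mat infl_mat) \<noteq> 0"
    using det_infl_mat det_transpose[OF inverse_carriers(3)] by simp
  ultimately have "?b = 0\<^sub>v (d + 1)"
    using det_0_iff_vec_prod_zero[OF transpose_carrier_mat[THEN iffD2, OF inverse_carriers(3)]] vec_carrier[of "d + 1" b]
    by blast
  then have "?b $ i = 0" using assms(2) by simp
  then show ?thesis using assms(2) by simp
qed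

text \<open>Averaging over \<delta> turns each t_r into a monomial, so that coefficients can be
  compared.\<close>

lemma expectation_t_pol_combination:
  assumes "\<And>i. i \<in> I \<Longrightarrow> r i \<le> 2 * d"
  shows "expectation (\<lambda>\<omega>. \<Sum>i\<in>I. c i * t_pol md (r i) (s + \<delta> \<omega>)) = (\<Sum>i\<in>I. c i * s ^ r i)"
proof -
  have t: "integrable M (\<lambda>\<omega>. t_pol md (r i) (s + \<delta> \<omega>))" "expectation (\<lambda>\<omega>. t_pol md (r i) (s + \<delta> \<omega>)) = s ^ r i"
    if "i \<in> I" for i
    using expectation_t_pol_shift[of "r i" \<delta> md s] assms[OF that] integrable_powers(2) md by auto
  then show ?thesis by (subst Bochner_Integration.integral_sum) auto
qed

text \<open>If \<open>x\<close> takes two values on a full-measure set and the support of \<open>\<delta>\<close> contains \<open>2 d\<close> points,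
  then \<open>x + \<delta>\<close> charges neighbourhoods of at least \<open>2 d + 1\<close> points, too many for a
  nonzero polynomial of degree at most \<open>2 d\<close>.\<close>

lemma polynomial_in_w_zero:
  assumes A: "A \<subseteq> support_of (distr M borel \<delta>)" "finite A" "card A = 2 * d"
    and deg: "Polynomial.degree Q \<le> 2 * d"
    and ae: "AE \<omega> in M. poly Q (obs_w (quad \<omega>)) = 0"
  shows "Q = 0"
proof -
  have w [measurable]: "obs_w \<in> borel_measurable borel"
    unfolding obs_w_def by (simp add: split_beta' borel_prod[symmetric])
  have pQ: "poly Q \<in> borel_measurable borel"
    by (intro borel_measurable_continuous_onI continuous_intros)
  have "(\<lambda>z. poly Q (obs_w z)) \<in> borel_measurable borel"
    by (rule measurable_compose[OF w pQ])
  from AE_coordinate(1)[OF this ae]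
  have AE: "AE \<omega> in M. AE \<omega>' in M. poly Q (x \<omega> + \<delta> \<omega>') = 0" by (simp add: obs_w_def)
  have root: "poly Q (x \<omega> + s) = 0" if "AE \<omega>' in M. poly Q (x \<omega> + \<delta> \<omega>') = 0" "s \<in> A" for \<omega> s
    using that A(1)
    by (intro continuous_AE_zero_on_support[of \<delta> "\<lambda>t. poly Q (x \<omega> + t)"]) (auto intro!: continuous_intros)
  obtain \<omega>0 where \<omega>0: "AE \<omega>' in M. poly Q (x \<omega>0 + \<delta> \<omega>') = 0" using AE_ex[OF AE] by blast
  \<comment> \<open>As d >= 1, assumption (iv) excludes concentration at one point, so a second
    value of x has the same property.\<close>
  have "\<exists>\<omega>1. (AE \<omega>' in M. poly Q (x \<omega>1 + \<delta> \<omega>') = 0) \<and> x \<omega>1 \<noteq> x \<omega>0"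
  proof (rule ccontr)
    assume "\<not> ?thesis"
    with AE have "AE \<omega> in M. x \<omega> \<in> {x \<omega>0}" by (auto elim!: eventually_mono)
    moreover have "finite {x \<omega>0}" "card {x \<omega>0} \<le> d" using d by auto
    ultimately show False using nonconc by blast
  qed
  then obtain \<omega>1 where \<omega>1: "AE \<omega>' in M. poly Q (x \<omega>1 + \<delta> \<omega>') = 0" "x \<omega>1 \<noteq> x \<omega>0" by blast
  obtain s1 s2 where s: "s1 < s2" "\<And>t. t \<in> A \<Longrightarrow> poly Q (s1 + t) = 0" "\<And>t. t \<in> A \<Longrightarrow> poly Q (s2 + t) = 0"
  proof (cases "x \<omega>0 < x \<omega>1")
    case True
    show thesis by (rule that[OF True root[OF \<omega>0] root[OF \<omega>1(1)]])
  next
    case False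
    then have "x \<omega>1 < x \<omega>0" using \<omega>1(2) by simp
    show thesis by (rule that[OF \<open>x \<omega>1 < x \<omega>0\<close> root[OF \<omega>1(1)] root[OF \<omega>0]])
  qed
  have ne: "A \<noteq> {}" using A(3) d by auto
  \<comment> \<open>The translate of \<open>A\<close> by s1 gives 2 d roots; the largest point of
    the translate by s2 > s1 lies to the right of all of them.\<close>
  let ?R = "insert (s2 + Max A) ((+) s1 ` A)"
  have "s2 + Max A \<notin> (+) s1 ` A"
  proof
    assume "s2 + Max A \<in> (+) s1 ` A"
    then obtain t where "t \<in> A" "s2 + Max A = s1 + t" by auto
    with Max_ge[OF A(2) this(1)] s(1) show False by linarith
  qed
  then have "card ?R = 2 * d + 1" using A by (simp add: card_image)
  then show ?thesis
    using s A(2) deg Max_in[OF A(2) ne] by (intro poly_zero_of_many_roots[of ?R]) auto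
qed

theorem asym_cov_invertible:
  assumes A: "A \<subseteq> support_of (distr M borel \<delta>)" "finite A" "card A = 2 * d"
    and B: "B \<subseteq> support_of (distr M borel \<epsilon>)" "finite B" "card B = 3"
  shows "invertible_mat asym_cov"
proof -
  have "det asym_cov \<noteq> 0"
  proof
    assume "det asym_cov = 0"
    then obtain a where a: "a \<in> carrier_vec (3 * d + 2)" "a \<noteq> 0\<^sub>v (3 * d + 2)" "asym_cov *\<^sub>v a = 0\<^sub>v (3 * d + 2)"
      using det_0_iff_vec_prod_zero[OF asym_cov_carrier] by blast
    define F where "F z = (\<Sum>j<3 * d + 2. a $ j * psi j z)" for z
    have cF: "centered F"
      unfolding F_def[abs_def] by (intro centered_sum centered_cmult centered_psi)
    then have gF: "growth d 2 F" by (simp add: centered_def)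
    note mF = growth_measurable[OF gF]
    have "expectation (\<lambda>\<omega>. (F (quad \<omega>))\<^sup>2) = 0"
      using quadratic_form_asym_cov[OF a(1)] a by (simp add: F_def)
    then have AE_F: "AE \<omega> in M. F (quad \<omega>) = 0"
      using integral_nonneg_eq_0_iff_AE[OF square_integrable_growth[OF gF]] by simp
    define c where "c = a $ (3 * d + 1)"
    \<comment> \<open>The plug-in term of \<open>phi_sigma\<close> is a combination of the
      \<open>phi_beta\<close> and is absorbed into their coefficients.\<close>
    define b where "b i = a $ (2 * d + i) - 2 * c * (xi_moment_mat *\<^sub>v \<beta>) $ i" for i
    \<comment> \<open>Coefficients with respect to the residual functions \<open>phi_R\<close>;
      nonsingularity of \<open>infl_mat\<close> later recovers b from e.\<close>
    define e where "e l = (\<Sum>i\<le>d. b i * infl_mat $$ (i, l))" for l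
    define p where "p w = (\<Sum>l\<le>d. e l * t_pol md l w)" for w
    define S where "S w = (\<Sum>j<2 * d. a $ j * (t_pol md (j + 1) w - expectation (\<lambda>\<omega>. x \<omega> ^ (j + 1)))) -
      (\<Sum>l\<le>d. e l * (\<Sum>k\<le>d. beta_x $ k * t_pol md (l + k) w)) -
      c * (variance \<epsilon> + (\<Sum>i\<le>d. \<Sum>j\<le>d. \<beta> $ i * \<beta> $ j * g_pol md mu (i + j) w))" for w
    \<comment> \<open>Grouped in this way, F is quadratic in y with coefficients that depend on w
      alone.\<close>
    have F_eq: "F z = c * (obs_y d \<beta> z)\<^sup>2 + obs_y d \<beta> z * p (obs_w z) + S (obs_w z)" for z
    proof -
      have "F z = (\<Sum>j<2 * d. a $ j * psi j z) + (\<Sum>i<d + 1. a $ (2 * d + i) * psi (2 * d + i) z) + c * psi (3 * d + 1) z"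
      proof -
        have "{..<3 * d + 2} = insert (3 * d + 1) ({..<2 * d} \<union> (\<lambda>i. 2 * d + i) ` {..<d + 1})"
        proof (intro equalityI subsetI)
          fix j assume "j \<in> {..<3 * d + 2}"
          then have "j = 3 * d + 1 \<or> j < 2 * d \<or> (j = 2 * d + (j - 2 * d) \<and> j - 2 * d < d + 1)" by auto
          then show "j \<in> insert (3 * d + 1) ({..<2 * d} \<union> (\<lambda>i. 2 * d + i) ` {..<d + 1})" by blast
        qed auto
        moreover have "{..<2 * d} \<inter> (\<lambda>i. 2 * d + i) ` {..<d + 1} = {}"
          "3 * d + 1 \<notin> {..<2 * d} \<union> (\<lambda>i. 2 * d + i) ` {..<d + 1}" by auto
        ultimately show ?thesis
          unfolding F_def by (simp add: sum.union_disjoint sum.reindex c_def del: sum.lessThan_Suc)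
      qed
      also have "(\<Sum>j<2 * d. a $ j * psi j z) = (\<Sum>j<2 * d. a $ j * phi_T (j + 1) z)"
        by (intro sum.cong) (auto simp: psi_def)
      also have "(\<Sum>i<d + 1. a $ (2 * d + i) * psi (2 * d + i) z) = (\<Sum>i\<le>d. a $ (2 * d + i) * phi_beta i z)"
        by (intro sum.cong) (auto simp: psi_def)
      also have "psi (3 * d + 1) z = phi_sigma z" by (simp add: psi_def)
      finally have "F z = (\<Sum>j<2 * d. a $ j * phi_T (j + 1) z) + (\<Sum>i\<le>d. b i * phi_beta i z) +
          c * ((obs_y d \<beta> z)\<^sup>2 - (variance \<epsilon> + (\<Sum>i\<le>d. \<Sum>j\<le>d. \<beta> $ i * \<beta> $ j * g_pol md mu (i + j) (obs_w z))))"
        unfolding b_def phi_sigma_def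
        by (simp add: left_diff_distrib right_diff_distrib sum_subtractf sum_distrib_left mult_ac distrib_left)
      moreover have "(\<Sum>i\<le>d. b i * phi_beta i z) = (\<Sum>l\<le>d. e l * phi_R l z)"
      proof -
        have "(\<Sum>i\<le>d. b i * phi_beta i z) = (\<Sum>i\<le>d. \<Sum>l\<le>d. b i * infl_mat $$ (i, l) * phi_R l z)"
          unfolding phi_beta_def sum_distrib_left by (simp add: mult.assoc)
        also have "\<dots> = (\<Sum>l\<le>d. \<Sum>i\<le>d. b i * infl_mat $$ (i, l) * phi_R l z)" by (rule sum.swap)
        finally show ?thesis by (simp add: e_def sum_distrib_right)
      qed
      moreover have "(\<Sum>l\<le>d. e l * phi_R l z) = obs_y d \<beta> z * p (obs_w z) -
          (\<Sum>l\<le>d. e l * (\<Sum>k\<le>d. beta_x $ k * t_pol md (l + k) (obs_w z)))"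
        unfolding p_def phi_R_def by (simp only: right_diff_distrib sum_subtractf sum_distrib_left mult.left_commute)
      ultimately show ?thesis
        unfolding S_def phi_T_def by (simp add: right_diff_distrib)
    qed
    define f where "f s = (\<Sum>j\<le>d. \<beta> $ j * s ^ j)" for s
    \<comment> \<open>Substituting y = f(x + u) + \<epsilon> and freezing x, \<delta>, u gives a
      quadratic polynomial in \<epsilon> that vanishes on the support of \<epsilon>.\<close>
    have coeffs: "AE \<omega> in M. c = 0 \<and> 2 * c * f (x \<omega> + u \<omega>) + p (x \<omega> + \<delta> \<omega>) = 0 \<and>
        c * (f (x \<omega> + u \<omega>))\<^sup>2 + f (x \<omega> + u \<omega>) * p (x \<omega> + \<delta> \<omega>) + S (x \<omega> + \<delta> \<omega>) = 0"
      using AE_coordinate(2)[OF mF AE_F]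
    proof (rule eventually_mono)
      fix \<omega>
      let ?f = "f (x \<omega> + u \<omega>)" and ?w = "x \<omega> + \<delta> \<omega>"
      let ?q = "\<lambda>s. c * s\<^sup>2 + (2 * c * ?f + p ?w) * s + (c * ?f\<^sup>2 + ?f * p ?w + S ?w)"
      assume "AE \<omega>' in M. F (x \<omega>, \<delta> \<omega>, u \<omega>, \<epsilon> \<omega>') = 0"
      moreover have "F (x \<omega>, \<delta> \<omega>, u \<omega>, s) = ?q s" for s
        unfolding F_eq by (simp add: obs_y_def obs_w_def f_def[symmetric] power2_eq_square algebra_simps)
      ultimately have ae: "AE \<omega>' in M. ?q (\<epsilon> \<omega>') = 0" by simp
      have "?q s = 0" if "s \<in> B" for s
        by (rule continuous_AE_zero_on_support[where X=\<epsilon> and f="?q", OF _ _ ae]) (use that B in \<open>auto intro!: continuous_intros\<close>)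
      from quadratic_zero_of_three_roots[OF B(2,3) this]
      show "c = 0 \<and> 2 * c * ?f + p ?w = 0 \<and> c * ?f\<^sup>2 + ?f * p ?w + S ?w = 0" by blast
    qed
    have c: "c = 0" using AE_ex[OF coeffs] by blast
    have AE_p: "AE \<omega> in M. p (obs_w (quad \<omega>)) = 0"
      using coeffs by (rule eventually_mono) (simp add: c obs_w_def quad_def)
    have AE_S: "AE \<omega> in M. S (obs_w (quad \<omega>)) = 0"
      using coeffs by (rule eventually_mono) (auto simp: c obs_w_def quad_def)
    \<comment> \<open>Averaging p(w) over \<delta> leaves a polynomial of degree at most d in x, to
      which assumption (iv) applies.\<close>
    have "(\<lambda>z. p (obs_w z)) \<in> borel_measurable borel"
      unfolding p_def by (rule growth_measurable[of d 1], intro growth_sum growth_cmult growth_t_pol_obs_w(1)) simp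
    from AE_coordinate(1)[OF this AE_p]
    have "AE \<omega> in M. (\<Sum>l\<le>d. e l * x \<omega> ^ l) = 0"
    proof (rule eventually_mono)
      fix \<omega> assume "AE \<omega>' in M. p (obs_w (x \<omega>, \<delta> \<omega>', u \<omega>, \<epsilon> \<omega>)) = 0"
      then have "AE \<omega>' in M. (\<Sum>l\<le>d. e l * t_pol md l (x \<omega> + \<delta> \<omega>')) = 0"
        by (simp add: obs_w_def p_def)
      then have "expectation (\<lambda>\<omega>'. \<Sum>l\<le>d. e l * t_pol md l (x \<omega> + \<delta> \<omega>')) = 0"
        by (rule integral_eq_zero_AE)
      then show "(\<Sum>l\<le>d. e l * x \<omega> ^ l) = 0"
        by (subst (asm) expectation_t_pol_combination) auto
    qed
    then have e: "e l = 0" if "l \<le> d" for l by (rule polynomial_AE_zero) (rule that)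
    have b0: "b i = 0" if "i \<le> d" for i
    proof (rule infl_mat_left_kernel[OF _ that])
      show "(\<Sum>i\<le>d. b i * infl_mat $$ (i, l)) = 0" if "l \<le> d" for l
        using e[OF that] unfolding e_def .
    qed
    have S_eq: "S w = (\<Sum>j<2 * d. a $ j * t_pol md (j + 1) w) - (\<Sum>j<2 * d. a $ j * expectation (\<lambda>\<omega>. x \<omega> ^ (j + 1)))" for w
      unfolding S_def c by (simp add: e right_diff_distrib sum_subtractf)
    obtain P where P: "\<And>r. Polynomial.degree (P r) \<le> r" "\<And>r w. t_pol md r w = poly (P r) w"
      using t_pol_eq_poly[of _ md] by metis
    define m where "m = (\<Sum>j<2 * d. a $ j * expectation (\<lambda>\<omega>. x \<omega> ^ (j + 1)))"
    define Q where "Q = (\<Sum>j<2 * d. Polynomial.smult (a $ j) (P (j + 1))) - [:m:]"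
    have Q: "poly Q w = S w" for w
      by (simp add: Q_def S_eq poly_sum P(2) m_def)
    have "Polynomial.degree Q \<le> 2 * d"
      unfolding Q_def
    proof (intro degree_diff_le degree_sum_le)
      show "Polynomial.degree (Polynomial.smult (a $ j) (P (j + 1))) \<le> 2 * d" if "j \<in> {..<2 * d}" for j
        using P(1)[of "j + 1"] that degree_smult_le[of "a $ j" "P (j + 1)"] by simp
    qed auto
    then have "Q = 0" using AE_S by (intro polynomial_in_w_zero[OF A]) (simp_all add: Q)
    then have S0: "S w = 0" for w using Q[of w] by simp
    \<comment> \<open>As S vanishes at every real point, \<delta> can be averaged out at any shift
      s, which turns t_(j+1) into s^(j+1).\<close>
    have zero: "(\<Sum>j<2 * d. a $ j * s ^ (j + 1)) = m" for s
    proof -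
      have "expectation (\<lambda>\<omega>. \<Sum>j<2 * d. a $ j * t_pol md (j + 1) (s + \<delta> \<omega>)) = expectation (\<lambda>\<omega>. m)"
        using S0 by (intro Bochner_Integration.integral_cong refl) (simp add: S_eq m_def)
      then show ?thesis
        by (subst (asm) expectation_t_pol_combination) (auto simp: prob_space)
    qed
    \<comment> \<open>The exponents start at 1, so the constant m does not interfere with the
      coefficients a_j.\<close>
    define R where "R = (\<Sum>j<2 * d. Polynomial.monom (a $ j) (j + 1)) - [:m:]"
    have "poly R s = poly 0 s" for s
      using zero[of s] by (simp add: R_def poly_sum poly_monom)
    then have "R = 0" by (simp add: poly_eq_poly_eq_iff[symmetric] fun_eq_iff)
    have a1: "a $ j = 0" if "j < 2 * d" for j
    proof -
      have "Polynomial.coeff R (j + 1) = a $ j"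
        using that by (simp add: R_def Polynomial.coeff_sum)
      with \<open>R = 0\<close> show ?thesis by simp
    qed
    have "a $ j = 0" if "j < 3 * d + 2" for j
    proof -
      consider "j < 2 * d" | "2 * d \<le> j" "j \<le> 3 * d" | "j = 3 * d + 1"
        using \<open>j < 3 * d + 2\<close> by linarith
      then show ?thesis
      proof cases
        case 1 then show ?thesis by (rule a1)
      next
        case 2 then show ?thesis using b0[of "j - 2 * d"] c by (simp add: b_def)
      next
        case 3 then show ?thesis using c by (simp add: c_def)
      qed
    qed
    then have "a = 0\<^sub>v (3 * d + 2)" using a(1) by (intro eq_vecI) auto
    with a(2) show False by simp
  qed
  then show ?thesis using invertible_mat_iff_det[OF asym_cov_carrier] by simp
qed

end

section \<open>Transfer to the observed sample\<close>

theorem theorem3p1: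
  fixes M :: "'a measure"
    and d :: nat
    and \<beta> :: "real vec"
    and x \<delta> u \<epsilon> :: "'a \<Rightarrow> real"
    and xs ds us es w \<xi> y :: "nat \<Rightarrow> 'a \<Rightarrow> real"
    and md mu :: "nat \<Rightarrow> real"
    and b0 :: "nat \<Rightarrow> 'a \<Rightarrow> real vec"
  assumes prob: "prob_space M"
    and d: "d \<ge> 1"
    and beta: "\<beta> \<in> carrier_vec (d + 1)"
    \<comment> \<open>(i)\<close>
    and indep: "prob_space.indep_vars M (\<lambda>_. borel) (\<lambda>j. [x, \<delta>, u, \<epsilon>] ! j) {..<4::nat}"
    \<comment> \<open>(ii)\<close>
    and mean0: "integral\<^sup>L M \<delta> = 0" "integral\<^sup>L M u = 0" "integral\<^sup>L M \<epsilon> = 0"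
    and mom: "integrable M (\<lambda>\<omega>. \<epsilon> \<omega> ^ 2 + \<delta> \<omega> ^ (2 * d) + u \<omega> ^ (2 * d) + x \<omega> ^ (2 * d))"
    \<comment> \<open>(iii)\<close>
    and md: "\<And>k. md k = (\<integral>\<omega>. \<delta> \<omega> ^ k \<partial>M)"
    and mu: "\<And>k. mu k = (\<integral>\<omega>. u \<omega> ^ k \<partial>M)"
    \<comment> \<open>(iv)\<close>
    and nonconc: "\<not> (\<exists>A. finite A \<and> card A \<le> d \<and> (AE \<omega> in M. x \<omega> \<in> A))"
    \<comment> \<open>(v)\<close>
    and mom4: "integrable M (\<lambda>\<omega>. x \<omega> ^ (4 * d) + \<delta> \<omega> ^ (4 * d) + u \<omega> ^ (4 * d) + \<epsilon> \<omega> ^ 4)"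
    \<comment> \<open>i.i.d. copies and the observations\<close>
    and copies_indep:
      "prob_space.indep_vars M (\<lambda>_. borel) (\<lambda>i \<omega>. (xs i \<omega>, ds i \<omega>, us i \<omega>, es i \<omega>)) {1..}"
    and copies_distr:
      "\<And>i. i \<ge> 1 \<Longrightarrow> distr M borel (\<lambda>\<omega>. (xs i \<omega>, ds i \<omega>, us i \<omega>, es i \<omega>)) =
                      distr M borel (\<lambda>\<omega>. (x \<omega>, \<delta> \<omega>, u \<omega>, \<epsilon> \<omega>))"
    and w: "\<And>i \<omega>. w i \<omega> = xs i \<omega> + ds i \<omega>"
    and xi: "\<And>i \<omega>. \<xi> i \<omega> = xs i \<omega> + us i \<omega>"
    and y: "\<And>i \<omega>. y i \<omega> = (\<Sum>j\<le>d. \<beta> $ j * \<xi> i \<omega> ^ j) + es i \<omega>"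
    \<comment> \<open>arbitrary values of the regression estimator where its formula is not defined\<close>
    and b0: "\<And>n \<omega>. b0 n \<omega> \<in> carrier_vec (d + 1)"
            "\<And>n j. j \<le> d \<Longrightarrow> (\<lambda>\<omega>. b0 n \<omega> $ j) \<in> borel_measurable M"
  shows "\<exists>\<Sigma>. covariance_mat (3 * d + 2) \<Sigma> \<and>
     (\<exists>N. multivariate_normal (3 * d + 2) (0\<^sub>v (3 * d + 2)) \<Sigma> N \<and>
        converges_in_distribution M (3 * d + 2)
          (\<lambda>n \<omega>. let wo = (\<lambda>i. w i \<omega>); yo = (\<lambda>i. y i \<omega>) in
             sqrt (real n) \<cdot>\<^sub>v
               ((mx_hat md d n wo - vec (2 * d) (\<lambda>k. \<integral>\<omega>'. x \<omega>' ^ (k + 1) \<partial>M))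
                @\<^sub>v (beta_hat md mu d (b0 n \<omega>) n wo yo - \<beta>)
                @\<^sub>v vec 1 (\<lambda>_. sigma2_hat md mu d (b0 n \<omega>) n wo yo - prob_space.variance M \<epsilon>)))
          N) \<and>
     ((\<exists>A. A \<subseteq> support_of (distr M borel \<delta>) - {0} \<and> finite A \<and> card A = 2 * d) \<and>
      (\<exists>B. B \<subseteq> support_of (distr M borel \<epsilon>) \<and> finite B \<and> card B = 3)
      \<longrightarrow> invertible_mat \<Sigma>)"
proof -
  interpret E: errors_in_variables M d x \<delta> u \<epsilon> md mu \<beta>
    unfolding errors_in_variables_def errors_in_variables_axioms_def
    using prob d beta indep mean0 md mu nonconc mom4 by blast
  \<comment> \<open>Bundles each copy into one quadruple, so that w and y become fixed functions of
    it.\<close>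
  define z where "z i \<omega> = (xs i \<omega>, ds i \<omega>, us i \<omega>, es i \<omega>)" for i \<omega>
  have quad: "E.quad = (\<lambda>\<omega>. (x \<omega>, \<delta> \<omega>, u \<omega>, \<epsilon> \<omega>))"
    by (simp add: E.quad_def[abs_def])
  interpret S: errors_in_variables_sample M d x \<delta> u \<epsilon> md mu \<beta> z b0
  proof
    show "E.indep_vars (\<lambda>_. borel) z {1..}" using copies_indep by (simp add: z_def[abs_def])
    show "distr M borel (z i) = distr M borel E.quad" if "i \<ge> 1" for i
      using copies_distr[OF that] by (simp add: quad z_def[abs_def])
  qed (use b0 in auto)
  have w': "w i \<omega> = obs_w (z i \<omega>)" for i \<omega> by (simp add: w z_def obs_w_def)
  have y': "y i \<omega> = obs_y d \<beta> (z i \<omega>)" for i \<omega> by (simp add: y xi z_def obs_y_def)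
  obtain N where N: "multivariate_normal (3 * d + 2) (0\<^sub>v (3 * d + 2)) E.asym_cov N"
    using multivariate_normal_exists[OF E.covariance_mat_asym_cov] by blast
  have "converges_in_distribution M (3 * d + 2) S.est_error N"
    by (rule S.est_error_asymptotically_normal[OF N])
  then have conv: "converges_in_distribution M (3 * d + 2)
      (\<lambda>n \<omega>. let wo = (\<lambda>i. w i \<omega>); yo = (\<lambda>i. y i \<omega>) in
             sqrt (real n) \<cdot>\<^sub>v
               ((mx_hat md d n wo - vec (2 * d) (\<lambda>k. \<integral>\<omega>'. x \<omega>' ^ (k + 1) \<partial>M))
                @\<^sub>v (beta_hat md mu d (b0 n \<omega>) n wo yo - \<beta>)
                @\<^sub>v vec 1 (\<lambda>_. sigma2_hat md mu d (b0 n \<omega>) n wo yo - prob_space.variance M \<epsilon>))) N"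
    unfolding S.est_error_def[abs_def] S.beta_est_def S.sigma2_est_def Let_def w' y' .
  have inv: "invertible_mat E.asym_cov"
    if "\<exists>A. A \<subseteq> support_of (distr M borel \<delta>) - {0} \<and> finite A \<and> card A = 2 * d"
      "\<exists>B. B \<subseteq> support_of (distr M borel \<epsilon>) \<and> finite B \<and> card B = 3"
  proof -
    from that obtain A B where "A \<subseteq> support_of (distr M borel \<delta>) - {0}" "finite A" "card A = 2 * d"
      "B \<subseteq> support_of (distr M borel \<epsilon>)" "finite B" "card B = 3" by blast
    then show ?thesis by (intro E.asym_cov_invertible[of A B]) auto
  qed
  show ?thesis
    using E.covariance_mat_asym_cov N conv inv by blast
qed

end
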